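(* Consider the learning problem $F_\lambda=(\mathcal X_\lambda,\mathcal Y_\lambda,\mathcal D_\lambda,\mathcal H_\lambda)$ defined in the context. Any efficient (polynomial-time) learner that outputs models with at most $\alpha/2$ (bits of) parameters cannot $\varepsilon$-learn $F_\lambda$ for $\varepsilon<1/3$.
   Context: **Learning.** A family of learning problems is $\{F_\lambda=(\mathcal X_\lambda,\mathcal Y_\lambda,\mathcal D_\lambda,\mathcal H_\lambda)\}_{\lambda\in\mathbb N}$, where $\mathcal H_\lambda$ is a set of functions $\mathcal X_\lambda\to\mathcal Y_\lambda$ and $\mathcal D_\lambda$ is a set of distributions supported on $\mathcal X_\lambda$; elements of $\mathcal X_\lambda,\mathcal Y_\lambda$ are represented with $\mathrm{poly}(\lambda)$ bits. A learner $L$ takes a labeled set $\mathcal S^h=\{(x,h(x)):x\in\mathcal S\}$ and $\lambda$, and outputs a function $f$ (not necessarily in $\mathcal H_\lambda$). Let $\mathrm{Risk}(h,D,f)=\Pr_{x\leftarrow D}[h(x)\neq f(x)]$. For a function $\varepsilon(\cdot,\cdot)$, $L$ $\varepsilon$-learns the family if for all $\lambda\in\mathbb N$, $D_\lambda\in\mathcal D_\lambda$, $h\in\mathcal H_\lambda$ and all sample sizes $N\in\mathbb N$, $$\mathbf E_{\mathcal S\leftarrow D_\lambda^N,\ f\leftarrow L(\mathcal S^h,\lambda)}[\mathrm{Risk}(h,D_\lambda,f)]\le\varepsilon(\lambda,N).$$ $L$ outputs models with at most $p(\cdot)$ bits of parameters if $|\mathrm{Supp}(L(\cdot,\lambda))|\le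 2^{p(\lambda)}$ for all $\lambda$, i.e. the set of possible outputs of $L(\cdot,\lambda)$ has size at most $2^{p(\lambda)}$. $L$ runs in polynomial time (is efficient) if there is a polynomial $\mathrm{poly}$ such that for all $\lambda$ and all labeled sets $\mathcal S$ the running time of $L(\mathcal S,\lambda)$ is at most $\mathrm{poly}(|\mathcal S|\cdot\lambda)$. **Building blocks.** The parameters $n<\lambda<\alpha<\beta$ are given, with $n,\alpha,\beta$ polynomial in $\lambda$ (e.g. $n=\lambda^{0.1}$, $\alpha=\lambda^5$, $\beta=\lambda^{10}$). A function of $\lambda$ is negligible if for every polynomial $p$ it is smaller than $1/p(\lambda)$ for all sufficiently large $\lambda$. The min-entropy of $X$ is $H_\infty(X)=-\log_2\max_\omega\Pr[X=\omega]$. $U_r$ is the uniform distribution on $\{0,1\}^r$. For a vector $x$ and a set $\mathcal S$ of coordinates, $x|_{\mathcal S}$ is the restriction of $x$ to $\mathcal S$. - A pseudorandom generator (PRG) is a function $f:\{0,1\}^\lambda\to\{0,1\}^{a}$, $a>\lambda$, such that for every probabilistic polynomial-time algorithm $A$, $|\Pr_{x\leftarrow\{0,1\}^\lambda}[A(f(x))=1]-\Pr_{y\leftarrow\{0,1\}^{a}}[A(y)=1]|$ is negligible in $\lambda$. Let $f_1:\{0,1\}^\lambda\to\{0,1\}^\alpha$ and $f_2:\{0,1\}^\lambda\to\{0,1\}^\beta$ be PRGs. - $\mathrm{Enc}:\mathbb F_{2^\ell}^k\to\mathbb F_{2^\ell}^n$ is the Reed–Solomon (RS) encoding over $\mathbb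 F_{2^\ell}$, for some $\ell=\Theta(\log\lambda)$: the message gives the coefficients of a polynomial of degree at most $k-1$, and the codeword is its list of values at $n$ fixed distinct field elements. The rate $R=k/n$ is any constant $<1/3$, and $k$ is determined by $R$ and $n$. - Sampler fact: for any $0<\kappa_1,\kappa_2<1$ and $M,t\in\mathbb N$ there is a deterministic sampler $\mathsf{samp}:\{0,1\}^r\to\binom{\{1,\dots,M\}}{t}$ (values are subsets of size $t$) with $r=\Theta(M^{\kappa_2})$ such that, if $X$ is a random variable over $\{0,1\}^M$ with min-entropy $\ge\mu M$, there is a random variable $Y$ over $\{0,1\}^t$ with min-entropy $\ge(\mu-\kappa_1)t$ such that the statistical distance between $(U_r,X|_{\mathsf{samp}(U_r)})$ and $(U_r,Y)$ is at most $\exp(-\Theta(M\kappa_1))+\exp(-M^{\kappa_2})$ (the two $U_r$ in the first pair are the same sample). Let $\mathsf{samp}_1:\{0,1\}^{r_1}\to\binom{\{1,\dots,\alpha\}}{k\ell}$ and $\mathsf{samp}_2:\{0,1\}^{r_2}\to\binom{\{1,\dots,\beta\}}{n\ell}$ be samplers given by this fact with sufficiently small $\kappa_1$ and $\kappa_2$ (e.g. $\kappa_1=\Theta(1/\log\lambda)$ and $\kappa_2$ a sufficiently small constant); $\kappa_1,\kappa_2$ determine $r_1,r_2$. - For a binary string $v$, $[v]$ is an arbitrary error-correcting encoding of $v$ over $\mathbb F_{2^\ell}$ that can correct more than $(1-R)n/2$ errors (e.g. an RS encoding of suitable rate). **The learning problem.** $\mathcal Y_\lambda=\{0,1\}$.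 $\mathcal D_\lambda=\{D_s:s\in\{0,1\}^\lambda\}$, where $D_s$ is the distribution of $$x=\big([u_1],\,[u_2],\,m,\,\mathrm{Enc}(m)+f_2(s)|_{\mathsf{samp}_2(u_2)}\big)$$ with $u_1,u_2,m$ sampled uniformly at random from $\{0,1\}^{r_1}$, $\{0,1\}^{r_2}$, $\mathbb F_{2^\ell}^k$ respectively; $f_2(s)|_{\mathsf{samp}_2(u_2)}$ is interpreted as a vector over $\mathbb F_{2^\ell}$ and the addition is coordinate-wise over $\mathbb F_{2^\ell}$. $\mathcal X_\lambda$ is implicitly defined by $\mathcal D_\lambda$. $\mathcal H_\lambda=\{h_s:s\in\{0,1\}^\lambda\}$ with $h_s(x)=\langle m,\,f_1(s)|_{\mathsf{samp}_1(u_1)}\rangle$, where the inner product is over $\mathbb F_2$ and $m$ is interpreted as a string in $\mathbb F_2^{k\ell}$ in the natural way.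
   Formalization: Added: the PRGs, samplers, Enc, the encoding [v] and the length parameters are polynomial-time computable, and the learner's output model is polynomial-time evaluable; the bound ε ≥ 1/3 is asserted for all large λ and all sample sizes N polynomial in λ. *)

theory Defs
  imports
    "HOL-Probability.Probability"
    "HOL-Computational_Algebra.Polynomial"
    "HOL-Library.Landau_Symbols"
    "HOL-Algebra.Ring"
begin

definition bitstrings :: "nat \<Rightarrow> bool list set" where
  "bitstrings r = {v. length v = r}"

definition unif :: "nat \<Rightarrow> bool list pmf" where
  "unif r = pmf_of_set (bitstrings r)"

definition min_entropy :: "'a pmf \<Rightarrow> real" where
  "min_entropy X = - log 2 (SUP \<omega>. pmf X \<omega>)"

definition stat_dist :: "'a pmf \<Rightarrow> 'a pmf \<Rightarrow> real" where
  "stat_dist p q = (SUP A. \<bar>measure_pmf.prob p A - measure_pmf.prob q A\<bar>)"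

definition negligible :: "(nat \<Rightarrow> real) \<Rightarrow> bool" where
  "negligible g \<longleftrightarrow>
     (\<forall>p :: nat poly. p \<noteq> 0 \<longrightarrow> (\<forall>\<^sub>F l in sequentially. g l < 1 / real (poly p l)))"

definition poly_related :: "(nat \<Rightarrow> nat) \<Rightarrow> bool" where
  "poly_related g \<longleftrightarrow>
     (\<exists>a b :: real. 0 < a \<and>
        (\<forall>\<^sub>F l in sequentially. real l powr a \<le> real (g l) \<and> real (g l) \<le> real l powr b))"

text \<open>
  The machine model: structured programs over registers that hold bit strings and are used as
  stacks. Every step lengthens a register by at most one bit, so that, with the costs below, the
  model is polynomially equivalent to probabilistic Turing machines (a tape is a pair of stacks).
  \<open>Call i c js\<close> runs \<open>c\<close> on fresh registers loaded with copies of the registers \<open>js\<close>, and stores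
  the result in register \<open>i\<close>; copying is charged by length, and there is no recursion.
\<close>

datatype com =
    Skip
  | Push bool nat
  | Pop nat
  | Flip nat
  | Seq com com
  | Case nat com com com  \<comment> \<open>register empty / starts with \<open>False\<close> / starts with \<open>True\<close>\<close>
  | While nat com      | Call nat com "nat list"

type_synonym store = "nat \<Rightarrow> bool list"

definition load :: "bool list list \<Rightarrow> store" where
  "load vs = (\<lambda>i. if i < length vs then vs ! i else [])"

partial_function (spmf) loop ::
  "nat \<Rightarrow> (store \<Rightarrow> (store \<times> nat) spmf) \<Rightarrow> store \<Rightarrow> (store \<times> nat) spmf" where
  "loop i body s =
     (if s i = [] then return_spmf (s, 1)
      else bind_spmf (body s) (\<lambda>(s1, t1).
           bind_spmf (loop i body s1) (\<lambda>(s2, t2). return_spmf (s2, 1 + t1 + t2))))"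

text \<open>The result is the final store with the number of steps; nontermination is missing mass.\<close>

primrec exec :: "com \<Rightarrow> store \<Rightarrow> (store \<times> nat) spmf" where
  "exec Skip s = return_spmf (s, 1)"
| "exec (Push b i) s = return_spmf (s(i := b # s i), 1)"
| "exec (Pop i) s = return_spmf (s(i := tl (s i)), 1)"
| "exec (Flip i) s = map_spmf (\<lambda>b. (s(i := b # s i), 1)) coin_spmf"
| "exec (Seq c d) s =
     bind_spmf (exec c s) (\<lambda>(s1, t1).
     bind_spmf (exec d s1) (\<lambda>(s2, t2). return_spmf (s2, t1 + t2)))"
| "exec (Case i c0 c1 c2) s =
     map_spmf (\<lambda>(s', t). (s', 1 + t))
       (case s i of [] \<Rightarrow> exec c0 s | b # _ \<Rightarrow> if b then exec c2 s else exec c1 s)"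
| "exec (While i c) s = loop i (exec c) s"
| "exec (Call i c js) s =
     map_spmf (\<lambda>(s', t). (s(i := s' 0),
                          1 + (\<Sum>j\<leftarrow>js. length (s j)) + t + length (s' 0)))
       (exec c (load (map s js)))"

definition run :: "com \<Rightarrow> bool list list \<Rightarrow> bool list spmf" where
  "run c vs = map_spmf (\<lambda>(s, t). s 0) (exec c (load vs))"

definition runs_within :: "com \<Rightarrow> bool list list \<Rightarrow> nat \<Rightarrow> bool" where
  "runs_within c vs T \<longleftrightarrow>
     lossless_spmf (exec c (load vs)) \<and> (\<forall>(s, t) \<in> set_spmf (exec c (load vs)). t \<le> T)"

definition input_size :: "bool list list \<Rightarrow> nat" where
  "input_size vs = (\<Sum>v\<leftarrow>vs. length v)"

definition ppt :: "com \<Rightarrow> bool" where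
  "ppt c \<longleftrightarrow> (\<exists>p :: nat poly. \<forall>vs. runs_within c vs (poly p (input_size vs)))"

text \<open>\<open>f\<close>, with inputs from \<open>A\<close> written as \<open>inp\<close>, is computable in deterministic polynomial time:
  the output is the same for all coin tosses, so they may as well be fixed.\<close>

definition poly_time :: "('a \<Rightarrow> bool list list) \<Rightarrow> ('a \<Rightarrow> bool list) \<Rightarrow> 'a set \<Rightarrow> bool" where
  "poly_time inp f A \<longleftrightarrow>
     (\<exists>c. \<exists>p :: nat poly. \<forall>a\<in>A.
        runs_within c (inp a) (poly p (input_size (inp a))) \<and> run c (inp a) = return_spmf (f a))"

definition unary :: "nat \<Rightarrow> bool list" where
  "unary l = replicate l True"

definition encode_list :: "bool list list \<Rightarrow> bool list" where
  "encode_list ws = concat (map (\<lambda>w. concat (map (\<lambda>b. [True, b]) w) @ [False]) ws)"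

text \<open>The security parameter is the seed length; as usual, distinguishers get it in unary.\<close>

definition prg :: "(nat \<Rightarrow> nat) \<Rightarrow> (bool list \<Rightarrow> bool list) \<Rightarrow> bool" where
  "prg a f \<longleftrightarrow>
     (\<forall>\<^sub>F l in sequentially. l < a l) \<and>
     (\<forall>x. length (f x) = a (length x)) \<and>
     poly_time (\<lambda>x. [x]) f UNIV \<and>
     (\<forall>A. ppt A \<longrightarrow> negligible (\<lambda>l.
        \<bar>spmf (bind_pmf (unif l) (\<lambda>x. run A [unary l, f x])) [True]
         - spmf (bind_pmf (unif (a l)) (\<lambda>y. run A [unary l, y])) [True]\<bar>))"

definition risk :: "('x \<Rightarrow> bool) \<Rightarrow> 'x pmf \<Rightarrow> ('x \<Rightarrow> bool) \<Rightarrow> real" where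
  "risk h D f = measure_pmf.prob D {x. h x \<noteq> f x}"

definition label :: "('x \<Rightarrow> bool) \<Rightarrow> 'x list \<Rightarrow> ('x \<times> bool) list" where
  "label h S = map (\<lambda>x. (x, h x)) S"

type_synonym 'x learner = "nat \<Rightarrow> ('x \<times> bool) list \<Rightarrow> ('x \<Rightarrow> bool) pmf"

definition eps_learns ::
  "(nat \<Rightarrow> 'x pmf set) \<Rightarrow> (nat \<Rightarrow> ('x \<Rightarrow> bool) set) \<Rightarrow> 'x learner \<Rightarrow> (nat \<Rightarrow> nat \<Rightarrow> real) \<Rightarrow> bool"
where
  "eps_learns Ds Hs L \<epsilon> \<longleftrightarrow>
     (\<forall>l. \<forall>D\<in>Ds l. \<forall>h\<in>Hs l. \<forall>N.
        measure_pmf.expectation (bind_pmf (replicate_pmf N D) (\<lambda>S. L l (label h S))) (risk h D)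
          \<le> \<epsilon> l N)"

definition labeled_sets :: "(nat \<Rightarrow> 'x set) \<Rightarrow> nat \<Rightarrow> ('x \<times> bool) list set" where
  "labeled_sets X l = lists (X l \<times> UNIV)"

definition outputs_bits :: "(nat \<Rightarrow> 'x set) \<Rightarrow> 'x learner \<Rightarrow> (nat \<Rightarrow> real) \<Rightarrow> bool" where
  "outputs_bits X L p \<longleftrightarrow>
     (\<forall>l. finite (\<Union>S\<in>labeled_sets X l. set_pmf (L l S)) \<and>
          real (card (\<Union>S\<in>labeled_sets X l. set_pmf (L l S))) \<le> 2 powr p l)"

definition encode_data :: "('x \<Rightarrow> bool list) \<Rightarrow> ('x \<times> bool) list \<Rightarrow> bool list" where
  "encode_data rep S = encode_list (concat (map (\<lambda>(x, b). [rep x, [b]]) S))"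

text \<open>
  An efficient learner prints a description \<open>w\<close> of its model, which denotes the function
  \<open>ev l w\<close>; \<open>ev\<close> is an arbitrary polynomial-time evaluation procedure (for instance, \<open>w\<close> is a
  circuit). Without efficient evaluation the notion would degenerate: a description could tell the
  evaluator to search for the best hypothesis on the sample. The models are functions on \<open>X l\<close>.
  The summands \<open>1\<close> in the running time avoid a constant time bound on the empty sample.
\<close>

definition efficient_learner :: "('x \<Rightarrow> bool list) \<Rightarrow> (nat \<Rightarrow> 'x set) \<Rightarrow> 'x learner \<Rightarrow> bool" where
  "efficient_learner rep X L \<longleftrightarrow>
     (\<exists>ev c. \<exists>p :: nat poly.
        poly_time (\<lambda>(l, w, x). [unary l, w, rep x]) (\<lambda>(l, w, x). [ev l w x])
          {(l, w, x). x \<in> X l} \<and>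
        (\<forall>l. \<forall>S\<in>labeled_sets X l.
           runs_within c [unary l, encode_data rep S] (poly p ((length S + 1) * (l + 1))) \<and>
           map_spmf (\<lambda>w. restrict (ev l w) (X l)) (run c [unary l, encode_data rep S])
             = spmf_of_pmf (L l S)))"

definition hamming :: "'a list \<Rightarrow> 'a list \<Rightarrow> nat" where
  "hamming v w = card {i. i < length v \<and> v ! i \<noteq> w ! i}"

text \<open>\<open>C\<close> encodes \<open>msgs\<close> over the alphabet \<open>A\<close> so that any \<open>e\<close> errors can be corrected.\<close>

definition corrects :: "'m set \<Rightarrow> 'a set \<Rightarrow> ('m \<Rightarrow> 'a list) \<Rightarrow> nat \<Rightarrow> bool" where
  "corrects msgs A C e \<longleftrightarrow>
     (\<exists>N dec. \<forall>v\<in>msgs. length (C v) = N \<and> set (C v) \<subseteq> A \<and>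
        (\<forall>w. length w = N \<and> set w \<subseteq> A \<and> hamming w (C v) \<le> e \<longrightarrow> dec w = v))"

text \<open>\<open>F\<close> is the field with \<open>2 ^ b\<close> elements in an \<open>\<F>\<^sub>2\<close>-basis: its elements are the \<open>b\<close>-bit
  strings, added bitwise.\<close>

definition binary_field :: "nat \<Rightarrow> bool list ring \<Rightarrow> bool" where
  "binary_field b F \<longleftrightarrow>
     field F \<and> carrier F = bitstrings b \<and>
     (\<forall>v\<in>carrier F. \<forall>w\<in>carrier F. v \<oplus>\<^bsub>F\<^esub> w = map2 (\<noteq>) v w)"

definition vectors :: "('a, 'b) ring_scheme \<Rightarrow> nat \<Rightarrow> 'a list set" where
  "vectors F j = {v. length v = j \<and> set v \<subseteq> carrier F}"

definition rs_encode :: "('a, 'b) ring_scheme \<Rightarrow> (nat \<Rightarrow> 'a) \<Rightarrow> nat \<Rightarrow> 'a list \<Rightarrow> 'a list" where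
  "rs_encode F pt n m =
     map (\<lambda>i. \<Oplus>\<^bsub>F\<^esub>j\<in>{..<length m}. m ! j \<otimes>\<^bsub>F\<^esub> (pt i [^]\<^bsub>F\<^esub> j)) [0..<n]"

definition chunks :: "nat \<Rightarrow> nat \<Rightarrow> 'a list \<Rightarrow> 'a list list" where
  "chunks b j v = map (\<lambda>i. take b (drop (i * b) v)) [0..<j]"

text \<open>Coordinates are numbered from \<open>0\<close>, and \<open>nths v A\<close> is the restriction of \<open>v\<close> to \<open>A\<close>. The
  approximating variable may depend on the seed, and has the min-entropy for each seed.\<close>

definition sampler ::
  "nat \<Rightarrow> nat \<Rightarrow> nat \<Rightarrow> (bool list \<Rightarrow> nat set) \<Rightarrow> real \<Rightarrow> real \<Rightarrow> bool" where
  "sampler r M t samp \<kappa> \<delta> \<longleftrightarrow>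
     (\<forall>u\<in>bitstrings r. samp u \<subseteq> {..<M} \<and> card (samp u) = t) \<and>
     (\<forall>X \<mu>. set_pmf X \<subseteq> bitstrings M \<and> \<mu> * real M \<le> min_entropy X \<longrightarrow>
        (\<exists>Y. (\<forall>u\<in>bitstrings r. set_pmf (Y u) \<subseteq> bitstrings t \<and>
                (\<mu> - \<kappa>) * real t \<le> min_entropy (Y u)) \<and>
             stat_dist
               (bind_pmf (unif r) (\<lambda>u. map_pmf (\<lambda>v. (u, nths v (samp u))) X))
               (bind_pmf (unif r) (\<lambda>u. map_pmf (\<lambda>y. (u, y)) (Y u))) \<le> \<delta>))"

definition indicator_string :: "nat \<Rightarrow> nat set \<Rightarrow> bool list" where
  "indicator_string M A = map (\<lambda>i. i \<in> A) [0..<M]"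

definition sampler_family ::
  "(nat \<Rightarrow> nat) \<Rightarrow> (nat \<Rightarrow> nat) \<Rightarrow> (nat \<Rightarrow> nat) \<Rightarrow> (nat \<Rightarrow> bool list \<Rightarrow> nat set) \<Rightarrow>
   (nat \<Rightarrow> real) \<Rightarrow> real \<Rightarrow> bool" where
  "sampler_family r M t samp \<kappa>1 \<kappa>2 \<longleftrightarrow>
     (\<lambda>l. real (r l)) \<in> \<Theta>(\<lambda>l. real (M l) powr \<kappa>2) \<and>
     (\<exists>c>0. \<forall>\<^sub>F l in sequentially.
        sampler (r l) (M l) (t l) (samp l) (\<kappa>1 l)
          (exp (- c * real (M l) * \<kappa>1 l) + exp (- (real (M l) powr \<kappa>2)))) \<and>
     poly_time (\<lambda>(l, u). [unary l, u]) (\<lambda>(l, u). indicator_string (M l) (samp l u))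
       {(l, u). u \<in> bitstrings (r l)}"

record blocks =
  alpha :: "nat \<Rightarrow> nat"
  beta :: "nat \<Rightarrow> nat"
  code_len :: "nat \<Rightarrow> nat"                         \<comment> \<open>\<open>n\<close>\<close>
  rate :: real                                    \<comment> \<open>\<open>R\<close>\<close>
  sym_len :: "nat \<Rightarrow> nat"                          \<comment> \<open>\<open>\<ell>\<close>\<close>
  fld :: "nat \<Rightarrow> bool list ring"                   \<comment> \<open>\<open>\<F>\<close> of order \<open>2 ^ \<ell>\<close>\<close>
  eval_pt :: "nat \<Rightarrow> nat \<Rightarrow> bool list"
  ecc :: "nat \<Rightarrow> bool list \<Rightarrow> bool list list"      \<comment> \<open>the encoding \<open>[v]\<close>\<close>
  prg1 :: "bool list \<Rightarrow> bool list"
  prg2 :: "bool list \<Rightarrow> bool list"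
  kappa1 :: "nat \<Rightarrow> real"
  kappa2 :: real
  seed1 :: "nat \<Rightarrow> nat"                            \<comment> \<open>\<open>r\<^sub>1\<close>\<close>
  seed2 :: "nat \<Rightarrow> nat"                            \<comment> \<open>\<open>r\<^sub>2\<close>\<close>
  samp1 :: "nat \<Rightarrow> bool list \<Rightarrow> nat set"
  samp2 :: "nat \<Rightarrow> bool list \<Rightarrow> nat set"

definition msg_len :: "blocks \<Rightarrow> nat \<Rightarrow> nat" where
  "msg_len B l = nat \<lfloor>rate B * real (code_len B l)\<rfloor>"

definition Enc :: "blocks \<Rightarrow> nat \<Rightarrow> bool list list \<Rightarrow> bool list list" where
  "Enc B l m = rs_encode (fld B l) (eval_pt B l) (code_len B l) m"

text \<open>
  "Sufficiently small" is read as: \<open>kappa1\<close> is eventually at most \<open>1/4\<close>, and \<open>kappa2\<close> is any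
  constant in \<open>(0,1)\<close>. The condition that \<open>alpha * kappa1\<close> dominates \<open>ln\<close> keeps the error of the
  sampler negligible; it holds in particular for \<open>kappa1\<close> of order \<open>1 / ln l\<close>. All ingredients are
  efficiently computable; lengths are produced in unary, and sets of coordinates as indicator
  strings.
\<close>

definition building_blocks :: "blocks \<Rightarrow> bool" where
  "building_blocks B \<longleftrightarrow>
     (\<forall>\<^sub>F l in sequentially.
        code_len B l < l \<and> l < alpha B l \<and> alpha B l < beta B l) \<and>
     poly_related (code_len B) \<and> poly_related (alpha B) \<and> poly_related (beta B) \<and>
     0 < rate B \<and> rate B < 1 / 3 \<and>
     (\<forall>g \<in> {code_len B, msg_len B, sym_len B, seed1 B, seed2 B}.
        poly_time (\<lambda>l. [unary l]) (\<lambda>l. unary (g l)) UNIV) \<and>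
     prg (alpha B) (prg1 B) \<and> prg (beta B) (prg2 B) \<and>
     (\<lambda>l. real (sym_len B l)) \<in> \<Theta>(\<lambda>l. ln (real l)) \<and>
     (\<forall>l. binary_field (sym_len B l) (fld B l)) \<and>
     (\<forall>\<^sub>F l in sequentially.
        inj_on (eval_pt B l) {..<code_len B l} \<and>
        eval_pt B l ` {..<code_len B l} \<subseteq> carrier (fld B l)) \<and>
     poly_time (\<lambda>(l, m). [unary l, concat m]) (\<lambda>(l, m). concat (Enc B l m))
       {(l, m). m \<in> vectors (fld B l) (msg_len B l)} \<and>
     (\<forall>\<^sub>F l in sequentially. \<forall>r \<in> {seed1 B l, seed2 B l}.
        \<exists>e. real e > (1 - rate B) * real (code_len B l) / 2 \<and>
            corrects (bitstrings r) (carrier (fld B l)) (ecc B l) e) \<and>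
     poly_time (\<lambda>(l, v). [unary l, v]) (\<lambda>(l, v). concat (ecc B l v))
       {(l, v). v \<in> bitstrings (seed1 B l) \<union> bitstrings (seed2 B l)} \<and>
     (\<forall>\<^sub>F l in sequentially. 0 < kappa1 B l \<and> kappa1 B l \<le> 1 / 4) \<and>
     (\<lambda>l. real (alpha B l) * kappa1 B l) \<in> \<omega>(\<lambda>l. ln (real l)) \<and>
     0 < kappa2 B \<and> kappa2 B < 1 \<and>
     sampler_family (seed1 B) (alpha B) (\<lambda>l. msg_len B l * sym_len B l) (samp1 B)
       (kappa1 B) (kappa2 B) \<and>
     sampler_family (seed2 B) (beta B) (\<lambda>l. code_len B l * sym_len B l) (samp2 B)
       (kappa1 B) (kappa2 B)"

type_synonym point = "bool list list \<times> bool list list \<times> bool list list \<times> bool list list"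

definition point_rep :: "point \<Rightarrow> bool list" where
  "point_rep = (\<lambda>(c1, c2, m, z). encode_list [concat c1, concat c2, concat m, concat z])"

definition point_dist :: "blocks \<Rightarrow> nat \<Rightarrow> bool list \<Rightarrow> point pmf" where
  "point_dist B l s = do {
     u1 \<leftarrow> unif (seed1 B l);
     u2 \<leftarrow> unif (seed2 B l);
     m \<leftarrow> pmf_of_set (vectors (fld B l) (msg_len B l));
     return_pmf (ecc B l u1, ecc B l u2, m,
       map2 (\<lambda>a b. a \<oplus>\<^bsub>fld B l\<^esub> b) (Enc B l m)
         (chunks (sym_len B l) (code_len B l) (nths (prg2 B s) (samp2 B l u2))))}"

definition inner_F2 :: "bool list \<Rightarrow> bool list \<Rightarrow> bool" where
  "inner_F2 v w = odd (card {i. i < length v \<and> i < length w \<and> v ! i \<and> w ! i})"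

definition hyp :: "blocks \<Rightarrow> nat \<Rightarrow> bool list \<Rightarrow> point \<Rightarrow> bool" where
  "hyp B l s = (\<lambda>(c1, c2, m, z).
     let u1 = inv_into (bitstrings (seed1 B l)) (ecc B l) c1
     in inner_F2 (concat m) (nths (prg1 B s) (samp1 B l u1)))"

definition distributions :: "blocks \<Rightarrow> nat \<Rightarrow> point pmf set" where
  "distributions B l = point_dist B l ` bitstrings l"

definition hypotheses :: "blocks \<Rightarrow> nat \<Rightarrow> (point \<Rightarrow> bool) set" where
  "hypotheses B l = hyp B l ` bitstrings l"

definition instances :: "blocks \<Rightarrow> nat \<Rightarrow> point set" where
  "instances B l = (\<Union>D\<in>distributions B l. set_pmf D)"

end

theory Submission
  imports Defs "HOL-Real_Asymp.Real_Asymp"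
begin

text \<open>
  The seeds of the distribution and of the hypothesis are independent in the definition of learning,
  so the distribution can be fixed to the one of seed \<open>1\<^sup>l\<close>, which is efficiently samplable, and only
  the seed of the hypothesis is random. If the string \<open>f\<^sub>1(s)\<close> is replaced by a uniformly random \<open>y\<close>,
  a model \<open>f\<close> with \<open>\<alpha>/2\<close> bits typically leaves \<open>y\<close> with min-entropy \<open>3\<alpha>/8\<close>; the sampler
  keeps a constant entropy rate in \<open>y|samp\<^sub>1(u\<^sub>1)\<close>, and the inner product with the uniform \<open>m\<close> is then
  unpredictable by Parseval's identity, so \<open>(risk - 1/2)\<^sup>2\<close> is negligible in expectation.

  A learner with risk below \<open>1/3\<close> at some sample size \<open>N \<le> poly(l)\<close> therefore breaks the generator. As
  \<open>N\<close> may depend on \<open>l\<close> in an uncomputable way, the distinguisher draws a random \<open>N\<close>, trains on \<open>N\<close>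
  labelled examples, and accepts if the model is right on both or wrong on both of two fresh examples.
\<close>

section \<open>Resource-bounded execution\<close>

text \<open>The labels read one fixed secret at every seed \<open>u1\<close>, while the sampler
  speaks about one random restriction. Second moments bridge this gap, and they are also what the
  agreement of two tests measures; hence the proof follows the mean of (risk - 1/2)^2 from end to
  end.

  The constants: a mean risk below 1/3 gives a second moment of at least (1/2 - 1/3)^2 = 1/36. Of
  the \<alpha> bits of entropy the model costs \<alpha>/2 and the exceptional probability
  2^(-\<alpha>/8) another \<alpha>/8, which leaves the rate 3/8; as \<open>kappa1\<close> is at most
  1/4, the restriction retains the rate 1/8.

  The sample size is drawn with a constant multiple of \<open>sym_len B l\<close> coins. This length
  is logarithmic in \<open>l\<close> and available in unary, so the range is polynomial, of a degree
  as large as desired, and hitting the right size costs only a polynomial factor of the advantage.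

  The ingredients of the distinguisher are computable only on promised inputs, such as seeds of the
  right length or encodings of genuine samples, and behave well only for large \<open>l\<close>.
  Therefore each rule for building programs carries the set of inputs that it speaks about.\<close>

lemma poly_nat_mono:
  fixes p :: "nat poly"
  assumes "x \<le> y"
  shows "poly p x \<le> poly p y"
  by (induction p) (auto intro!: add_mono mult_mono assms)

text \<open>The joint law of final store and running time is forgotten. What is kept is the law of
  the store, without any mass for nontermination, and a bound on the time of every outcome; both
  compose along the program text.\<close>

definition does :: "com \<Rightarrow> store \<Rightarrow> store pmf \<Rightarrow> nat \<Rightarrow> bool" where
  "does c s Q T \<longleftrightarrow>
     (\<exists>R. exec c s = spmf_of_pmf R \<and> map_pmf fst R = Q \<and> (\<forall>x\<in>set_pmf R. snd x \<le> T))"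

lemma does_mono: "does c s Q T \<Longrightarrow> T \<le> T' \<Longrightarrow> does c s Q T'"
  unfolding does_def by (blast intro: order_trans)

lemma doesI_return:
  "exec c s = return_spmf (s', t) \<Longrightarrow> t \<le> T \<Longrightarrow> does c s (return_pmf s') T"
  unfolding does_def by (rule exI[of _ "return_pmf (s', t)"]) simp

lemma does_Skip: "does Skip s (return_pmf s) 1"
  by (rule doesI_return) auto

lemma does_Push: "does (Push b i) s (return_pmf (s(i := b # s i))) 1"
  by (rule doesI_return) auto

lemma does_Pop: "does (Pop i) s (return_pmf (s(i := tl (s i)))) 1"
  by (rule doesI_return) auto

lemma does_Flip: "does (Flip i) s (map_pmf (\<lambda>b. s(i := b # s i)) (pmf_of_set UNIV)) 1"
  unfolding does_def
  by (rule exI[of _ "map_pmf (\<lambda>b. (s(i := b # s i), 1)) (pmf_of_set UNIV)"])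
     (auto simp: map_pmf_comp simp flip: map_spmf_of_pmf spmf_of_pmf_pmf_of_set)

text \<open>Shared core of \<open>Seq\<close> (\<open>k = 0\<close>) and of one unrolling of
  \<open>While\<close> (\<open>k = 1\<close>): both run \<open>c\<close>, then \<open>d\<close> on
  the resulting store, and add the times. A witness for \<open>d\<close> is chosen separately for
  each store in the support of \<open>P\<close>.\<close>

lemma does_bind:
  assumes 1: "does c s P T1"
    and 2: "\<And>s'. s' \<in> set_pmf P \<Longrightarrow> does d s' (Q s') T2"
    and e: "e = bind_spmf (exec c s) (\<lambda>(s1, t1).
                 bind_spmf (exec d s1) (\<lambda>(s2, t2). return_spmf (s2, k + t1 + t2)))"
  shows "\<exists>R. e = spmf_of_pmf R \<and> map_pmf fst R = bind_pmf P Q \<and>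
             (\<forall>x\<in>set_pmf R. snd x \<le> k + T1 + T2)"
proof -
  obtain R where R: "exec c s = spmf_of_pmf R" "map_pmf fst R = P" "\<And>x. x \<in> set_pmf R \<Longrightarrow> snd x \<le> T1"
    using 1 by (auto simp: does_def)
  have "\<forall>s'\<in>set_pmf P. \<exists>R. exec d s' = spmf_of_pmf R \<and> map_pmf fst R = Q s' \<and> (\<forall>x\<in>set_pmf R. snd x \<le> T2)"
    using 2 by (auto simp: does_def)
  then obtain R' where R': "\<And>s'. s' \<in> set_pmf P \<Longrightarrow>
      exec d s' = spmf_of_pmf (R' s') \<and> map_pmf fst (R' s') = Q s' \<and> (\<forall>x\<in>set_pmf (R' s'). snd x \<le> T2)"
    by metis
  have inP: "fst x \<in> set_pmf P" if "x \<in> set_pmf R" for x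
    using that R(2) by auto
  define R'' where "R'' = bind_pmf R (\<lambda>x. map_pmf (\<lambda>y. (fst y, k + snd x + snd y)) (R' (fst x)))"
  have "e = bind_pmf R (\<lambda>x. bind_spmf (exec d (fst x)) (\<lambda>y. return_spmf (fst y, k + snd x + snd y)))"
    by (simp add: e R(1) case_prod_unfold)
  also have "\<dots> = bind_pmf R (\<lambda>x. spmf_of_pmf (map_pmf (\<lambda>y. (fst y, k + snd x + snd y)) (R' (fst x))))"
    by (intro bind_pmf_cong refl) (auto simp: R' inP bind_pmf_return_spmf)
  finally have *: "e = spmf_of_pmf R''"
    by (simp add: R''_def spmf_of_pmf_bind)
  have "map_pmf fst R'' = bind_pmf R (\<lambda>x. map_pmf fst (R' (fst x)))"
    by (simp add: R''_def map_bind_pmf map_pmf_comp)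
  also have "\<dots> = bind_pmf R (\<lambda>x. Q (fst x))"
    by (intro bind_pmf_cong refl) (auto simp: R' inP)
  also have "\<dots> = bind_pmf P Q"
    by (simp flip: R(2) add: bind_map_pmf)
  finally have **: "map_pmf fst R'' = bind_pmf P Q" .
  have "snd x \<le> k + T1 + T2" if "x \<in> set_pmf R''" for x
    using that R(3) R' inP by (fastforce simp: R''_def intro!: add_mono)
  with * ** show ?thesis by blast
qed

lemma does_Seq:
  assumes "does c s P T1" and "\<And>s'. s' \<in> set_pmf P \<Longrightarrow> does d s' (Q s') T2"
  shows "does (Seq c d) s (bind_pmf P Q) (T1 + T2)"
  using does_bind[OF assms refl, where k = 0] by (simp add: does_def)

lemma does_Seq_det:
  assumes "does c s (return_pmf s') T1" and "does d s' Q T2"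
  shows "does (Seq c d) s Q (T1 + T2)"
  using does_Seq[OF assms(1), of d "\<lambda>_. Q" T2] assms(2) by (simp add: bind_return_pmf)

lemma does_While_Nil: "s i = [] \<Longrightarrow> does (While i c) s (return_pmf s) 1"
  by (rule doesI_return) (auto simp: loop.simps)

text \<open>Unrolls one iteration only. Every loop below empties a register, so termination and
  total time come from an induction on the length of that register.\<close>

lemma does_While:
  assumes "s i \<noteq> []" "does c s P T1" and "\<And>s'. s' \<in> set_pmf P \<Longrightarrow> does (While i c) s' (Q s') T2"
  shows "does (While i c) s (bind_pmf P Q) (1 + T1 + T2)"
  unfolding does_def
  by (rule does_bind[OF assms(2,3)], assumption) (use assms(1) in \<open>simp add: loop.simps[of i _ s]\<close>)

lemma does_While_det:
  assumes "s i \<noteq> []" "does c s (return_pmf s') T1" and "does (While i c) s' Q T2"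
  shows "does (While i c) s Q (1 + T1 + T2)"
  using does_While[of s i c "return_pmf s'" T1 "\<lambda>_. Q" T2] assms by (simp add: bind_return_pmf)

lemma does_Case:
  assumes "s i = [] \<Longrightarrow> does c0 s Q T" "\<And>v. s i = False # v \<Longrightarrow> does c1 s Q T"
    "\<And>v. s i = True # v \<Longrightarrow> does c2 s Q T"
  shows "does (Case i c0 c1 c2) s Q (1 + T)"
proof -
  obtain c where c: "exec (Case i c0 c1 c2) s = map_spmf (\<lambda>(s', t). (s', 1 + t)) (exec c s)" "does c s Q T"
    using assms by (cases "s i"; cases "hd (s i)") auto
  from c(2) obtain R where "exec c s = spmf_of_pmf R" "map_pmf fst R = Q" "\<forall>x\<in>set_pmf R. snd x \<le> T"
    by (auto simp: does_def)
  then show ?thesis using c(1) unfolding does_def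
    by (intro exI[of _ "map_pmf (\<lambda>x. (fst x, 1 + snd x)) R"])
       (auto simp: map_pmf_comp case_prod_unfold)
qed

text \<open>Running time bounds output length because every instruction is charged for what it writes.\<close>

lemma exec_growth:
  "(s', t) \<in> set_spmf (exec c s) \<Longrightarrow> length (s' i) \<le> length (s i) + t"
proof (induction c arbitrary: s s' t i)
  case (Seq c d)
  from Seq.prems obtain s1 t1 t2 where *: "(s1, t1) \<in> set_spmf (exec c s)" "(s', t2) \<in> set_spmf (exec d s1)"
    "t = t1 + t2" by (auto simp: set_bind_spmf Set.bind_def)
  show ?case using Seq.IH(1)[OF *(1), of i] Seq.IH(2)[OF *(2), of i] *(3) by simp
next
  case (Case j c0 c1 c2)
  obtain c where "c \<in> {c0, c1, c2}" and
    c: "exec (Case j c0 c1 c2) s = map_spmf (\<lambda>(s', t). (s', 1 + t)) (exec c s)"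
    by (cases "s j"; cases "hd (s j)") auto
  from Case.prems obtain t' where "t = 1 + t'" "(s', t') \<in> set_spmf (exec c s)"
    unfolding c by auto
  moreover have "length (s' i) \<le> length (s i) + t'"
    using Case.IH(1)[of s' t' s i] Case.IH(2)[of s' t' s i] Case.IH(3)[of s' t' s i]
      \<open>c \<in> _\<close> calculation(2) by blast
  ultimately show ?case by simp
next
  case (While j c)
  have "\<forall>s s' t. (s', t) \<in> set_spmf (loop j (exec c) s) \<longrightarrow> length (s' i) \<le> length (s i) + t"
  proof (induction rule: loop.fixp_induct[where P = "\<lambda>lp. \<forall>s s' t. (s', t) \<in> set_spmf (lp j (exec c) s) \<longrightarrow> length (s' i) \<le> length (s i) + t"])
    case 1
    show ?case by simp
  next
    case 2
    show ?case by simp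
  next
    case (3 lp)
    show ?case
    proof (intro allI impI)
      fix s s' t
      assume a: "(s', t) \<in> set_spmf (if s j = [] then return_spmf (s, 1)
        else bind_spmf (exec c s) (\<lambda>(s1, t1). bind_spmf (lp j (exec c) s1) (\<lambda>(s2, t2). return_spmf (s2, 1 + t1 + t2))))"
      show "length (s' i) \<le> length (s i) + t"
      proof (cases "s j = []")
        case False
        with a obtain s1 t1 t2 where *: "(s1, t1) \<in> set_spmf (exec c s)" "(s', t2) \<in> set_spmf (lp j (exec c) s1)"
          "t = 1 + t1 + t2" by (auto simp: set_bind_spmf Set.bind_def)
        show ?thesis using While.IH[OF *(1), of i] 3[rule_format, OF *(2)] *(3) by simp
      qed (use a in auto)
    qed
  qed
  then show ?case using While.prems by simp
qed auto

section \<open>Randomized polynomial-time functions: composition and iteration\<close>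

definition computes :: "com \<Rightarrow> bool list list \<Rightarrow> bool list pmf \<Rightarrow> nat \<Rightarrow> bool" where
  "computes c vs P T \<longleftrightarrow> run c vs = spmf_of_pmf P \<and> runs_within c vs T"

lemma spmf_of_pmf_inject: "spmf_of_pmf p = spmf_of_pmf q \<longleftrightarrow> p = q"
  by (metis pmf_eqI spmf_spmf_of_pmf)

lemma computes_def':
  "computes c vs P T \<longleftrightarrow>
     (\<exists>R. exec c (load vs) = spmf_of_pmf R \<and> map_pmf (\<lambda>x. fst x 0) R = P \<and> (\<forall>x\<in>set_pmf R. snd x \<le> T))"
  by (auto simp: computes_def run_def runs_within_def lossless_spmf_conv_spmf_of_pmf case_prod_unfold
        spmf_of_pmf_inject)

lemma does_computes: "does c (load vs) Q T \<Longrightarrow> computes c vs (map_pmf (\<lambda>s. s 0) Q) T"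
  unfolding does_def computes_def' by (auto simp: map_pmf_comp)

lemma computes_mono: "computes c vs P T \<Longrightarrow> T \<le> T' \<Longrightarrow> computes c vs P T'"
  unfolding computes_def' by (blast intro: order_trans)

lemma length_load_le: "length (load vs i) \<le> input_size vs"
  by (auto simp: load_def input_size_def intro!: member_le_sum_list)

lemma computes_length:
  assumes "computes c vs P T" "v \<in> set_pmf P"
  shows "length v \<le> input_size vs + T"
proof -
  from assms(1) obtain R where R: "exec c (load vs) = spmf_of_pmf R" "\<And>x. x \<in> set_pmf R \<Longrightarrow> snd x \<le> T"
    and P: "map_pmf (\<lambda>x. fst x 0) R = P"
    unfolding computes_def' by blast
  from assms(2) obtain x where x: "x \<in> set_pmf R" "v = fst x 0"
    by (auto simp flip: P)
  then have "(fst x, snd x) \<in> set_spmf (exec c (load vs))"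
    by (simp add: R(1))
  from exec_growth[OF this, of 0] length_load_le[of vs 0] R(2)[OF x(1)] show ?thesis
    unfolding x(2) by linarith
qed

text \<open>The output is charged as well, but it is no longer than input plus running time, whence
  the factors 2.\<close>

lemma does_Call:
  assumes "computes c (map s js) P T"
  shows "does (Call i c js) s (map_pmf (\<lambda>v. s(i := v)) P) (1 + 2 * input_size (map s js) + 2 * T)"
proof -
  obtain R where R: "exec c (load (map s js)) = spmf_of_pmf R" "map_pmf (\<lambda>x. fst x 0) R = P"
    "\<And>x. x \<in> set_pmf R \<Longrightarrow> snd x \<le> T"
    using assms unfolding computes_def' by blast
  have "length (fst x 0) \<le> input_size (map s js) + T" if "x \<in> set_pmf R" for x
    using that by (intro computes_length[OF assms]) (auto simp flip: R(2))
  then have *: "snd x + length (fst x 0) \<le> input_size (map s js) + 2 * T" if "x \<in> set_pmf R" for x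
    using that R(3)[of x] by fastforce
  have sz: "input_size (map s js) = (\<Sum>j\<leftarrow>js. length (s j))"
    by (simp add: input_size_def comp_def)
  define R' where "R' = map_pmf (\<lambda>x. (s(i := fst x 0), 1 + input_size (map s js) + snd x + length (fst x 0))) R"
  have "exec (Call i c js) s = spmf_of_pmf R'"
    by (simp add: R(1) R'_def sz case_prod_unfold)
  moreover have "map_pmf fst R' = map_pmf (\<lambda>v. s(i := v)) P"
    by (simp add: R'_def map_pmf_comp flip: R(2))
  moreover have "snd x \<le> 1 + 2 * input_size (map s js) + 2 * T" if "x \<in> set_pmf R'" for x
    using that * unfolding R'_def by fastforce
  ultimately show ?thesis
    unfolding does_def by blast
qed

text \<open>Randomized counterpart of \<open>poly_time\<close>. The set \<open>A\<close> is a
  promise on the arguments. The map \<open>inp\<close> separates the mathematical argument from the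
  registers that hold it, so that \<open>A\<close> can express dependencies, such as that of the
  length of a seed on the security parameter.\<close>

definition ppt_fun :: "('a \<Rightarrow> bool list list) \<Rightarrow> ('a \<Rightarrow> bool list pmf) \<Rightarrow> 'a set \<Rightarrow> bool" where
  "ppt_fun inp F A \<longleftrightarrow> (\<exists>c. \<exists>p :: nat poly. \<forall>a\<in>A. computes c (inp a) (F a) (poly p (input_size (inp a))))"

lemma poly_time_ppt_fun: "poly_time inp f A \<Longrightarrow> ppt_fun inp (\<lambda>a. return_pmf (f a)) A"
  unfolding poly_time_def ppt_fun_def computes_def by fastforce

lemma ppt_fun_cong:
  assumes "ppt_fun inp F A" "B \<subseteq> A" "\<And>a. a \<in> B \<Longrightarrow> inp' a = inp a" "\<And>a. a \<in> B \<Longrightarrow> F' a = F a"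
  shows "ppt_fun inp' F' B"
proof -
  from assms(1) obtain c p where "\<forall>a\<in>A. computes c (inp a) (F a) (poly p (input_size (inp a)))"
    by (auto simp: ppt_fun_def)
  then show ?thesis unfolding ppt_fun_def
    using assms(2-) by (intro exI[of _ c] exI[of _ p]) auto
qed

lemma ppt_fun_length:
  assumes "ppt_fun inp F A"
  obtains q :: "nat poly" where
    "\<And>a v. a \<in> A \<Longrightarrow> v \<in> set_pmf (F a) \<Longrightarrow> length v \<le> poly q (input_size (inp a))"
proof -
  from assms obtain c p where "\<forall>a\<in>A. computes c (inp a) (F a) (poly p (input_size (inp a)))"
    by (auto simp: ppt_fun_def)
  then have "length v \<le> poly ([:0, 1:] + p) (input_size (inp a))"
    if "a \<in> A" "v \<in> set_pmf (F a)" for a v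
    using computes_length that by fastforce
  then show ?thesis by (rule that)
qed

lemma map_load: "set js \<subseteq> {..<length vs} \<Longrightarrow> map (load vs) js = map ((!) vs) js"
  by (auto simp: load_def)

lemma map_load_upd: "map ((load vs)(length vs := v)) [0..<Suc (length vs)] = vs @ [v]"
  by (rule nth_equalityI) (auto simp: load_def nth_append less_Suc_eq)

lemma input_size_append [simp]: "input_size (vs @ ws) = input_size vs + input_size ws"
  and input_size_Cons [simp]: "input_size (v # vs) = length v + input_size vs"
  and input_size_Nil [simp]: "input_size [] = 0"
  by (simp_all add: input_size_def)

lemma input_size_select_le:
  "set js \<subseteq> {..<length vs} \<Longrightarrow> input_size (map ((!) vs) js) \<le> length js * input_size vs"
proof (induction js)
  case (Cons j js)
  then have "length (vs ! j) \<le> input_size vs"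
    using length_load_le[of vs j] by (auto simp: load_def)
  with Cons show ?case by simp
qed simp

text \<open>Rewiring: \<open>js\<close> selects, permutes or repeats registers of
  \<open>inp\<close>, and \<open>g\<close> is the matching map on the mathematical
  arguments.\<close>

lemma ppt_fun_call:
  assumes F: "ppt_fun inp1 F A1"
    and len: "\<And>a. a \<in> A \<Longrightarrow> length (inp a) = n"
    and js: "set js \<subseteq> {..<n}"
    and sub: "\<And>a. a \<in> A \<Longrightarrow> g a \<in> A1 \<and> inp1 (g a) = map ((!) (inp a)) js"
  shows "ppt_fun inp (\<lambda>a. F (g a)) A"
proof -
  from F obtain c p where c: "\<And>a. a \<in> A1 \<Longrightarrow> computes c (inp1 a) (F a) (poly p (input_size (inp1 a)))"
    by (auto simp: ppt_fun_def)
  define Y :: "nat poly" where "Y = [:0, length js:]"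
  define q where "q = 1 + 2 * Y + 2 * pcompose p Y"
  have "computes (Call 0 c js) (inp a) (F (g a)) (poly q (input_size (inp a)))" if a: "a \<in> A" for a
  proof -
    have inp1: "inp1 (g a) = map (load (inp a)) js"
      using sub[OF a] js len[OF a] by (simp add: map_load)
    have size: "input_size (inp1 (g a)) \<le> poly Y (input_size (inp a))"
      using sub[OF a] input_size_select_le[of js "inp a"] js len[OF a] by (simp add: Y_def mult.commute)
    have "does (Call 0 c js) (load (inp a)) (map_pmf (\<lambda>v. (load (inp a))(0 := v)) (F (g a)))
        (poly q (input_size (inp a)))"
      by (rule does_mono[OF does_Call[OF c[of "g a", unfolded inp1]]])
         (use sub[OF a] size poly_nat_mono[OF size] in \<open>auto simp flip: inp1 simp: q_def poly_pcompose intro!: add_mono\<close>)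
    from does_computes[OF this] show ?thesis
      by (simp add: map_pmf_comp)
  qed
  then show ?thesis unfolding ppt_fun_def by blast
qed

text \<open>The result of \<open>F\<close> goes to a new register behind all inputs, so earlier
  register numbers stay valid and programs can be written as chains of bindings. The promise set of
  \<open>G\<close> contains only values that \<open>F\<close> can produce, which is how facts about
  intermediate values reach \<open>G\<close>.\<close>

lemma ppt_fun_bind:
  assumes F: "ppt_fun inp1 F A1"
    and len: "\<And>a. a \<in> A \<Longrightarrow> length (inp a) = n"
    and js: "set js \<subseteq> {..<n}"
    and sub: "\<And>a. a \<in> A \<Longrightarrow> g a \<in> A1 \<and> inp1 (g a) = map ((!) (inp a)) js"
    and G: "ppt_fun (\<lambda>(a, v). inp a @ [v]) (\<lambda>(a, v). G a v) {(a, v). a \<in> A \<and> v \<in> set_pmf (F (g a))}"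
  shows "ppt_fun inp (\<lambda>a. bind_pmf (F (g a)) (G a)) A"
proof -
  from F obtain c p where c: "\<And>a. a \<in> A1 \<Longrightarrow> computes c (inp1 a) (F a) (poly p (input_size (inp1 a)))"
    by (auto simp: ppt_fun_def)
  from G obtain d r where d: "\<And>a v. a \<in> A \<Longrightarrow> v \<in> set_pmf (F (g a)) \<Longrightarrow>
      computes d (inp a @ [v]) (G a v) (poly r (input_size (inp a) + length v))"
    by (fastforce simp: ppt_fun_def)
  define Y :: "nat poly" where "Y = [:0, length js:]"
  define P where "P = pcompose p Y"
  \<comment> \<open>Bounds the input of \<open>G\<close>: the old registers plus an output of
    \<open>F\<close>, which is no longer than the input of \<open>F\<close> (at most
    \<open>Y\<close>) plus its running time (at most \<open>P\<close>).\<close>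
  define Z where "Z = [:0, 1:] + Y + P"
  define R where "R = pcompose r Z"
  define q where "q = 1 + 2 * Y + 2 * P + (1 + 2 * Z + 2 * R)"
  define e where "e = Seq (Call n c js) (Call 0 d [0..<Suc n])"
  have "computes e (inp a) (bind_pmf (F (g a)) (G a)) (poly q (input_size (inp a)))" if a: "a \<in> A" for a
  proof -
    let ?x = "input_size (inp a)" and ?s = "load (inp a)"
    have inp1: "inp1 (g a) = map (load (inp a)) js"
      using sub[OF a] js len[OF a] by (simp add: map_load)
    have size: "input_size (inp1 (g a)) \<le> poly Y ?x"
      using sub[OF a] input_size_select_le[of js "inp a"] js len[OF a] by (simp add: Y_def mult.commute)
    have P: "poly p (input_size (inp1 (g a))) \<le> poly P ?x"
      using poly_nat_mono[OF size] by (simp add: P_def poly_pcompose)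
    have "does (Call n c js) ?s (map_pmf (\<lambda>v. ?s(n := v)) (F (g a))) (poly (1 + 2 * Y + 2 * P) ?x)"
      by (rule does_mono[OF does_Call[OF c[of "g a", unfolded inp1]]])
         (use sub[OF a] size P in \<open>auto simp flip: inp1 intro!: add_mono\<close>)
    moreover have "does (Call 0 d [0..<Suc n]) s (map_pmf (\<lambda>v. s(0 := v)) (G a (s n))) (poly (1 + 2 * Z + 2 * R) ?x)"
      if s: "s \<in> set_pmf (map_pmf (\<lambda>v. ?s(n := v)) (F (g a)))" for s
    proof -
      obtain v where v: "v \<in> set_pmf (F (g a))" "s = ?s(n := v)" using s by auto
      have "map s [0..<Suc n] = inp a @ [v]"
        unfolding v len[OF a, symmetric] by (rule map_load_upd)
      moreover have "?x + length v \<le> poly Z ?x"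
        using computes_length[OF c v(1)] sub[OF a] size P by (simp add: Z_def)
      ultimately show ?thesis
        using poly_nat_mono[of "?x + length v" "poly Z ?x" r]
        by (intro does_mono[OF does_Call[where P = "G a (s n)" and T = "poly r (?x + length v)"]])
           (auto simp: d a v R_def poly_pcompose simp del: upt_Suc)
    qed
    ultimately have "does e ?s (bind_pmf (map_pmf (\<lambda>v. ?s(n := v)) (F (g a))) (\<lambda>s. map_pmf (\<lambda>v. s(0 := v)) (G a (s n))))
        (poly q ?x)"
      unfolding e_def q_def poly_add[of "1 + 2 * Y + 2 * P"] by (rule does_Seq)
    from does_computes[OF this] show ?thesis
      by (simp add: map_bind_pmf map_pmf_comp bind_map_pmf)
  qed
  then show ?thesis unfolding ppt_fun_def by blast
qed

text \<open>For a deterministic intermediate value, \<open>G\<close> has to handle only that value,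
  and the promise set does not change.\<close>

lemma ppt_fun_let:
  assumes F: "ppt_fun inp1 F A1"
    and len: "\<And>a. a \<in> A \<Longrightarrow> length (inp a) = n"
    and js: "set js \<subseteq> {..<n}"
    and sub: "\<And>a. a \<in> A \<Longrightarrow> g a \<in> A1 \<and> inp1 (g a) = map ((!) (inp a)) js \<and> F (g a) = return_pmf (v a)"
    and G: "ppt_fun (\<lambda>a. inp a @ [v a]) G A"
  shows "ppt_fun inp G A"
proof -
  from G obtain c p where
    "\<forall>a\<in>A. computes c (inp a @ [v a]) (G a) (poly p (input_size (inp a @ [v a])))"
    by (auto simp: ppt_fun_def)
  with sub have "ppt_fun (\<lambda>(a, v). inp a @ [v]) (\<lambda>(a, v). G a) {(a, v). a \<in> A \<and> v \<in> set_pmf (F (g a))}"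
    unfolding ppt_fun_def by (intro exI[of _ c] exI[of _ p]) auto
  from ppt_fun_bind[OF F len js _ this] sub show ?thesis
    by (auto simp: bind_return_pmf intro: ppt_fun_cong)
qed

primrec iterM :: "nat \<Rightarrow> ('b \<Rightarrow> 'b pmf) \<Rightarrow> 'b \<Rightarrow> 'b pmf" where
  "iterM 0 F v = return_pmf v"
| "iterM (Suc n) F v = bind_pmf (F v) (iterM n F)"

lemma computes_Skip: "computes Skip [v] (return_pmf v) 1"
  using does_computes[OF does_Skip, of "[v]"] by (simp add: load_def)

text \<open>Calling the empty program on register \<open>j\<close> acts as an assignment, since its
  result is its own register 0.\<close>

lemma does_Copy: "does (Call i Skip [j]) s (return_pmf (s(i := s j))) (3 + 2 * length (s j))"
  using does_Call[of Skip s "[j]" "return_pmf (s j)" 1 i] computes_Skip[of "s j"]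
  by (simp add: numeral_eq_Suc)

text \<open>The sets \<open>I a j\<close> are loop invariants; they keep the accumulator polynomially bounded.\<close>

lemma ppt_fun_iter:
  assumes F: "ppt_fun (\<lambda>(a, v). inp a @ [v]) (\<lambda>(a, v). F a v)
                {(a, v). a \<in> A \<and> (\<exists>j < length (inp a ! k). v \<in> I a j)}"
    and len: "\<And>a. a \<in> A \<Longrightarrow> length (inp a) = n" and k: "k < n" and i: "i < n"
    and init: "\<And>a. a \<in> A \<Longrightarrow> inp a ! i \<in> I a 0"
    and step: "\<And>a j v. a \<in> A \<Longrightarrow> j < length (inp a ! k) \<Longrightarrow> v \<in> I a j \<Longrightarrow> set_pmf (F a v) \<subseteq> I a (Suc j)"
    and bound: "\<And>a j v. a \<in> A \<Longrightarrow> j \<le> length (inp a ! k) \<Longrightarrow> v \<in> I a j \<Longrightarrow>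
                 length v \<le> poly q (input_size (inp a))"
  shows "ppt_fun inp (\<lambda>a. iterM (length (inp a ! k)) (F a) (inp a ! i)) A"
proof -
  from F obtain c p where c: "\<And>a v j. a \<in> A \<Longrightarrow> j < length (inp a ! k) \<Longrightarrow> v \<in> I a j \<Longrightarrow>
      computes c (inp a @ [v]) (F a v) (poly p (input_size (inp a) + length v))"
    by (fastforce simp: ppt_fun_def)
  define X :: "nat poly" where "X = [:0, 1:]"
  define Z where "Z = X + q"
  define Tc where "Tc = 1 + 2 * Z + 2 * pcompose p Z"
  \<comment> \<open>Register \<open>n\<close> is a counter that starts as a copy of register
    \<open>k\<close>, and register \<open>Suc n\<close> is the accumulator. The called program sees
    the inputs followed by the accumulator.\<close>
  define body where "body = Seq (Pop n) (Call (Suc n) c ([0..<n] @ [Suc n]))"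
  define e where "e = Seq (Call n Skip [k]) (Seq (Call (Suc n) Skip [i]) (Seq (While n body) (Call 0 Skip [Suc n])))"
  define r where "r = (3 + 2 * X) + ((3 + 2 * X) + ((1 + X * (2 + Tc)) + (3 + 2 * q)))"
  have "computes e (inp a) (iterM (length (inp a ! k)) (F a) (inp a ! i)) (poly r (input_size (inp a)))"
    if a: "a \<in> A" for a
  proof -
    let ?x = "input_size (inp a)"
    have le: "length (inp a ! j) \<le> ?x" if "j < n" for j
      using length_load_le[of "inp a" j] that len[OF a] by (simp add: load_def)
    \<comment> \<open>With \<open>m\<close> iterations left, the index of the invariant is the
      number of iterations already done.\<close>
    have loop: "does (While n body) s (map_pmf (\<lambda>v. s(n := [], Suc n := v)) (iterM m (F a) (s (Suc n))))
           (1 + m * (2 + poly Tc ?x))"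
      if "\<forall>j<n. s j = inp a ! j" "length (s n) = m" "m \<le> length (inp a ! k)"
         "s (Suc n) \<in> I a (length (inp a ! k) - m)" for m s
      using that
    proof (induction m arbitrary: s)
      case 0
      then have "s(n := [], Suc n := s (Suc n)) = s" by auto
      then show ?case using does_While_Nil[of s n body] 0(2)
        unfolding iterM.simps map_return_pmf by simp
    next
      case (Suc m)
      let ?j = "length (inp a ! k) - Suc m" and ?v = "s (Suc n)" and ?s = "s(n := tl (s n))"
      have v: "?j < length (inp a ! k)" "?v \<in> I a ?j" and j: "Suc ?j = length (inp a ! k) - m"
        using Suc.prems by auto
      have z: "?x + length ?v \<le> poly Z ?x"
        using bound[OF a _ v(2)] v(1) by (simp add: Z_def X_def)
      have m: "map ?s ([0..<n] @ [Suc n]) = inp a @ [?v]"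
        using Suc.prems(1) len[OF a] by (intro nth_equalityI) (auto simp: nth_append less_Suc_eq)
      have "does (Call (Suc n) c ([0..<n] @ [Suc n])) ?s (map_pmf (\<lambda>v. ?s(Suc n := v)) (F a ?v)) (poly Tc ?x)"
        by (rule does_mono[OF does_Call[OF c[OF a v, folded m]]], unfold m)
           (use z poly_nat_mono[OF z, of p] in \<open>simp add: Tc_def poly_pcompose\<close>)
      from does_Seq_det[OF does_Pop this]
      have body: "does body s (map_pmf (\<lambda>v. ?s(Suc n := v)) (F a ?v)) (1 + poly Tc ?x)"
        by (simp add: body_def)
      have "does (While n body) s
          (bind_pmf (map_pmf (\<lambda>v. ?s(Suc n := v)) (F a ?v))
             (\<lambda>s. map_pmf (\<lambda>v. s(n := [], Suc n := v)) (iterM m (F a) (s (Suc n)))))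
          (1 + (1 + poly Tc ?x) + (1 + m * (2 + poly Tc ?x)))"
      proof (rule does_While[OF _ body])
        fix s' assume "s' \<in> set_pmf (map_pmf (\<lambda>v. ?s(Suc n := v)) (F a ?v))"
        then obtain v' where "v' \<in> set_pmf (F a ?v)" and s': "s' = ?s(Suc n := v')"
          by auto
        then have "v' \<in> I a (length (inp a ! k) - m)"
          using step[OF a v] j by auto
        then show "does (While n body) s' (map_pmf (\<lambda>v. s'(n := [], Suc n := v)) (iterM m (F a) (s' (Suc n))))
                     (1 + m * (2 + poly Tc ?x))"
          using Suc.prems unfolding s' by (intro Suc.IH) auto
      qed (use Suc.prems in auto)
      moreover have "bind_pmf (map_pmf (\<lambda>v. ?s(Suc n := v)) (F a ?v))
             (\<lambda>s. map_pmf (\<lambda>v. s(n := [], Suc n := v)) (iterM m (F a) (s (Suc n))))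
          = map_pmf (\<lambda>v. s(n := [], Suc n := v)) (iterM (Suc m) (F a) ?v)"
        unfolding bind_map_pmf iterM.simps map_bind_pmf
        by (intro bind_pmf_cong map_pmf_cong) (auto simp: fun_eq_iff)
      moreover have "1 + (1 + poly Tc ?x) + (1 + m * (2 + poly Tc ?x)) = 1 + Suc m * (2 + poly Tc ?x)"
        by simp
      ultimately show ?case by (simp only:)
    qed
    have bnd: "length v \<le> poly q ?x" if "v \<in> set_pmf (iterM m (F a) w)" "w \<in> I a (length (inp a ! k) - m)"
      "m \<le> length (inp a ! k)" for m v w
      using that
    proof (induction m arbitrary: w)
      case 0
      then show ?case using bound[OF a, of "length (inp a ! k)"] by auto
    next
      case (Suc m)
      let ?j = "length (inp a ! k) - Suc m"
      have j: "Suc ?j = length (inp a ! k) - m" "?j < length (inp a ! k)" using Suc.prems by auto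
      from Suc.prems obtain w' where w': "w' \<in> set_pmf (F a w)" "v \<in> set_pmf (iterM m (F a) w')"
        by auto
      then have "w' \<in> I a (Suc ?j)" using step[OF a j(2) Suc.prems(2)] by auto
      then show ?case using w' Suc.prems(3) by (intro Suc.IH[OF w'(2)]) (simp_all only: j)
    qed
    let ?s = "load (inp a)"
    define s1 where "s1 = ?s(n := inp a ! k)"
    define s2 where "s2 = s1(Suc n := inp a ! i)"
    define I0 where "I0 = iterM (length (inp a ! k)) (F a) (inp a ! i)"
    have ks: "?s k = inp a ! k" "s1 i = inp a ! i"
      using k i len[OF a] by (simp_all add: load_def s1_def)
    have 1: "does (Call n Skip [k]) ?s (return_pmf s1) (poly (3 + 2 * X) ?x)"
      using does_Copy[of n k ?s] unfolding ks s1_def[symmetric]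
      by (rule does_mono) (use le[OF k] in \<open>simp add: X_def\<close>)
    have 2: "does (Call (Suc n) Skip [i]) s1 (return_pmf s2) (poly (3 + 2 * X) ?x)"
      using does_Copy[of "Suc n" i s1] unfolding ks s2_def[symmetric]
      by (rule does_mono) (use le[OF i] in \<open>simp add: X_def\<close>)
    have s2: "s2 (Suc n) = inp a ! i" "s2 n = inp a ! k" "\<forall>j<n. s2 j = inp a ! j"
      using len[OF a] by (auto simp: s2_def s1_def load_def)
    have "does (While n body) s2 (map_pmf (\<lambda>v. s2(n := [], Suc n := v)) I0)
            (1 + length (inp a ! k) * (2 + poly Tc ?x))"
      using loop[of s2 "length (inp a ! k)"] init[OF a] unfolding s2 I0_def using s2(3) by simp
    then have 3: "does (While n body) s2 (map_pmf (\<lambda>v. s2(n := [], Suc n := v)) I0) (poly (1 + X * (2 + Tc)) ?x)"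
      by (rule does_mono) (use mult_le_mono1[OF le[OF k], of "2 + poly Tc ?x"] in \<open>simp add: X_def\<close>)
    have 4: "does (Call 0 Skip [Suc n]) s (return_pmf (s(0 := s (Suc n)))) (poly (3 + 2 * q) ?x)"
      if s: "s \<in> set_pmf (map_pmf (\<lambda>v. s2(n := [], Suc n := v)) I0)" for s
      by (rule does_mono[OF does_Copy]) (use s bnd[of _ "length (inp a ! k)"] init[OF a] in \<open>auto simp: I0_def\<close>)
    have "does e ?s (bind_pmf (map_pmf (\<lambda>v. s2(n := [], Suc n := v)) I0) (\<lambda>s. return_pmf (s(0 := s (Suc n))))) (poly r ?x)"
      unfolding e_def r_def poly_add[of "3 + 2 * X"] poly_add[of "1 + X * (2 + Tc)"]
      by (intro does_Seq_det[OF 1] does_Seq_det[OF 2] does_Seq[OF 3] 4)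
    from does_computes[OF this] show ?thesis
      by (simp add: map_bind_pmf map_pmf_comp bind_map_pmf bind_return_pmf' I0_def)
  qed
  then show ?thesis unfolding ppt_fun_def by blast
qed

section \<open>Basic programs\<close>

lemma ppt_funI:
  fixes p :: "nat poly"
  assumes "\<And>a. a \<in> A \<Longrightarrow> does c (load (inp a)) (Q a) (T a)"
    and "\<And>a. a \<in> A \<Longrightarrow> map_pmf (\<lambda>s. s 0) (Q a) = F a"
    and "\<And>a. a \<in> A \<Longrightarrow> T a \<le> poly p (input_size (inp a))"
  shows "ppt_fun inp F A"
  unfolding ppt_fun_def
proof (intro exI ballI)
  fix a assume a: "a \<in> A"
  show "computes c (inp a) (F a) (poly p (input_size (inp a)))"
    using computes_mono[OF does_computes[OF assms(1)[OF a]] assms(3)[OF a]] assms(2)[OF a] by simp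
qed

lemma does_While_Nil': "s i = [] \<Longrightarrow> s' = s \<Longrightarrow> 1 \<le> T \<Longrightarrow> does (While i c) s (return_pmf s') T"
  using does_While_Nil does_mono by blast

text \<open>Popping and pushing reverses the string; a second move restores the order.\<close>

definition Mv :: "nat \<Rightarrow> nat \<Rightarrow> com" where
  "Mv i j = While i (Case i Skip (Seq (Pop i) (Push False j)) (Seq (Pop i) (Push True j)))"

lemma does_Case_det:
  assumes "does (case s i of [] \<Rightarrow> c0 | b # v \<Rightarrow> if b then c2 else c1) s Q T"
  shows "does (Case i c0 c1 c2) s Q (1 + T)"
  by (rule does_Case) (use assms in auto)

lemma does_Mv:
  assumes "i \<noteq> j"
  shows "does (Mv i j) s (return_pmf (s(i := [], j := rev (s i) @ s j))) (1 + 4 * length (s i))"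
proof (induction "s i" arbitrary: s)
  case Nil
  then show ?case unfolding Mv_def
    by (intro does_While_Nil') auto
next
  case (Cons b v)
  let ?s = "s(i := v, j := b # s j)"
  have "does (Seq (Pop i) (Push b j)) s (return_pmf ?s) (1 + 1)"
    by (rule does_Seq_det[OF does_Pop])
       (use does_Push[of b j "s(i := v)"] assms Cons(2)[symmetric] in simp)
  then have 1: "does (Case i Skip (Seq (Pop i) (Push False j)) (Seq (Pop i) (Push True j))) s (return_pmf ?s) (1 + (1 + 1))"
    by (intro does_Case_det) (cases b; simp add: Cons(2)[symmetric] del: One_nat_def)
  have 2: "does (Mv i j) ?s (return_pmf (s(i := [], j := rev (s i) @ s j))) (1 + 4 * length v)"
    using Cons(1)[of ?s] assms Cons(2)[symmetric] by (simp add: fun_upd_twist)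
  show ?case
    by (rule does_mono[OF does_While_det[OF _ 1 2[unfolded Mv_def], folded Mv_def]])
       (simp_all flip: Cons(2))
qed

lemma ppt_append: "ppt_fun (\<lambda>(v, w). [v, w]) (\<lambda>(v, w). return_pmf (v @ w)) UNIV"
proof (rule ppt_funI[of _ "Seq (Mv 0 2) (Seq (Mv 2 1) (Call 0 Skip [1]))" _
      "\<lambda>(v, w). return_pmf ((load [v, w])(0 := [], 2 := rev v, 2 := [], 1 := v @ w, 0 := v @ w))"
      "\<lambda>(v, w). (1 + 4 * length v) + ((1 + 4 * length v) + (3 + 2 * length (v @ w)))" _ "[:5, 10:]"], goal_cases)
  case (1 a)
  obtain v w where a: "a = (v, w)" by fastforce
  let ?s0 = "load [v, w]"
  let ?s1 = "?s0(0 := [], 2 := rev v)"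
  let ?s2 = "?s1(2 := [], 1 := v @ w)"
  have "does (Mv 0 2) ?s0 (return_pmf ?s1) (1 + 4 * length v)"
    using does_Mv[of 0 2 ?s0] by (simp add: load_def)
  moreover have "does (Mv 2 1) ?s1 (return_pmf ?s2) (1 + 4 * length v)"
    using does_Mv[of 2 1 ?s1] by (simp add: load_def)
  moreover have "does (Call 0 Skip [1]) ?s2 (return_pmf (?s2(0 := v @ w))) (3 + 2 * length (v @ w))"
    using does_Copy[of 0 1 ?s2] by simp
  ultimately show ?case
    unfolding a prod.case by (intro does_Seq_det)
qed auto

text \<open>A stack is written from the back: register 1 holds the word in reverse, and the
  terminating \<open>False\<close> has to lie in register 0 beforehand.\<close>

definition expand :: com where
  "expand = While 1 (Case 1 Skip
     (Seq (Pop 1) (Seq (Push False 0) (Push True 0))) (Seq (Pop 1) (Seq (Push True 0) (Push True 0))))"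

lemma does_expand:
  "does expand s (return_pmf (s(1 := [], 0 := concat (map (\<lambda>b. [True, b]) (rev (s 1))) @ s 0)))
     (1 + 5 * length (s 1))"
proof (induction "s 1" arbitrary: s)
  case Nil
  then show ?case unfolding expand_def
    by (intro does_While_Nil') auto
next
  case (Cons b v)
  let ?s = "s(1 := v, 0 := True # b # s 0)"
  have "does (Seq (Pop 1) (Seq (Push b 0) (Push True 0))) s (return_pmf ?s) (1 + (1 + 1))"
    by (rule does_Seq_det[OF does_Pop], rule does_Seq_det[OF does_Push])
       (use does_Push[of True 0 "s(1 := v, 0 := b # s 0)"] Cons(2)[symmetric] in simp)
  then have 1: "does (Case 1 Skip
     (Seq (Pop 1) (Seq (Push False 0) (Push True 0))) (Seq (Pop 1) (Seq (Push True 0) (Push True 0)))) s (return_pmf ?s) (1 + (1 + (1 + 1)))"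
    by (intro does_Case_det) (cases b; simp add: Cons(2)[symmetric] del: One_nat_def)
  have 2: "does expand ?s (return_pmf (s(1 := [], 0 := concat (map (\<lambda>b. [True, b]) (rev (s 1))) @ s 0))) (1 + 5 * length v)"
    using Cons(1)[of ?s] Cons(2)[symmetric] by (simp add: fun_upd_twist)
  show ?case
    by (rule does_mono[OF does_While_det[OF _ 1 2[unfolded expand_def], folded expand_def]])
       (simp_all add: Cons(2)[symmetric] del: One_nat_def)
qed

lemma ppt_encode: "ppt_fun (\<lambda>v. [v]) (\<lambda>v. return_pmf (encode_list [v])) UNIV"
proof (rule ppt_funI[of _ "Seq (Mv 0 1) (Seq (Push False 0) expand)" _
      "\<lambda>v. return_pmf ((load [v])(0 := [], 1 := rev v, 0 := [False], 1 := [], 0 := encode_list [v]))"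
      "\<lambda>v. (1 + 4 * length v) + (1 + (1 + 5 * length v))" _ "[:3, 9:]"], goal_cases)
  case (1 v)
  let ?s0 = "load [v]"
  let ?s1 = "?s0(0 := [], 1 := rev v)"
  let ?s2 = "?s1(0 := [False])"
  have "does (Mv 0 1) ?s0 (return_pmf ?s1) (1 + 4 * length v)"
    using does_Mv[of 0 1 ?s0] by (simp add: load_def)
  moreover have "does (Push False 0) ?s1 (return_pmf ?s2) 1"
    using does_Push[of False 0 ?s1] by simp
  moreover have "does expand ?s2 (return_pmf (?s2(1 := [], 0 := encode_list [v]))) (1 + 5 * length v)"
    using does_expand[of ?s2] by (simp add: encode_list_def)
  ultimately show ?case
    by (intro does_Seq_det)
qed auto

definition head :: "bool list \<Rightarrow> bool" where
  "head v \<longleftrightarrow> v \<noteq> [] \<and> hd v"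

text \<open>The mask \<open>d\<close> advances along \<open>y\<close> at every step but along
  \<open>e\<close> only at selected positions, so the restriction of \<open>y\<close> to the mask is
  combined with \<open>e\<close>. One program thus serves for masking the codeword, for the products
  of an inner product and, with mask \<open>[True]\<close>, for comparing two bits. Missing bits
  count as \<open>False\<close>, so any strings are acceptable.\<close>

primrec select2 :: "(bool \<Rightarrow> bool \<Rightarrow> bool) \<Rightarrow> bool list \<Rightarrow> bool list \<Rightarrow> bool list \<Rightarrow> bool list" where
  "select2 f [] y e = []"
| "select2 f (b # d) y e =
     (if b then f (head y) (head e) # select2 f d (tl y) (tl e) else select2 f d (tl y) e)"

definition select2_out :: "(bool \<Rightarrow> bool \<Rightarrow> bool) \<Rightarrow> com" where
  "select2_out f = (let push = (\<lambda>a. Case 2 (Push (f a False) 3) (Push (f a False) 3) (Push (f a True) 3))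
     in Case 1 (push False) (push False) (push True))"

definition select2_loop :: "(bool \<Rightarrow> bool \<Rightarrow> bool) \<Rightarrow> com" where
  "select2_loop f = While 0 (Case 0 Skip (Seq (Pop 0) (Pop 1))
     (Seq (select2_out f) (Seq (Pop 0) (Seq (Pop 1) (Pop 2)))))"

lemma does_select2_out:
  "does (select2_out f) s (return_pmf (s(3 := f (head (s 1)) (head (s 2)) # s 3))) (1 + (1 + 1))"
  unfolding select2_out_def Let_def
  by (intro does_Case_det)
     (cases "s 1"; cases "s 2"; cases "hd (s 1)"; cases "hd (s 2)";
      simp add: head_def; intro does_Case_det[where T = 1, simplified]; simp add: does_Push[simplified])

text \<open>The final store is existential because the remainders of registers 1 and 2 are of no
  interest. Register 4 is recorded as the target of the move that undoes the reversal.\<close>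

lemma does_select2_loop:
  "\<exists>s'. does (select2_loop f) s (return_pmf s') (1 + 8 * length (s 0)) \<and>
        s' 3 = rev (select2 f (s 0) (s 1) (s 2)) @ s 3 \<and> s' 4 = s 4"
proof (induction "s 0" arbitrary: s)
  case Nil
  then show ?case using does_While_Nil[of s 0]
    by (intro exI[of _ s]) (simp add: select2_loop_def flip: Nil)
next
  case (Cons b v)
  note s0 = Cons(2)[symmetric]
  define s1 where "s1 = (if b then s(3 := f (head (s 1)) (head (s 2)) # s 3, 0 := v, 1 := tl (s 1), 2 := tl (s 2))
     else s(0 := v, 1 := tl (s 1)))"
  have "does (Seq (Pop 0) (Pop 1)) s (return_pmf s1) (1 + 1)" if "\<not> b"
    by (rule does_Seq_det[OF does_Pop])
       (use that does_Pop[of 1 "s(0 := v)"] s0 in \<open>simp add: s1_def\<close>)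
  moreover have "does (Seq (select2_out f) (Seq (Pop 0) (Seq (Pop 1) (Pop 2)))) s (return_pmf s1) ((1 + (1 + 1)) + (1 + (1 + 1)))" if b
    by (rule does_Seq_det[OF does_select2_out], rule does_Seq_det[OF does_Pop], rule does_Seq_det[OF does_Pop])
       (use that does_Pop[of 2 "s(3 := f (head (s 1)) (head (s 2)) # s 3, 0 := v, 1 := tl (s 1))"] s0 in \<open>simp add: s1_def\<close>)
  ultimately have 1: "does (Case 0 Skip (Seq (Pop 0) (Pop 1))
     (Seq (select2_out f) (Seq (Pop 0) (Seq (Pop 1) (Pop 2))))) s (return_pmf s1) (1 + 6)"
    by (intro does_Case_det) (auto simp: s0 elim!: does_mono)
  have "v = s1 0" by (simp add: s1_def)
  from Cons(1)[of s1, OF this] obtain s' where s': "does (select2_loop f) s1 (return_pmf s') (1 + 8 * length v)"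
    "s' 3 = rev (select2 f (s1 0) (s1 1) (s1 2)) @ s1 3" "s' 4 = s1 4"
    using \<open>v = s1 0\<close> by auto
  show ?case
  proof (intro exI conjI)
    show "does (select2_loop f) s (return_pmf s') (1 + 8 * length (s 0))"
      by (rule does_mono[OF does_While_det[OF _ 1 s'(1)[unfolded select2_loop_def], folded select2_loop_def]])
         (simp_all add: s0)
  qed (use s'(2,3) in \<open>simp_all add: s0 s1_def\<close>)
qed

lemma length_select2_le: "length (select2 f d y e) \<le> length d"
  by (induction d arbitrary: y e) (auto intro: le_SucI)

lemma ppt_select2:
  "ppt_fun (\<lambda>(d, y, e). [d, y, e]) (\<lambda>(d, y, e). return_pmf (select2 f d y e)) UNIV"
proof -
  let ?c = "Seq (select2_loop f) (Seq (Mv 3 4) (Call 0 Skip [4]))"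
  have "\<exists>s'. does ?c (load [d, y, e]) (return_pmf s') (5 + 14 * length d) \<and> s' 0 = select2 f d y e" for d y e
  proof -
    let ?s = "load [d, y, e]" and ?r = "select2 f d y e"
    have s: "?s 0 = d" "?s (Suc 0) = y" "?s 2 = e" "?s 3 = []" "?s 4 = []"
      by (simp_all add: load_def)
    from does_select2_loop[of f ?s] obtain s1 where
      s1: "does (select2_loop f) ?s (return_pmf s1) (1 + 8 * length d)" "s1 3 = rev ?r" "s1 4 = []"
      by (auto simp: s)
    let ?s2 = "s1(3 := [], 4 := ?r)"
    have 2: "does (Mv 3 4) s1 (return_pmf ?s2) (1 + 4 * length ?r)"
      using does_Mv[of 3 4 s1] by (simp add: s1)
    have 3: "does (Call 0 Skip [4]) ?s2 (return_pmf (?s2(0 := ?r))) (3 + 2 * length ?r)"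
      using does_Copy[of 0 4 ?s2] by simp
    show ?thesis
      using length_select2_le[of f d y e]
      by (intro exI[of _ "?s2(0 := ?r)"] conjI does_mono[OF does_Seq_det[OF s1(1) does_Seq_det[OF 2 3]]]) auto
  qed
  then obtain s' where "\<And>d y e. does ?c (load [d, y, e]) (return_pmf (s' d y e)) (5 + 14 * length d) \<and> s' d y e 0 = select2 f d y e"
    by metis
  then show ?thesis
    by (intro ppt_funI[of _ ?c _ "\<lambda>(d, y, e). return_pmf (s' d y e)" "\<lambda>(d, y, e). 5 + 14 * length d" _ "[:5, 14:]"]) auto
qed

definition parity :: "bool list \<Rightarrow> bool" where
  "parity v = odd (length (filter id v))"

text \<open>The running parity is kept in register 1 as \<open>[]\<close> or
  \<open>[True]\<close>.\<close>

definition parity_loop :: com where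
  "parity_loop = While 0 (Case 0 Skip (Pop 0) (Seq (Pop 0) (Case 1 (Push True 1) (Pop 1) (Pop 1))))"

lemma does_parity_loop:
  "s 1 = (if b then [True] else []) \<Longrightarrow>
   does parity_loop s (return_pmf (s(0 := [], 1 := if b \<noteq> parity (s 0) then [True] else []))) (1 + 5 * length (s 0))"
proof (induction "s 0" arbitrary: s b)
  case Nil
  then show ?case unfolding parity_loop_def
    by (intro does_While_Nil') (auto simp: parity_def)
next
  case (Cons a v)
  note s0 = Cons(2)[symmetric]
  let ?s = "s(0 := v, 1 := if b \<noteq> a then [True] else [])"
  have upd: "s(0 := v) = ?s" if "\<not> a" using that Cons(3) by auto
  have "does (Pop 0) s (return_pmf ?s) 1" if "\<not> a"
    using that does_Pop[of 0 s] s0 unfolding upd[OF that, symmetric] by simp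
  moreover have "does (Case 1 (Push True 1) (Pop 1) (Pop 1)) (s(0 := v)) (return_pmf ?s) (1 + 1)" if a
    by (rule does_Case_det)
       (use that does_Push[of True 1 "s(0 := v)"] does_Pop[of 1 "s(0 := v)"] Cons(3) in \<open>auto split: if_splits\<close>)
  then have "does (Seq (Pop 0) (Case 1 (Push True 1) (Pop 1) (Pop 1))) s (return_pmf ?s) (1 + (1 + 1))" if a
    using that by (intro does_Seq_det[OF does_Pop]) (simp add: s0)
  ultimately have 1: "does (Case 0 Skip (Pop 0) (Seq (Pop 0) (Case 1 (Push True 1) (Pop 1) (Pop 1)))) s (return_pmf ?s) (1 + 3)"
    by (intro does_Case_det) (auto simp: s0 elim!: does_mono)
  have par: "parity (a # v) = (a \<noteq> parity v)" by (simp add: parity_def)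
  have 2: "does parity_loop ?s (return_pmf (s(0 := [], 1 := if b \<noteq> parity (s 0) then [True] else []))) (1 + 5 * length v)"
  proof -
    have "?s(0 := [], 1 := if (b \<noteq> a) \<noteq> parity v then [True] else []) = s(0 := [], 1 := if b \<noteq> parity (s 0) then [True] else [])"
      unfolding s0 par by (auto simp: fun_eq_iff)
    then show ?thesis using Cons(1)[of ?s "b \<noteq> a"] by simp
  qed
  show ?case
    by (rule does_mono[OF does_While_det[OF _ 1 2[unfolded parity_loop_def], folded parity_loop_def]])
       (simp_all add: s0)
qed

lemma ppt_parity: "ppt_fun (\<lambda>v. [v]) (\<lambda>v. return_pmf [parity v]) UNIV"
proof (rule ppt_funI[of _ "Seq parity_loop (Case 1 (Push False 0) Skip (Push True 0))" _
      "\<lambda>v. return_pmf ((load [v])(0 := [], 1 := if parity v then [True] else [], 0 := [parity v]))"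
      "\<lambda>v. (1 + 5 * length v) + (1 + 1)" _ "[:3, 5:]"], goal_cases)
  case (1 v)
  let ?s = "(load [v])(0 := [], 1 := if parity v then [True] else [])"
  have "does parity_loop (load [v]) (return_pmf ?s) (1 + 5 * length v)"
    using does_parity_loop[of "load [v]" False] by (simp add: load_def)
  moreover have "does (Case 1 (Push False 0) Skip (Push True 0)) ?s (return_pmf (?s(0 := [parity v]))) (1 + 1)"
    by (rule does_Case_det) (use does_Push[of _ 0 ?s] in \<open>auto split: if_splits\<close>)
  ultimately show ?case
    by (intro does_Seq_det)
qed auto

definition double_loop :: com where
  "double_loop = While 0 (Seq (Pop 0) (Seq (Push True 1) (Push True 1)))"

lemma does_double_loop:
  "does double_loop s (return_pmf (s(0 := [], 1 := unary (2 * length (s 0)) @ s 1))) (1 + 4 * length (s 0))"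
proof (induction "s 0" arbitrary: s)
  case Nil
  then show ?case unfolding double_loop_def
    by (intro does_While_Nil') (auto simp: unary_def)
next
  case (Cons a v)
  note s0 = Cons(2)[symmetric]
  let ?s = "s(0 := v, 1 := True # True # s 1)"
  have 1: "does (Seq (Pop 0) (Seq (Push True 1) (Push True 1))) s (return_pmf ?s) (1 + (1 + 1))"
    by (rule does_Seq_det[OF does_Pop], rule does_Seq_det[OF does_Push])
       (use does_Push[of True 1 "s(0 := v, 1 := True # s 1)"] s0 in simp)
  have "replicate n True @ True # True # w = True # True # replicate n True @ w" for n w
    by (simp add: replicate_app_Cons_same)
  then have "?s(0 := [], 1 := unary (2 * length v) @ ?s 1) = s(0 := [], 1 := unary (2 * length (s 0)) @ s 1)"
    by (auto simp: fun_eq_iff s0 unary_def)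
  then have 2: "does double_loop ?s (return_pmf (s(0 := [], 1 := unary (2 * length (s 0)) @ s 1))) (1 + 4 * length v)"
    using Cons(1)[of ?s] by simp
  show ?case
    by (rule does_mono[OF does_While_det[OF _ 1 2[unfolded double_loop_def], folded double_loop_def]])
       (simp_all add: s0)
qed

text \<open>Appends a random binary digit to a number written in unary; iteration draws a random
  number.\<close>

lemma ppt_double_coin:
  "ppt_fun (\<lambda>v. [v]) (\<lambda>v. map_pmf (\<lambda>b. unary (2 * length v + of_bool b)) (pmf_of_set UNIV)) UNIV"
proof (rule ppt_funI[of _ "Seq double_loop (Seq (Flip 2) (Seq (Case 2 Skip Skip (Push True 1)) (Call 0 Skip [1])))" _
      "\<lambda>v. bind_pmf (map_pmf (\<lambda>b. (load [v])(0 := [], 1 := unary (2 * length v), 2 := [b])) (pmf_of_set UNIV))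
         (\<lambda>s. return_pmf (s(1 := unary (2 * length v + of_bool (hd (s 2))), 0 := unary (2 * length v + of_bool (hd (s 2))))))"
      "\<lambda>v. (1 + 4 * length v) + (1 + ((1 + 1) + (3 + 2 * (2 * length v + 1))))" _ "[:9, 8:]"], goal_cases)
  case (1 v)
  let ?s = "(load [v])(0 := [], 1 := unary (2 * length v))"
  have A: "does double_loop (load [v]) (return_pmf ?s) (1 + 4 * length v)"
    using does_double_loop[of "load [v]"] by (simp add: load_def)
  have B: "does (Flip 2) ?s (map_pmf (\<lambda>b. ?s(2 := [b])) (pmf_of_set UNIV)) 1"
    using does_Flip[of 2 ?s] by (simp add: load_def)
  have C: "does (Seq (Case 2 Skip Skip (Push True 1)) (Call 0 Skip [1])) s
      (return_pmf (s(1 := unary (2 * length v + of_bool (hd (s 2))), 0 := unary (2 * length v + of_bool (hd (s 2))))))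
      ((1 + 1) + (3 + 2 * (2 * length v + 1)))"
    if s: "s \<in> set_pmf (map_pmf (\<lambda>b. ?s(2 := [b])) (pmf_of_set UNIV))" for s
  proof -
    from s obtain b where b: "s = ?s(2 := [b])" by auto
    let ?t = "s(1 := unary (2 * length v + of_bool b))"
    have id: "?t = s" if "\<not> b" using that by (auto simp: b)
    have "does (Case 2 Skip Skip (Push True 1)) s (return_pmf ?t) (1 + 1)"
      by (rule does_Case_det)
         (use does_Push[of True 1 s] does_Skip[of s] id in \<open>cases b; auto simp: b unary_def\<close>)
    moreover have "does (Call 0 Skip [1]) ?t (return_pmf (?t(0 := unary (2 * length v + of_bool b)))) (3 + 2 * (2 * length v + 1))"
      using does_mono[OF does_Copy[of 0 1 ?t], of "3 + 2 * (2 * length v + 1)"] by (simp add: unary_def)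
    ultimately show ?thesis unfolding b by (intro does_Seq_det) simp_all
  qed
  show ?case
    by (intro does_Seq_det[OF A] does_Seq[OF B] C)
qed (auto simp: map_pmf_def bind_assoc_pmf bind_return_pmf)

lemma ppt_push_coin: "ppt_fun (\<lambda>v. [v]) (\<lambda>v. map_pmf (\<lambda>b. b # v) (pmf_of_set UNIV)) UNIV"
  by (rule ppt_funI[OF does_Flip[of 0], where p = 1]) (auto simp: map_pmf_comp load_def)

text \<open>The word is pushed bit by bit, its length being a constant of the program.\<close>

lemma ppt_const: "ppt_fun inp (\<lambda>_. return_pmf w) {a. inp a = []}"
proof (induction w)
  case Nil
  show ?case
    by (rule ppt_funI[OF does_Skip, where p = 1]) (auto simp: load_def)
next
  case (Cons b w)
  have "ppt_fun (\<lambda>v. [v]) (\<lambda>v. return_pmf (b # v)) UNIV"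
    by (rule ppt_funI[OF does_Push[of b 0], where p = 1]) (auto simp: load_def)
  then have G: "ppt_fun (\<lambda>a. inp a @ [w]) (\<lambda>_. return_pmf (b # w)) {a. inp a = []}"
    by (rule ppt_fun_call[where n = 1 and js = "[0]" and g = "\<lambda>_. w"]) auto
  show ?case
    by (rule ppt_fun_let[OF Cons, where n = 0 and js = "[]" and g = "\<lambda>a. a" and v = "\<lambda>_. w"])
       (use G in auto)
qed

lemma ppt_fun_let_const:
  assumes G: "ppt_fun (\<lambda>a. inp a @ [w]) G A" and len: "\<And>a. a \<in> A \<Longrightarrow> length (inp a) = n"
  shows "ppt_fun inp G A"
  by (rule ppt_fun_let[OF ppt_const[where inp = "\<lambda>_. []"], where js = "[]" and g = "\<lambda>_. ()" and v = "\<lambda>_. w"])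
     (use assms in auto)

section \<open>Min-entropy and Walsh characters\<close>

lemma finite_bitstrings [simp]: "finite (bitstrings r)"
  using finite_lists_length_eq[of "UNIV :: bool set" r] by (simp add: bitstrings_def)

lemma bitstrings_nonempty [simp]: "bitstrings r \<noteq> {}"
  using Ex_list_of_length by (auto simp: bitstrings_def)

lemma card_bitstrings [simp]: "card (bitstrings r) = 2 ^ r"
  using card_lists_length_eq[of "UNIV :: bool set" r] by (simp add: bitstrings_def)

lemma set_pmf_unif [simp]: "set_pmf (unif r) = bitstrings r"
  by (simp add: unif_def)

lemma expectation_unif:
  fixes f :: "bool list \<Rightarrow> real"
  shows "measure_pmf.expectation (unif r) f = (\<Sum>u\<in>bitstrings r. f u) / 2 ^ r"
  by (simp add: unif_def integral_pmf_of_set)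

lemma bitstrings_0: "bitstrings 0 = {[]}"
  by (simp add: bitstrings_def)

lemma bitstrings_Suc: "bitstrings (Suc r) = (#) False ` bitstrings r \<union> (#) True ` bitstrings r"
  by (auto simp: bitstrings_def length_Suc_conv image_iff)

lemma sum_bitstrings_Suc:
  "(\<Sum>v\<in>bitstrings (Suc r). f v) = (\<Sum>v\<in>bitstrings r. f (False # v)) + (\<Sum>v\<in>bitstrings r. f (True # v))"
  unfolding bitstrings_Suc by (subst sum.union_disjoint) (auto simp: sum.reindex)

text \<open>Among test functions with values in [0,1], the difference of the expectations is largest
  for the indicator of the event where \<open>p\<close> exceeds \<open>q\<close>.\<close>

lemma expectation_le_stat_dist:
  fixes f :: "'a \<Rightarrow> real"
  assumes fin: "finite (set_pmf p)" "finite (set_pmf q)" and f: "\<And>x. 0 \<le> f x" "\<And>x. f x \<le> 1"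
  shows "measure_pmf.expectation p f \<le> measure_pmf.expectation q f + stat_dist p q"
proof -
  let ?W = "set_pmf p \<union> set_pmf q"
  let ?A = "{x \<in> ?W. pmf p x > pmf q x}"
  have W: "finite ?W" using fin by simp
  have "measure_pmf.expectation p f - measure_pmf.expectation q f = (\<Sum>x\<in>?W. f x * (pmf p x - pmf q x))"
    using W by (simp add: integral_measure_pmf_real[of ?W] sum_subtractf algebra_simps)
  also have "\<dots> \<le> (\<Sum>x\<in>?W. if x \<in> ?A then pmf p x - pmf q x else 0)"
  proof (intro sum_mono)
    fix x assume "x \<in> ?W"
    then show "f x * (pmf p x - pmf q x) \<le> (if x \<in> ?A then pmf p x - pmf q x else 0)"
      using f[of x] by (auto simp: mult_left_le_one_le mult_nonneg_nonpos)
  qed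
  also have "\<dots> = (\<Sum>x\<in>?A. pmf p x - pmf q x)"
    by (rule sum.mono_neutral_cong_right) (use W in auto)
  also have "\<dots> = measure_pmf.prob p ?A - measure_pmf.prob q ?A"
    using W by (simp add: measure_measure_pmf_finite sum_subtractf)
  also have "\<dots> \<le> \<bar>measure_pmf.prob p ?A - measure_pmf.prob q ?A\<bar>"
    by simp
  also have "\<dots> \<le> stat_dist p q"
    unfolding stat_dist_def
  proof (rule cSUP_upper)
    have "\<bar>measure_pmf.prob p A - measure_pmf.prob q A\<bar> \<le> 1" for A
      using measure_pmf.prob_le_1[of p A] measure_pmf.prob_le_1[of q A]
        measure_nonneg[of "measure_pmf p" A] measure_nonneg[of "measure_pmf q" A] by linarith
    then show "bdd_above (range (\<lambda>A. \<bar>measure_pmf.prob p A - measure_pmf.prob q A\<bar>))"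
      by (intro bdd_aboveI[of _ 1]) auto
  qed simp
  finally show ?thesis by simp
qed

lemma pmf_le_SUP: "pmf Y v \<le> (SUP \<omega>. pmf Y \<omega>)"
  by (rule cSUP_upper) (auto intro: bdd_aboveI pmf_le_1)

lemma SUP_pmf_pos: "0 < (SUP \<omega>. pmf Y \<omega>)"
proof -
  obtain v where "v \<in> set_pmf Y" using set_pmf_not_empty[of Y] by blast
  then have "0 < pmf Y v" by (simp add: pmf_positive)
  also have "\<dots> \<le> (SUP \<omega>. pmf Y \<omega>)" by (rule pmf_le_SUP)
  finally show ?thesis .
qed

lemma pmf_le_min_entropy: "h \<le> min_entropy Y \<Longrightarrow> pmf Y v \<le> 2 powr (- h)"
proof -
  assume "h \<le> min_entropy Y"
  then have "log 2 (SUP \<omega>. pmf Y \<omega>) \<le> - h" by (simp add: min_entropy_def)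
  then have "(SUP \<omega>. pmf Y \<omega>) \<le> 2 powr (- h)"
    using SUP_pmf_pos[of Y] by (simp add: log_le_iff)
  then show ?thesis using pmf_le_SUP[of Y v] by linarith
qed

lemma min_entropy_ge:
  assumes "\<And>v. pmf X v \<le> 2 powr (- h)"
  shows "h \<le> min_entropy X"
proof -
  have "(SUP \<omega>. pmf X \<omega>) \<le> 2 powr (- h)"
    by (rule cSUP_least) (auto intro: assms)
  then have "log 2 (SUP \<omega>. pmf X \<omega>) \<le> - h"
    using SUP_pmf_pos[of X] by (simp add: log_le_iff)
  then show ?thesis by (simp add: min_entropy_def)
qed

section \<open>Characters of binary vector spaces and the second moment of a correlation\<close>

definition bit_sign :: "bool \<Rightarrow> real" where
  "bit_sign b = (if b then - 1 else 1)"

lemma abs_bit_sign [simp]: "\<bar>bit_sign a\<bar> = 1"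
  by (simp add: bit_sign_def)

lemma inner_F2_Nil [simp]: "\<not> inner_F2 [] v" "\<not> inner_F2 v []"
  by (simp_all add: inner_F2_def)

lemma inner_F2_Cons [simp]: "inner_F2 (a # m) (b # v) \<longleftrightarrow> ((a \<and> b) \<noteq> inner_F2 m v)"
proof -
  let ?S = "\<lambda>m v. {i. i < length m \<and> i < length v \<and> m ! i \<and> v ! i}"
  have "?S (a # m) (b # v) = (if a \<and> b then {0} else {}) \<union> Suc ` ?S m v"
    by (auto simp: image_iff less_Suc_eq_0_disj)
  moreover have "finite (?S m v)" by simp
  ultimately have "card (?S (a # m) (b # v)) = (if a \<and> b then 1 else 0) + card (?S m v)"
    by (auto simp: card_image card_insert_if)
  then show ?thesis by (auto simp: inner_F2_def)
qed

text \<open>Splitting off the first bit of \<open>m\<close> and of \<open>v\<close> turns the inner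
  sums into the sum and the difference of two shorter transforms; by the parallelogram law the mixed
  terms cancel.\<close>

lemma parseval:
  "(\<Sum>v\<in>bitstrings t. (\<Sum>m\<in>bitstrings t. g m * bit_sign (inner_F2 m v))\<^sup>2) = 2 ^ t * (\<Sum>m\<in>bitstrings t. (g m)\<^sup>2)"
proof (induction t arbitrary: g)
  case 0
  then show ?case by (simp add: bitstrings_0 bit_sign_def)
next
  case (Suc t)
  let ?F = "\<lambda>b v. \<Sum>m\<in>bitstrings t. g (b # m) * bit_sign (inner_F2 m v)"
  have sq: "(\<Sum>v\<in>V. (a v + b v)\<^sup>2) + (\<Sum>v\<in>V. (a v - b v)\<^sup>2) = 2 * (\<Sum>v\<in>V. (a v)\<^sup>2) + 2 * (\<Sum>v\<in>V. (b v)\<^sup>2)"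
    for a b :: "bool list \<Rightarrow> real" and V
    unfolding sum_distrib_left sum.distrib[symmetric]
    by (intro sum.cong refl) (simp add: power2_eq_square algebra_simps)
  have *: "(\<Sum>m\<in>bitstrings t. g (b # m) * bit_sign (inner_F2 (b # m) (c # v))) = bit_sign (b \<and> c) * ?F b v" for b c v
    by (auto simp: sum_distrib_left bit_sign_def intro!: sum.cong)
  have "(\<Sum>v\<in>bitstrings (Suc t). (\<Sum>m\<in>bitstrings (Suc t). g m * bit_sign (inner_F2 m v))\<^sup>2)
      = (\<Sum>v\<in>bitstrings t. (?F False v + ?F True v)\<^sup>2) + (\<Sum>v\<in>bitstrings t. (?F False v - ?F True v)\<^sup>2)"
    unfolding sum_bitstrings_Suc * by (simp add: bit_sign_def)
  also have "\<dots> = 2 * (\<Sum>v\<in>bitstrings t. (?F False v)\<^sup>2) + 2 * (\<Sum>v\<in>bitstrings t. (?F True v)\<^sup>2)"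
    by (rule sq)
  also have "\<dots> = 2 ^ Suc t * (\<Sum>m\<in>bitstrings (Suc t). (g m)\<^sup>2)"
    unfolding Suc sum_bitstrings_Suc by (simp add: algebra_simps)
  finally show ?case .
qed

text \<open>Once the weights of \<open>Y\<close> are replaced by the bound \<open>B\<close>, the sum
  runs over all characters with equal weight, and Parseval evaluates it to \<open>B\<close> times
  the mean of the squares of \<open>g\<close>. For \<open>B = 2 powr (- h)\<close> this says that
  the inner product with a source of min-entropy \<open>h\<close> is hard to predict.\<close>

lemma walsh_coefficient_bound:
  assumes g: "\<And>m. \<bar>g m\<bar> \<le> 1" and Y: "set_pmf Y \<subseteq> bitstrings t" "\<And>v. pmf Y v \<le> B"
  shows "measure_pmf.expectation Y (\<lambda>v. (measure_pmf.expectation (unif t) (\<lambda>m. g m * bit_sign (inner_F2 m v)))\<^sup>2) \<le> B"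
proof -
  have B: "0 \<le> B" using Y(2)[of undefined] pmf_nonneg[of Y undefined] by linarith
  define c where "c = (\<lambda>v. \<Sum>m\<in>bitstrings t. g m * bit_sign (inner_F2 m v))"
  have "measure_pmf.expectation Y (\<lambda>v. (measure_pmf.expectation (unif t) (\<lambda>m. g m * bit_sign (inner_F2 m v)))\<^sup>2)
      = (\<Sum>v\<in>bitstrings t. (c v / 2 ^ t)\<^sup>2 * pmf Y v)"
    unfolding expectation_unif c_def using Y(1) by (subst integral_measure_pmf_real[of "bitstrings t"]) auto
  also have "\<dots> \<le> (\<Sum>v\<in>bitstrings t. (c v / 2 ^ t)\<^sup>2 * B)"
    by (intro sum_mono mult_left_mono Y) simp
  also have "\<dots> = B * (\<Sum>v\<in>bitstrings t. (c v)\<^sup>2) / (2 ^ t)\<^sup>2"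
    unfolding sum_distrib_left sum_divide_distrib
    by (intro sum.cong refl) (simp add: power_divide mult.commute)
  also have "\<dots> = B * ((\<Sum>m\<in>bitstrings t. (g m)\<^sup>2) / 2 ^ t)"
    unfolding c_def parseval by (simp add: power2_eq_square)
  also have "\<dots> \<le> B * 1"
  proof (intro mult_left_mono B)
    have "(\<Sum>m\<in>bitstrings t. (g m)\<^sup>2) \<le> (\<Sum>m\<in>bitstrings t. 1)"
      by (intro sum_mono) (use g in \<open>simp add: abs_square_le_1\<close>)
    then show "(\<Sum>m\<in>bitstrings t. (g m)\<^sup>2) / 2 ^ t \<le> 1" by simp
  qed
  finally show ?thesis by simp
qed

text \<open>Jensen over the seed reduces to a single sampled restriction, which is all that the sampler
  guarantee speaks about.\<close>

lemma sampler_correlation_bound: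
  assumes s: "sampler r M t samp \<kappa> \<delta>" and g: "\<And>u m. \<bar>g u m\<bar> \<le> 1"
    and X: "set_pmf X \<subseteq> bitstrings M" "\<mu> * real M \<le> min_entropy X"
  shows "measure_pmf.expectation X (\<lambda>y. (measure_pmf.expectation (unif r) (\<lambda>u.
           measure_pmf.expectation (unif t) (\<lambda>m. g u m * bit_sign (inner_F2 m (nths y (samp u))))))\<^sup>2)
         \<le> 2 powr (- (\<mu> - \<kappa>) * real t) + \<delta>"
proof -
  define c where "c = (\<lambda>u v. measure_pmf.expectation (unif t) (\<lambda>m. g u m * bit_sign (inner_F2 m v)))"
  have c1: "\<bar>c u v\<bar> \<le> 1" for u v
  proof -
    have "\<bar>\<Sum>m\<in>bitstrings t. g u m * bit_sign (inner_F2 m v)\<bar> \<le> (\<Sum>m\<in>bitstrings t. 1)"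
      by (intro order_trans[OF sum_abs] sum_mono) (simp add: abs_mult g)
    then show ?thesis by (simp add: c_def expectation_unif)
  qed
  from s X obtain Y where Y: "\<And>u. u \<in> bitstrings r \<Longrightarrow> set_pmf (Y u) \<subseteq> bitstrings t"
      "\<And>u. u \<in> bitstrings r \<Longrightarrow> (\<mu> - \<kappa>) * real t \<le> min_entropy (Y u)"
    and sd: "stat_dist (bind_pmf (unif r) (\<lambda>u. map_pmf (\<lambda>v. (u, nths v (samp u))) X))
               (bind_pmf (unif r) (\<lambda>u. map_pmf (\<lambda>y. (u, y)) (Y u))) \<le> \<delta>"
    unfolding sampler_def by blast
  let ?P = "bind_pmf (unif r) (\<lambda>u. map_pmf (\<lambda>v. (u, nths v (samp u))) X)"
  let ?Q = "bind_pmf (unif r) (\<lambda>u. map_pmf (\<lambda>y. (u, y)) (Y u))"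
  have finX: "finite (set_pmf X)" and finY: "\<And>u. u \<in> bitstrings r \<Longrightarrow> finite (set_pmf (Y u))"
    using X Y(1) finite_subset finite_bitstrings by metis+
  have "measure_pmf.expectation X (\<lambda>y. (measure_pmf.expectation (unif r) (\<lambda>u. c u (nths y (samp u))))\<^sup>2)
      \<le> measure_pmf.expectation X (\<lambda>y. measure_pmf.expectation (unif r) (\<lambda>u. (c u (nths y (samp u)))\<^sup>2))"
  proof (intro integral_mono integrable_measure_pmf_finite finX)
    fix y
    show "(measure_pmf.expectation (unif r) (\<lambda>u. c u (nths y (samp u))))\<^sup>2
        \<le> measure_pmf.expectation (unif r) (\<lambda>u. (c u (nths y (samp u)))\<^sup>2)"
      by (rule measure_pmf.jensens_inequality[of "unif r" _ UNIV])
         (auto intro!: integrable_measure_pmf_finite convex_on_realI[where f' = "\<lambda>x. 2 * x"] derivative_eq_intros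
            simp: mult_left_mono convex_power2)
  qed
  also have "\<dots> = (\<Sum>u\<in>bitstrings r. measure_pmf.expectation X (\<lambda>y. (c u (nths y (samp u)))\<^sup>2)) / 2 ^ r"
    unfolding expectation_unif integral_divide_zero
    by (subst Bochner_Integration.integral_sum) (auto intro!: integrable_measure_pmf_finite finX)
  also have "\<dots> = measure_pmf.expectation ?P (\<lambda>(u, v). (c u v)\<^sup>2)"
    by (subst pmf_expectation_bind[of "bitstrings r"])
       (auto simp: finX unif_def sum_divide_distrib)
  \<comment> \<open>The squared coefficient is a function of seed and restriction together with
    values in [0,1], as the comparison by statistical distance requires.\<close>
  also have "\<dots> \<le> measure_pmf.expectation ?Q (\<lambda>(u, v). (c u v)\<^sup>2) + stat_dist ?P ?Q"
    by (rule expectation_le_stat_dist) (use c1 finX finY in \<open>auto simp: abs_square_le_1\<close>)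
  also have "measure_pmf.expectation ?Q (\<lambda>(u, v). (c u v)\<^sup>2)
      = (\<Sum>u\<in>bitstrings r. measure_pmf.expectation (Y u) (\<lambda>v. (c u v)\<^sup>2)) / 2 ^ r"
    by (subst pmf_expectation_bind[of "bitstrings r"])
       (auto simp: finY unif_def sum_divide_distrib)
  also have "\<dots> \<le> (\<Sum>u\<in>bitstrings r. 2 powr (- (\<mu> - \<kappa>) * real t)) / 2 ^ r"
    unfolding c_def
    by (intro divide_right_mono sum_mono walsh_coefficient_bound g Y(1))
       (use pmf_le_min_entropy[OF Y(2)] in \<open>auto simp: algebra_simps\<close>)
  also have "\<dots> = 2 powr (- (\<mu> - \<kappa>) * real t)"
    by simp
  finally show ?thesis using sd by (simp add: c_def)
qed

text \<open>A model from a class of size \<open>2 ^ (M / 2)\<close> leaves the secret with min-entropy \<open>3/8 M\<close>,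
  except with probability \<open>2 ^ (- M / 8)\<close>.\<close>

lemma compression_bound:
  fixes K :: "bool list \<Rightarrow> 'f pmf" and c :: "'f \<Rightarrow> bool list \<Rightarrow> real"
  assumes \<Phi>: "finite \<Phi>" "real (card \<Phi>) \<le> 2 powr (real M / 2)"
    and K: "\<And>y. y \<in> bitstrings M \<Longrightarrow> set_pmf (K y) \<subseteq> \<Phi>"
    and c: "\<And>f y. 0 \<le> c f y" "\<And>f y. c f y \<le> 1"
    and \<eta>: "0 \<le> \<eta>" "\<And>f X. set_pmf X \<subseteq> bitstrings M \<Longrightarrow> 3 / 8 * real M \<le> min_entropy X \<Longrightarrow>
               measure_pmf.expectation X (c f) \<le> \<eta>"
  shows "measure_pmf.expectation (unif M) (\<lambda>y. measure_pmf.expectation (K y) (\<lambda>f. c f y))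
           \<le> 2 powr (- real M / 8) + \<eta>"
proof -
  \<comment> \<open>Joint law of the uniform secret \<open>y\<close> and the model \<open>f\<close>;
    \<open>W\<close> is the marginal of the model.\<close>
  define J where "J = (\<lambda>f y. pmf (K y) f / 2 ^ M)"
  define W where "W = (\<lambda>f. \<Sum>y\<in>bitstrings M. J f y)"
  have J0: "0 \<le> J f y" for f y by (simp add: J_def)
  have W0: "0 \<le> W f" for f by (simp add: W_def J0 sum_nonneg)
  have EK: "measure_pmf.expectation (K y) h = (\<Sum>f\<in>\<Phi>. h f * pmf (K y) f)" if "y \<in> bitstrings M" for y and h :: "'f \<Rightarrow> real"
    using K[OF that] \<Phi>(1) by (intro integral_measure_pmf_real) auto
  have WS: "(\<Sum>f\<in>\<Phi>. W f) = 1"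
  proof -
    have "(\<Sum>f\<in>\<Phi>. W f) = (\<Sum>y\<in>bitstrings M. \<Sum>f\<in>\<Phi>. J f y)"
      unfolding W_def by (rule sum.swap)
    also have "\<dots> = (\<Sum>y\<in>bitstrings M. 1 / 2 ^ M)"
    proof (intro sum.cong refl)
      fix y assume "y \<in> bitstrings M"
      from EK[OF this, of "\<lambda>_. 1"] show "(\<Sum>f\<in>\<Phi>. J f y) = 1 / 2 ^ M"
        by (simp add: J_def flip: sum_divide_distrib)
    qed
    finally show ?thesis by simp
  qed
  \<comment> \<open>5/8 = 1/2 + 1/8. Models of weight below this threshold have total weight at most
    2^(M/2) * 2^(-5M/8) = 2^(-M/8); for the others, conditioning raises the probability of a secret
    from 2^(-M) to at most 2^(-3M/8).\<close>
  let ?b = "2 powr (- 5 / 8 * real M)"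
  have main: "(\<Sum>y\<in>bitstrings M. J f y * c f y) \<le> ?b + W f * \<eta>" for f
  proof (cases "W f < ?b")
    case True
    have "(\<Sum>y\<in>bitstrings M. J f y * c f y) \<le> W f"
      unfolding W_def by (intro sum_mono) (simp add: J0 c mult_left_le)
    with True W0[of f] \<eta>(1) show ?thesis by (smt (verit) mult_nonneg_nonneg)
  next
    case False
    have Wpos: "W f > 0" using False by (smt (verit) powr_gt_zero)
    \<comment> \<open>The law of the secret conditioned on the model being \<open>f\<close>.\<close>
    define X where "X = embed_pmf (\<lambda>y. if y \<in> bitstrings M then J f y / W f else 0)"
    have pX: "pmf X y = (if y \<in> bitstrings M then J f y / W f else 0)" for y
      unfolding X_def
    proof (rule pmf_embed_pmf)
      have "(\<integral>\<^sup>+ y. ennreal (if y \<in> bitstrings M then J f y / W f else 0) \<partial>count_space UNIV)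
          = (\<integral>\<^sup>+ y. ennreal (J f y / W f) \<partial>count_space (bitstrings M))"
        by (subst nn_integral_count_space_indicator)
           (auto intro!: nn_integral_cong simp: indicator_def)
      also have "\<dots> = ennreal (\<Sum>y\<in>bitstrings M. J f y / W f)"
        by (subst nn_integral_count_space_finite) (use Wpos J0 in \<open>auto intro!: sum_ennreal\<close>)
      also have "(\<Sum>y\<in>bitstrings M. J f y / W f) = 1"
        using Wpos by (simp add: W_def flip: sum_divide_distrib)
      finally show "(\<integral>\<^sup>+ y. ennreal (if y \<in> bitstrings M then J f y / W f else 0) \<partial>count_space UNIV) = 1"
        by simp
    qed (use Wpos J0 in auto)
    have sX: "set_pmf X \<subseteq> bitstrings M"
      by (auto simp: set_pmf_eq pX split: if_splits)
    have "3 / 8 * real M \<le> min_entropy X"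
    proof (rule min_entropy_ge)
      fix y
      have "J f y / W f \<le> (1 / 2 ^ M) / ?b"
        using False Wpos by (intro frac_le) (auto simp: J_def pmf_le_1 divide_right_mono)
      also have "\<dots> = 2 powr (- (3 / 8 * real M))"
        by (simp add: powr_minus powr_realpow[symmetric] powr_add[symmetric] divide_simps)
      finally show "pmf X y \<le> 2 powr (- (3 / 8 * real M))"
        by (simp add: pX)
    qed
    from \<eta>(2)[OF sX this, of f] have "(\<Sum>y\<in>bitstrings M. c f y * pmf X y) \<le> \<eta>"
      using sX by (subst (asm) integral_measure_pmf_real[of "bitstrings M"]) auto
    then have "W f * (\<Sum>y\<in>bitstrings M. c f y * pmf X y) \<le> W f * \<eta>"
      by (intro mult_left_mono W0)
    also have "W f * (\<Sum>y\<in>bitstrings M. c f y * pmf X y) = (\<Sum>y\<in>bitstrings M. J f y * c f y)"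
      unfolding sum_distrib_left using Wpos by (intro sum.cong) (auto simp: pX)
    finally show ?thesis by (smt (verit) powr_ge_zero)
  qed
  have "measure_pmf.expectation (unif M) (\<lambda>y. measure_pmf.expectation (K y) (\<lambda>f. c f y))
      = (\<Sum>y\<in>bitstrings M. \<Sum>f\<in>\<Phi>. J f y * c f y)"
    unfolding expectation_unif sum_divide_distrib
    by (intro sum.cong refl) (simp add: EK J_def sum_divide_distrib mult.commute)
  also have "\<dots> = (\<Sum>f\<in>\<Phi>. \<Sum>y\<in>bitstrings M. J f y * c f y)"
    by (rule sum.swap)
  also have "\<dots> \<le> (\<Sum>f\<in>\<Phi>. ?b + W f * \<eta>)"
    by (intro sum_mono main)
  also have "\<dots> = real (card \<Phi>) * ?b + \<eta>"
    by (simp add: sum.distrib WS flip: sum_distrib_right)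
  also have "real (card \<Phi>) * ?b \<le> 2 powr (real M / 2) * ?b"
    by (intro mult_right_mono \<Phi>) simp
  also have "\<dots> = 2 powr (- real M / 8)"
    by (simp flip: powr_add)
  finally show ?thesis by simp
qed

section \<open>Random strings, encodings and loops\<close>

lemma iterM_return: "iterM n (\<lambda>v. return_pmf (f v)) v = return_pmf ((f ^^ n) v)"
  by (induction n arbitrary: v) (simp_all add: bind_return_pmf funpow_swap1)

abbreviation coin :: "bool pmf" where
  "coin \<equiv> pmf_of_set UNIV"

text \<open>The new bit is put last, because in a loop that pushes coins the first one drawn ends up
  at the bottom of the stack.\<close>

lemma unif_Suc: "unif (Suc n) = bind_pmf coin (\<lambda>b. map_pmf (\<lambda>v. v @ [b]) (unif n))"
proof -
  have "bij_betw (\<lambda>(b, v). v @ [b]) (UNIV \<times> bitstrings n) (bitstrings (Suc n))"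
  proof (rule bij_betwI[where g = "\<lambda>w. (last w, butlast w)"], goal_cases)
    case 4
    then show ?case by (auto simp: bitstrings_def) (metis append_butlast_last_id length_0_conv nat.distinct(1))
  qed (auto simp: bitstrings_def)
  then have inj: "inj_on (\<lambda>(b, v). v @ [b]) (UNIV \<times> bitstrings n)"
    and im: "(\<lambda>(b, v). v @ [b]) ` (UNIV \<times> bitstrings n) = bitstrings (Suc n)"
    by (auto simp: bij_betw_def)
  have "unif (Suc n) = map_pmf (\<lambda>(b, v). v @ [b]) (pmf_of_set (UNIV \<times> bitstrings n))"
    unfolding unif_def by (subst map_pmf_of_set_inj[OF inj]) (auto simp flip: im)
  also have "pmf_of_set (UNIV \<times> bitstrings n) = pair_pmf coin (unif n)"
    unfolding unif_def
    by (intro pmf_eqI) (auto simp: pmf_pair indicator_def card_cartesian_product split: prod.splits)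
  finally show ?thesis
    by (simp add: pair_pmf_def map_bind_pmf map_pmf_def bind_assoc_pmf bind_return_pmf)
qed

lemma iterM_coins: "iterM n (\<lambda>v. map_pmf (\<lambda>b. b # v) coin) w = map_pmf (\<lambda>v. v @ w) (unif n)"
proof (induction n arbitrary: w)
  case 0
  show ?case by (simp add: unif_def bitstrings_0 pmf_of_set_singleton)
next
  case (Suc n)
  show ?case unfolding iterM.simps unif_Suc
    by (simp add: bind_map_pmf Suc map_bind_pmf map_pmf_comp)
qed

lemma unary_eq_iff [simp]: "unary m = unary n \<longleftrightarrow> m = n"
  by (auto simp: unary_def)

lemma length_unary [simp]: "length (unary n) = n"
  by (simp add: unary_def)

lemma ppt_coins: "ppt_fun (\<lambda>v. [v]) (\<lambda>v. unif (length v)) UNIV"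
proof (rule ppt_fun_let_const[where w = "[]" and n = 1])
  have F: "ppt_fun (\<lambda>(v, w). [v, []] @ [w]) (\<lambda>(v, w). map_pmf (\<lambda>b. b # w) coin) UNIV"
    by (rule ppt_fun_cong[OF ppt_fun_call[OF ppt_push_coin, where A = UNIV and n = 3
        and inp = "\<lambda>(v, w). [v, [], w]" and js = "[2]" and g = snd]]) auto
  have "ppt_fun (\<lambda>v. [v, []]) (\<lambda>v. iterM (length ([v, []] ! 0)) (\<lambda>w. map_pmf (\<lambda>b. b # w) coin) ([v, []] ! 1)) UNIV"
  proof (rule ppt_fun_iter[where n = 2 and k = 0 and i = 1 and I = "\<lambda>_ j. bitstrings j" and q = "[:0, 1:]"], goal_cases)
    case 1
    show ?case by (rule ppt_fun_cong[OF F]) auto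
  qed (auto simp: bitstrings_def)
  then show "ppt_fun (\<lambda>a. [a] @ [[]]) (\<lambda>v. unif (length v)) UNIV"
    by (simp add: iterM_coins)
qed auto

lemma funpow_append_prefix: "((\<lambda>u. w @ u) ^^ n) u = concat (replicate n w) @ u"
  by (induction n) auto

lemma ppt_replicate:
  "ppt_fun (\<lambda>(v, w). [v, w]) (\<lambda>(v, w). return_pmf (concat (replicate (length v) w))) UNIV"
proof (rule ppt_fun_let_const[where w = "[]" and n = 2])
  let ?inp = "\<lambda>(v, w). [v, w, []]"
  have F: "ppt_fun (\<lambda>((v, w), u). [v, w, [], u]) (\<lambda>((v, w), u). return_pmf (w @ u)) UNIV"
    by (rule ppt_fun_cong[OF ppt_fun_call[OF ppt_append, where A = UNIV and n = 4
        and inp = "\<lambda>((v, w), u). [v, w, [], u]" and js = "[1, 3]" and g = "\<lambda>((v, w), u). (w, u)"]]) auto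
  have "ppt_fun ?inp (\<lambda>a. iterM (length (?inp a ! 0)) (\<lambda>u. return_pmf (snd a @ u)) (?inp a ! 2)) UNIV"
  proof (rule ppt_fun_iter[where n = 3 and k = 0 and i = 2 and q = "[:0, 0, 1:]"
          and I = "\<lambda>a j. {u. length u \<le> j * length (snd a)}"], goal_cases)
    case 1
    show ?case by (rule ppt_fun_cong[OF F]) auto
  next
    case (7 a j u)
    obtain v w where a: "a = (v, w)" by fastforce
    from 7 have "length u \<le> j * length w" by (simp add: a)
    also have "\<dots> \<le> (length v + length w) * (length v + length w)"
      using 7 by (intro mult_le_mono) (auto simp: a)
    finally show ?case by (simp add: a)
  qed auto
  then show "ppt_fun (\<lambda>a. (case a of (v, w) \<Rightarrow> [v, w]) @ [[]])
     (\<lambda>(v, w). return_pmf (concat (replicate (length v) w))) UNIV"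
    by (rule ppt_fun_cong) (auto simp: iterM_return funpow_append_prefix)
qed auto

lemma concat_replicate_unary: "concat (replicate m (unary n)) = unary (m * n)"
  by (induction m) (auto simp: unary_def replicate_add)

definition double_coin :: "bool list \<Rightarrow> bool list pmf" where
  "double_coin v = map_pmf (\<lambda>b. unary (2 * length v + of_bool b)) coin"

text \<open>Each step appends a digit, so \<open>k\<close> steps from \<open>j\<close> reach the
  numbers from \<open>2 ^ k * j\<close> up to, but excluding, \<open>2 ^ k * Suc j\<close>, each in
  one way. The induction varies \<open>j\<close>, because the first digit decides in which half of
  this interval \<open>N\<close> lies.\<close>

lemma pmf_iterM_double_coin:
  "2 ^ k * j \<le> N \<Longrightarrow> N < 2 ^ k * Suc j \<Longrightarrow> 1 / 2 ^ k \<le> pmf (iterM k double_coin (unary j)) (unary N)"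
proof (induction k arbitrary: j)
  case 0
  then show ?case by simp
next
  case (Suc k)
  let ?p = "\<lambda>j. pmf (iterM k double_coin (unary j)) (unary N)"
  have "1 / 2 ^ k \<le> ?p (2 * j) + ?p (2 * j + 1)"
  proof (cases "N < 2 ^ k * Suc (2 * j)")
    case True
    with Suc.prems have "1 / 2 ^ k \<le> ?p (2 * j)" by (intro Suc.IH) simp_all
    then show ?thesis using pmf_nonneg[of "iterM k double_coin (unary (2 * j + 1))" "unary N"] by linarith
  next
    case False
    with Suc.prems have "1 / 2 ^ k \<le> ?p (2 * j + 1)" by (intro Suc.IH) simp_all
    then show ?thesis using pmf_nonneg[of "iterM k double_coin (unary (2 * j))" "unary N"] by linarith
  qed
  moreover have "pmf (iterM (Suc k) double_coin (unary j)) (unary N) = (?p (2 * j) + ?p (2 * j + 1)) / 2"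
    by (simp add: double_coin_def bind_map_pmf pmf_bind integral_pmf_of_set UNIV_bool add.commute)
  ultimately show ?case by simp
qed

text \<open>\<open>v\<close> counts the binary digits, but the result is written in unary and may be
  exponentially longer. The register \<open>unary l\<close> supplies the budget in which this length
  is polynomial.\<close>

lemma ppt_random_nat:
  assumes "\<And>l v. (l, v) \<in> A \<Longrightarrow> 2 ^ length v \<le> poly q l"
  shows "ppt_fun (\<lambda>(l, v). [unary l, v]) (\<lambda>(l, v). iterM (length v) double_coin []) A"
proof (rule ppt_fun_let_const[where w = "[]" and n = 2])
  let ?inp = "\<lambda>(l, v). [unary l, v, []]"
  have F: "ppt_fun (\<lambda>(a, w). ?inp a @ [w]) (\<lambda>(a, w). double_coin w) UNIV"
    by (rule ppt_fun_cong[OF ppt_fun_call[OF ppt_double_coin, where A = UNIV and n = 4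
        and inp = "\<lambda>(a, w). ?inp a @ [w]" and js = "[3]" and g = snd]])
       (auto simp: double_coin_def)
  have "ppt_fun ?inp (\<lambda>a. iterM (length (?inp a ! 1)) double_coin (?inp a ! 2)) A"
  proof (rule ppt_fun_iter[where n = 3 and k = 1 and i = 2 and q = q
          and I = "\<lambda>a j. unary ` {..<2 ^ j}"], goal_cases)
    case 1
    show ?case by (rule ppt_fun_cong[OF F]) auto
  next
    case (7 a j v)
    obtain l w where a: "a = (l, w)" by fastforce
    from 7 have "length v < 2 ^ j" by auto
    also have "\<dots> \<le> 2 ^ length w" using 7 by (intro power_increasing) (auto simp: a)
    also have "\<dots> \<le> poly q l" using assms 7 by (auto simp: a)
    also have "\<dots> \<le> poly q (input_size (?inp a))" by (intro poly_nat_mono) (simp add: a)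
    finally show ?case by simp
  next
    case (6 a j v)
    have "2 * N + of_bool b < 2 ^ Suc j" if "N < 2 ^ j" for N :: nat and b
      using that by (cases b) auto
    with 6 show ?case by (auto simp: double_coin_def)
  qed (auto simp: unary_def)
  then show "ppt_fun (\<lambda>a. (case a of (l, v) \<Rightarrow> [unary l, v]) @ [[]])
     (\<lambda>(l, v). iterM (length v) double_coin []) A"
    by (rule ppt_fun_cong) auto
qed auto

lemma ppt_encode2: "ppt_fun (\<lambda>(a, b). [a, b]) (\<lambda>(a, b). return_pmf (encode_list [a, b])) UNIV"
proof -
  have *: "ppt_fun (\<lambda>(a, b). [a, b, encode_list [a], encode_list [b]]) (\<lambda>(a, b). return_pmf (encode_list [a, b])) UNIV"
    by (rule ppt_fun_cong[OF ppt_fun_call[OF ppt_append, where A = UNIV and n = 4 and js = "[2, 3]"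
          and inp = "\<lambda>(a, b). [a, b, encode_list [a], encode_list [b]]" and g = "\<lambda>(a, b). (encode_list [a], encode_list [b])"]])
       (auto simp: encode_list_def)
  have **: "ppt_fun (\<lambda>(a, b). [a, b, encode_list [a]]) (\<lambda>(a, b). return_pmf (encode_list [a, b])) UNIV"
    by (rule ppt_fun_let[OF ppt_encode, where n = 3 and js = "[1]" and g = snd and v = "\<lambda>(a, b). encode_list [b]"]) (auto intro!: ppt_fun_cong[OF *])
  show ?thesis
    by (rule ppt_fun_let[OF ppt_encode, where n = 2 and js = "[0]" and g = fst and v = "\<lambda>(a, b). encode_list [a]"]) (auto intro!: ppt_fun_cong[OF **])
qed

lemma ppt_encode4:
  "ppt_fun (\<lambda>(a, b, c, d). [a, b, c, d]) (\<lambda>(a, b, c, d). return_pmf (encode_list [a, b, c, d])) UNIV"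
proof -
  have *: "ppt_fun (\<lambda>(a, b, c, d). [a, b, c, d, encode_list [a, b], encode_list [c, d]])
      (\<lambda>(a, b, c, d). return_pmf (encode_list [a, b, c, d])) UNIV"
    by (rule ppt_fun_cong[OF ppt_fun_call[OF ppt_append, where A = UNIV and n = 6 and js = "[4, 5]"
          and inp = "\<lambda>(a, b, c, d). [a, b, c, d, encode_list [a, b], encode_list [c, d]]"
          and g = "\<lambda>(a, b, c, d). (encode_list [a, b], encode_list [c, d])"]])
       (auto simp: encode_list_def)
  have **: "ppt_fun (\<lambda>(a, b, c, d). [a, b, c, d, encode_list [a, b]])
      (\<lambda>(a, b, c, d). return_pmf (encode_list [a, b, c, d])) UNIV"
    by (rule ppt_fun_let[OF ppt_encode2, where n = 5 and js = "[2, 3]" and g = "\<lambda>(a, b, c, d). (c, d)"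
          and v = "\<lambda>(a, b, c, d). encode_list [c, d]"])
       (auto intro!: ppt_fun_cong[OF *])
  show ?thesis
    by (rule ppt_fun_let[OF ppt_encode2, where n = 4 and js = "[0, 1]" and g = "\<lambda>(a, b, c, d). (a, b)"
          and v = "\<lambda>(a, b, c, d). encode_list [a, b]"])
       (auto intro!: ppt_fun_cong[OF **])
qed

lemma ppt_unif:
  assumes "ppt_fun inp (\<lambda>a. return_pmf (unary (g a))) A" "\<And>a. a \<in> A \<Longrightarrow> length (inp a) = n"
  shows "ppt_fun inp (\<lambda>a. unif (g a)) A"
proof (rule ppt_fun_let[OF assms(1), where n = n and js = "[0..<n]" and g = "\<lambda>a. a" and v = "\<lambda>a. unary (g a)"])
  show "ppt_fun (\<lambda>a. inp a @ [unary (g a)]) (\<lambda>a. unif (g a)) A"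
    by (rule ppt_fun_cong[OF ppt_fun_call[OF ppt_coins, where A = A and n = "Suc n" and js = "[n]"
        and inp = "\<lambda>a. inp a @ [unary (g a)]" and g = "\<lambda>a. unary (g a)"]])
      (use assms(2) in \<open>auto simp: nth_append\<close>)
qed (use assms(2) in \<open>auto intro!: nth_equalityI\<close>)

lemma ppt_unary_mult:
  assumes f: "ppt_fun inp (\<lambda>a. return_pmf (unary (f a))) A"
    and g: "ppt_fun inp (\<lambda>a. return_pmf (unary (g a))) A" and len: "\<And>a. a \<in> A \<Longrightarrow> length (inp a) = n"
  shows "ppt_fun inp (\<lambda>a. return_pmf (unary (f a * g a))) A"
proof (rule ppt_fun_let[OF f, where n = n and js = "[0..<n]" and g = "\<lambda>a. a" and v = "\<lambda>a. unary (f a)"])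
  show "ppt_fun (\<lambda>a. inp a @ [unary (f a)]) (\<lambda>a. return_pmf (unary (f a * g a))) A"
  proof (rule ppt_fun_let[OF g, where n = "Suc n" and js = "[0..<n]" and g = "\<lambda>a. a" and v = "\<lambda>a. unary (g a)"])
    show "ppt_fun (\<lambda>a. (inp a @ [unary (f a)]) @ [unary (g a)]) (\<lambda>a. return_pmf (unary (f a * g a))) A"
      by (rule ppt_fun_cong[OF ppt_fun_call[OF ppt_replicate, where A = A and n = "Suc (Suc n)" and js = "[n, Suc n]"
          and inp = "\<lambda>a. (inp a @ [unary (f a)]) @ [unary (g a)]" and g = "\<lambda>a. (unary (f a), unary (g a))"]])
        (use len in \<open>auto simp: nth_append concat_replicate_unary\<close>)
  qed (use len in \<open>auto simp: nth_append intro!: nth_equalityI\<close>)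
qed (use len in \<open>auto intro!: nth_equalityI\<close>)

lemma ppt_unary_const:
  assumes "\<And>a. a \<in> A \<Longrightarrow> length (inp a) = n"
  shows "ppt_fun inp (\<lambda>a. return_pmf w) A"
  using ppt_fun_call[OF ppt_const[where inp = "\<lambda>_. []" and w = w], where A = A and inp = inp and n = n
      and js = "[]" and g = "\<lambda>_. ()"] assms
  by simp

lemma ppt_to_unary: "ppt_fun (\<lambda>v. [v]) (\<lambda>v. return_pmf (unary (length v))) UNIV"
proof (rule ppt_fun_let_const[where w = "unary 1" and n = 1])
  show "ppt_fun (\<lambda>v. [v] @ [unary 1]) (\<lambda>v. return_pmf (unary (length v))) UNIV"
    by (rule ppt_fun_cong[OF ppt_fun_call[OF ppt_replicate, where A = UNIV and n = 2 and js = "[0, 1]"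
          and inp = "\<lambda>v. [v] @ [unary 1]" and g = "\<lambda>v. (v, unary 1)"]])
       (auto simp: concat_replicate_unary)
qed auto

section \<open>Masks as restrictions to sets of coordinates\<close>

lemma select2_eq_map2:
  "length y = length d \<Longrightarrow> length e = card {i. i < length d \<and> d ! i} \<Longrightarrow>
   select2 f d y e = map2 f (nths y {i. i < length d \<and> d ! i}) e"
proof (induction d arbitrary: y e)
  case (Cons b d)
  then obtain a y' where y: "y = a # y'" "length y' = length d" by (cases y) auto
  let ?S = "{i. i < length d \<and> d ! i}"
  have S: "{i. i < length (b # d) \<and> (b # d) ! i} = (if b then {0} else {}) \<union> Suc ` ?S"
    by (auto simp: image_iff less_Suc_eq_0_disj)
  then have card: "card {i. i < length (b # d) \<and> (b # d) ! i} = of_bool b + card ?S"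
    by (auto simp: card_image card_insert_if)
  have nths: "nths y {i. i < length (b # d) \<and> (b # d) ! i} = (if b then [a] else []) @ nths y' ?S"
    by (simp add: y nths_Cons)
  show ?case
  proof (cases b)
    case True
    then obtain c e' where "e = c # e'" "length e' = card ?S" using Cons.prems card by (cases e) auto
    then show ?thesis using True Cons.IH[OF y(2)] unfolding nths by (simp add: head_def y(1))
  next
    case False
    then show ?thesis using Cons.IH[OF y(2), of e] Cons.prems card unfolding nths by (simp add: y(1))
  qed
qed simp

lemma indicator_string_set: "A \<subseteq> {..<M} \<Longrightarrow> {i. i < length (indicator_string M A) \<and> indicator_string M A ! i} = A"
  by (auto simp: indicator_string_def)

lemma select2_indicator:
  assumes "A \<subseteq> {..<M}" "length y = M" "length e = card A"
  shows "select2 f (indicator_string M A) y e = map2 f (nths y A) e"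
  using select2_eq_map2[of y "indicator_string M A" e f] assms unfolding indicator_string_set[OF assms(1)]
  by (simp add: indicator_string_def)

lemma length_nths_subset: "A \<subseteq> {..<length y} \<Longrightarrow> length (nths y A) = card A"
  by (simp add: length_nths) (metis Collect_mem_eq Collect_conj_eq inf.absorb2 lessThan_def inf_commute)

lemma inner_F2_parity: "length v = length w \<Longrightarrow> inner_F2 v w = parity (map2 (\<and>) w v)"
proof (induction v w rule: list_induct2)
  case (Cons a v b w)
  then show ?case by (auto simp: parity_def)
qed (simp add: parity_def)

section \<open>The learning problem\<close>

lemma chunks_0 [simp]: "chunks b 0 v = []"
  by (simp add: chunks_def)

lemma chunks_Suc: "chunks b (Suc k) v = take b v # chunks b k (drop b v)"
proof -
  have "[0..<Suc k] = 0 # map Suc [0..<k]" by (simp add: upt_conv_Cons map_Suc_upt del: upt_Suc)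
  then show ?thesis by (simp add: chunks_def comp_def add.commute del: upt_Suc)
qed

lemma length_chunks [simp]: "length (chunks b k v) = k"
  by (simp add: chunks_def)

lemma concat_chunks: "length v = k * b \<Longrightarrow> concat (chunks b k v) = v"
  by (induction k arbitrary: v) (simp_all add: chunks_Suc)

lemma set_chunks: "length v = k * b \<Longrightarrow> set (chunks b k v) \<subseteq> bitstrings b"
  by (induction k arbitrary: v) (simp_all add: chunks_Suc, simp add: bitstrings_def)

lemma chunks_concat:
  "set m \<subseteq> bitstrings b \<Longrightarrow> length m = k \<Longrightarrow> chunks b k (concat m) = m \<and> length (concat m) = k * b"
  by (induction m arbitrary: k) (auto simp: chunks_Suc bitstrings_def)

text \<open>Cutting a bit string into symbols is inverted by concatenation. This lets the message be
  drawn with coins and Parseval's identity be applied to its bits.\<close>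

lemma pmf_of_set_vectors:
  assumes "carrier F = bitstrings b"
  shows "pmf_of_set (vectors F k) = map_pmf (chunks b k) (unif (k * b))"
proof -
  have "inj_on (chunks b k) (bitstrings (k * b))"
    by (rule inj_on_inverseI[where g = concat]) (simp add: bitstrings_def concat_chunks)
  moreover have "chunks b k ` bitstrings (k * b) = vectors F k"
  proof safe
    fix v assume "v \<in> bitstrings (k * b)"
    then show "chunks b k v \<in> vectors F k"
      using set_chunks[of v k b] by (auto simp: vectors_def assms bitstrings_def)
  next
    fix m assume "m \<in> vectors F k"
    then have "chunks b k (concat m) = m \<and> length (concat m) = k * b"
      by (intro chunks_concat) (auto simp: vectors_def assms)
    then show "m \<in> chunks b k ` bitstrings (k * b)"
      by (intro image_eqI[of _ _ "concat m"]) (auto simp: bitstrings_def)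
  qed
  ultimately show ?thesis
    unfolding unif_def by (subst map_pmf_of_set_inj) auto
qed

lemma concat_map2_map2:
  "length E = length C \<Longrightarrow> set E \<subseteq> bitstrings b \<Longrightarrow> set C \<subseteq> bitstrings b \<Longrightarrow>
   concat (map2 (map2 f) E C) = map2 f (concat E) (concat C)"
  by (induction E C rule: list_induct2) (auto simp: bitstrings_def)

lemma rs_encode_vectors:
  assumes F: "field F" and m: "m \<in> vectors F k" and pt: "pt ` {..<n} \<subseteq> carrier F"
  shows "rs_encode F pt n m \<in> vectors F n"
proof -
  interpret field F by (rule F)
  have "(\<Oplus>\<^bsub>F\<^esub>j\<in>{..<length m}. m ! j \<otimes>\<^bsub>F\<^esub> (pt i [^]\<^bsub>F\<^esub> j)) \<in> carrier F" if "i < n" for i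
  proof (intro finsum_closed Pi_I m_closed nat_pow_closed)
    fix j assume "j \<in> {..<length m}"
    then show "m ! j \<in> carrier F" using m by (auto simp: vectors_def)
  qed (use pt that in auto)
  then show ?thesis by (auto simp: rs_encode_def vectors_def)
qed

text \<open>A codeword is at distance 0 from itself, so the decoder is a left inverse. Injectivity
  is what lets \<open>hyp\<close> recover the seed from a point.\<close>

lemma corrects_inj_on:
  assumes "corrects msgs A C e"
  shows "inj_on C msgs"
proof -
  from assms obtain N dec where *: "\<forall>v\<in>msgs. length (C v) = N \<and> set (C v) \<subseteq> A \<and>
        (\<forall>w. length w = N \<and> set w \<subseteq> A \<and> hamming w (C v) \<le> e \<longrightarrow> dec w = v)"
    unfolding corrects_def by blast
  have "hamming (C v) (C v) = 0" for v by (simp add: hamming_def)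
  then have "dec (C v) = v" if "v \<in> msgs" for v
    using bspec[OF * that] by simp
  then show ?thesis by (rule inj_on_inverseI)
qed

text \<open>The structural facts that are granted only for large \<open>l\<close>, bundled as a
  property of a single \<open>l\<close> so that they can serve as a promise for programs.\<close>

definition good :: "blocks \<Rightarrow> nat \<Rightarrow> bool" where
  "good B l \<longleftrightarrow>
     inj_on (ecc B l) (bitstrings (seed1 B l)) \<and>
     (\<forall>u\<in>bitstrings (seed1 B l). samp1 B l u \<subseteq> {..<alpha B l} \<and> card (samp1 B l u) = msg_len B l * sym_len B l) \<and>
     (\<forall>u\<in>bitstrings (seed2 B l). samp2 B l u \<subseteq> {..<beta B l} \<and> card (samp2 B l u) = code_len B l * sym_len B l) \<and>
     eval_pt B l ` {..<code_len B l} \<subseteq> carrier (fld B l)"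

definition seeds :: "blocks \<Rightarrow> nat \<Rightarrow> (bool list \<times> bool list \<times> bool list) set" where
  "seeds B l = bitstrings (seed1 B l) \<times> bitstrings (seed2 B l) \<times> bitstrings (msg_len B l * sym_len B l)"

text \<open>Points become functions of their coins: the message is given by its bits
  \<open>v\<close>, and the seed \<open>unary l\<close> is determined by the security
  parameter.\<close>

definition point_of :: "blocks \<Rightarrow> nat \<Rightarrow> bool list \<times> bool list \<times> bool list \<Rightarrow> point" where
  "point_of B l = (\<lambda>(u1, u2, v). let m = chunks (sym_len B l) (msg_len B l) v in
     (ecc B l u1, ecc B l u2, m,
       map2 (\<lambda>a b. a \<oplus>\<^bsub>fld B l\<^esub> b) (Enc B l m)
         (chunks (sym_len B l) (code_len B l) (nths (prg2 B (unary l)) (samp2 B l u2)))))"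

definition seed_dist :: "blocks \<Rightarrow> nat \<Rightarrow> (bool list \<times> bool list \<times> bool list) pmf" where
  "seed_dist B l = do {
     u1 \<leftarrow> unif (seed1 B l);
     u2 \<leftarrow> unif (seed2 B l);
     v \<leftarrow> unif (msg_len B l * sym_len B l);
     return_pmf (u1, u2, v)}"

lemma set_pmf_seed_dist [simp]: "set_pmf (seed_dist B l) = seeds B l"
  by (auto simp: seed_dist_def seeds_def)

text \<open>Defined for secrets \<open>y\<close> of any length, because a distinguisher must cope with any input.\<close>

definition lab :: "blocks \<Rightarrow> nat \<Rightarrow> bool list \<Rightarrow> point \<Rightarrow> bool" where
  "lab B l y = (\<lambda>(c1, c2, m, z).
     parity (select2 (\<and>) (indicator_string (alpha B l) (samp1 B l (inv_into (bitstrings (seed1 B l)) (ecc B l) c1)))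
       y (concat m)))"

locale construction =
  fixes B :: blocks
  assumes blocks: "building_blocks B"
begin

lemma field: "binary_field (sym_len B l) (fld B l)"
  using blocks by (simp add: building_blocks_def)

lemma carrier_fld: "carrier (fld B l) = bitstrings (sym_len B l)"
  using field by (simp add: binary_field_def)

lemma eventually_good: "\<forall>\<^sub>F l in sequentially. good B l"
proof -
  have 1: "\<forall>\<^sub>F l in sequentially. \<forall>r \<in> {seed1 B l, seed2 B l}.
        \<exists>e. real e > (1 - rate B) * real (code_len B l) / 2 \<and>
            corrects (bitstrings r) (carrier (fld B l)) (ecc B l) e"
    and 2: "\<forall>\<^sub>F l in sequentially.
        inj_on (eval_pt B l) {..<code_len B l} \<and>
        eval_pt B l ` {..<code_len B l} \<subseteq> carrier (fld B l)"
    and 3: "sampler_family (seed1 B) (alpha B) (\<lambda>l. msg_len B l * sym_len B l) (samp1 B)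
       (kappa1 B) (kappa2 B)"
    and 4: "sampler_family (seed2 B) (beta B) (\<lambda>l. code_len B l * sym_len B l) (samp2 B)
       (kappa1 B) (kappa2 B)"
    using blocks unfolding building_blocks_def by - (elim conjE, assumption)+
  from 3 obtain c where 3: "\<forall>\<^sub>F l in sequentially.
        sampler (seed1 B l) (alpha B l) (msg_len B l * sym_len B l) (samp1 B l) (kappa1 B l)
          (exp (- c * real (alpha B l) * kappa1 B l) + exp (- (real (alpha B l) powr kappa2 B)))"
    unfolding sampler_family_def by blast
  from 4 obtain c where 4: "\<forall>\<^sub>F l in sequentially.
        sampler (seed2 B l) (beta B l) (code_len B l * sym_len B l) (samp2 B l) (kappa1 B l)
          (exp (- c * real (beta B l) * kappa1 B l) + exp (- (real (beta B l) powr kappa2 B)))"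
    unfolding sampler_family_def by blast
  from 1 2 3 4 show ?thesis
  proof eventually_elim
    case (elim l)
    have "\<exists>e. corrects (bitstrings (seed1 B l)) (carrier (fld B l)) (ecc B l) e"
      using elim(1) by blast
    then have "inj_on (ecc B l) (bitstrings (seed1 B l))"
      using corrects_inj_on by blast
    then show ?case
      using elim(2) elim(3,4)[unfolded sampler_def, THEN conjunct1] by (simp add: good_def)
  qed
qed

lemma point_dist_unary: "point_dist B l (unary l) = map_pmf (point_of B l) (seed_dist B l)"
  unfolding point_dist_def seed_dist_def pmf_of_set_vectors[OF carrier_fld]
  by (simp add: map_bind_pmf bind_map_pmf point_of_def Let_def)

lemma point_dist_in_distributions: "point_dist B l (unary l) \<in> distributions B l"
  by (simp add: distributions_def bitstrings_def)

lemma set_point_dist: "set_pmf (point_dist B l (unary l)) \<subseteq> instances B l"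
  using point_dist_in_distributions by (auto simp: instances_def)

lemma point_of_instances: "a \<in> seeds B l \<Longrightarrow> point_of B l a \<in> instances B l"
  using set_point_dist[of l] by (auto simp: point_dist_unary)

lemma length_prg: "length (prg1 B s) = alpha B (length s)" "length (prg2 B s) = beta B (length s)"
  using blocks by (simp_all add: building_blocks_def prg_def)

lemma vectors_chunks:
  "v \<in> bitstrings (msg_len B l * sym_len B l) \<Longrightarrow>
   chunks (sym_len B l) (msg_len B l) v \<in> vectors (fld B l) (msg_len B l)"
  using set_chunks[of v "msg_len B l" "sym_len B l"] by (auto simp: vectors_def carrier_fld bitstrings_def)

text \<open>Field addition is bitwise exclusive or, so the masking can be carried out on the
  concatenated strings; field arithmetic stays confined to \<open>Enc\<close>.\<close>

lemma point_rep_point_of: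
  assumes g: "good B l" and u: "(u1, u2, v) \<in> seeds B l"
  shows "point_rep (point_of B l (u1, u2, v)) = encode_list [concat (ecc B l u1), concat (ecc B l u2), v,
    select2 (\<noteq>) (indicator_string (beta B l) (samp2 B l u2)) (prg2 B (unary l))
      (concat (Enc B l (chunks (sym_len B l) (msg_len B l) v)))]"
proof -
  let ?b = "sym_len B l" and ?n = "code_len B l"
  let ?m = "chunks ?b (msg_len B l) v"
  let ?w = "nths (prg2 B (unary l)) (samp2 B l u2)"
  let ?F = "fld B l"
  have s: "samp2 B l u2 \<subseteq> {..<beta B l}" "card (samp2 B l u2) = ?n * ?b"
    using g u by (auto simp: good_def seeds_def)
  have v: "v \<in> bitstrings (msg_len B l * ?b)" using u by (auto simp: seeds_def)
  have E: "Enc B l ?m \<in> vectors ?F ?n"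
    unfolding Enc_def
    by (rule rs_encode_vectors[OF _ vectors_chunks[OF v]])
       (use field[of l] g in \<open>auto simp: binary_field_def good_def\<close>)
  have w: "length ?w = ?n * ?b"
    using s by (simp add: length_nths_subset length_prg)
  have C: "set (chunks ?b ?n ?w) \<subseteq> carrier ?F"
    using set_chunks[OF w] by (simp add: carrier_fld)
  have "map2 (\<lambda>a b. a \<oplus>\<^bsub>?F\<^esub> b) (Enc B l ?m) (chunks ?b ?n ?w) = map2 (map2 (\<noteq>)) (Enc B l ?m) (chunks ?b ?n ?w)"
  proof (intro map_cong refl, safe)
    fix a b assume "(a, b) \<in> set (zip (Enc B l ?m) (chunks ?b ?n ?w))"
    then have "a \<in> carrier ?F" "b \<in> carrier ?F"
      using E C by (auto simp: vectors_def dest: set_zip_leftD set_zip_rightD)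
    then show "a \<oplus>\<^bsub>?F\<^esub> b = map2 (\<noteq>) a b"
      using field[of l] by (simp add: binary_field_def)
  qed
  also have "concat \<dots> = map2 (\<noteq>) (concat (Enc B l ?m)) (concat (chunks ?b ?n ?w))"
    using E C by (intro concat_map2_map2) (auto simp: vectors_def carrier_fld)
  also have "\<dots> = map2 (\<noteq>) ?w (concat (Enc B l ?m))"
    unfolding concat_chunks[OF w]
    by (subst zip_commute) (auto simp: case_prod_unfold)
  also have "\<dots> = select2 (\<noteq>) (indicator_string (beta B l) (samp2 B l u2)) (prg2 B (unary l)) (concat (Enc B l ?m))"
    using s E chunks_concat[of "Enc B l ?m" ?b ?n]
    by (intro select2_indicator[symmetric]) (auto simp: length_prg vectors_def carrier_fld)
  finally show ?thesis
    using v by (simp add: point_rep_def point_of_def Let_def concat_chunks bitstrings_def)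
qed

lemma lab_point_of:
  assumes "good B l" "(u1, u2, v) \<in> seeds B l"
  shows "lab B l y (point_of B l (u1, u2, v))
    = parity (select2 (\<and>) (indicator_string (alpha B l) (samp1 B l u1)) y v)"
  using assms by (simp add: lab_def point_of_def Let_def good_def seeds_def concat_chunks bitstrings_def)

lemma lab_point_of_inner:
  assumes g: "good B l" "(u1, u2, v) \<in> seeds B l" and y: "length y = alpha B l"
  shows "lab B l y (point_of B l (u1, u2, v)) = inner_F2 v (nths y (samp1 B l u1))"
proof -
  have "samp1 B l u1 \<subseteq> {..<alpha B l}" "card (samp1 B l u1) = length v"
    using g by (auto simp: good_def seeds_def bitstrings_def)
  then show ?thesis
    unfolding lab_point_of[OF g]
    by (simp add: select2_indicator y inner_F2_parity length_nths_subset)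
qed

text \<open>Injectivity of the encoding recovers \<open>u1\<close>; hence for pseudorandom secrets
  the labels produced by the distinguisher are those of the learning problem.\<close>

lemma lab_hyp:
  assumes "good B l" "a \<in> seeds B l" "s \<in> bitstrings l"
  shows "lab B l (prg1 B s) (point_of B l a) = hyp B l s (point_of B l a)"
proof -
  obtain u1 u2 v where a: "a = (u1, u2, v)" by (cases a) auto
  with assms have v: "length v = msg_len B l * sym_len B l" and u: "u1 \<in> bitstrings (seed1 B l)"
    by (auto simp: seeds_def bitstrings_def)
  have "inv_into (bitstrings (seed1 B l)) (ecc B l) (ecc B l u1) = u1"
    using assms(1) u by (simp add: good_def)
  with v assms show ?thesis
    unfolding a
    by (subst lab_point_of_inner)
       (auto simp: length_prg bitstrings_def hyp_def point_of_def Let_def concat_chunks)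
qed

section \<open>Efficient generation of points and labels\<close>

lemma ppt_length_funs:
  "g \<in> {code_len B, msg_len B, sym_len B, seed1 B, seed2 B} \<Longrightarrow>
   ppt_fun (\<lambda>l. [unary l]) (\<lambda>l. return_pmf (unary (g l))) UNIV"
  using blocks by (intro poly_time_ppt_fun) (auto simp: building_blocks_def)

lemma ppt_ecc:
  "ppt_fun (\<lambda>(l, v). [unary l, v]) (\<lambda>(l, v). return_pmf (concat (ecc B l v)))
     {(l, v). v \<in> bitstrings (seed1 B l) \<union> bitstrings (seed2 B l)}"
  using poly_time_ppt_fun[of "\<lambda>(l, v). [unary l, v]" "\<lambda>(l, v). concat (ecc B l v)"] blocks
  by (simp add: building_blocks_def case_prod_unfold)

lemma ppt_Enc:
  "ppt_fun (\<lambda>(l, m). [unary l, concat m]) (\<lambda>(l, m). return_pmf (concat (Enc B l m)))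
     {(l, m). m \<in> vectors (fld B l) (msg_len B l)}"
  using poly_time_ppt_fun[of "\<lambda>(l, m). [unary l, concat m]" "\<lambda>(l, m). concat (Enc B l m)"] blocks
  by (simp add: building_blocks_def case_prod_unfold)

lemma ppt_samp1:
  "ppt_fun (\<lambda>(l, u). [unary l, u]) (\<lambda>(l, u). return_pmf (indicator_string (alpha B l) (samp1 B l u)))
     {(l, u). u \<in> bitstrings (seed1 B l)}"
  using poly_time_ppt_fun[of "\<lambda>(l, u). [unary l, u]" "\<lambda>(l, u). indicator_string (alpha B l) (samp1 B l u)"] blocks
  by (simp add: building_blocks_def sampler_family_def case_prod_unfold)

lemma ppt_samp2:
  "ppt_fun (\<lambda>(l, u). [unary l, u]) (\<lambda>(l, u). return_pmf (indicator_string (beta B l) (samp2 B l u)))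
     {(l, u). u \<in> bitstrings (seed2 B l)}"
  using poly_time_ppt_fun[of "\<lambda>(l, u). [unary l, u]" "\<lambda>(l, u). indicator_string (beta B l) (samp2 B l u)"] blocks
  by (simp add: building_blocks_def sampler_family_def case_prod_unfold)

lemma ppt_prg2: "ppt_fun (\<lambda>x. [x]) (\<lambda>x. return_pmf (prg2 B x)) UNIV"
  using blocks by (intro poly_time_ppt_fun) (simp add: building_blocks_def prg_def)

text \<open>Each binding reads the registers \<open>js\<close> and appends one. Behind the inputs 0
  to 3 come the encodings of \<open>u1\<close> and \<open>u2\<close> (4 and 5), the output of the
  generator (6), the mask (7), the codeword (8) and the masked codeword (9).\<close>

lemma ppt_point_rep:
  "ppt_fun (\<lambda>(l, u1, u2, v). [unary l, u1, u2, v])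
     (\<lambda>(l, a). return_pmf (point_rep (point_of B l a))) {(l, a). good B l \<and> a \<in> seeds B l}"
  apply (rule ppt_fun_let[OF ppt_ecc, where n = 4 and js = "[0, 1]" and g = "\<lambda>(l, u1, u2, v). (l, u1)"
        and v = "\<lambda>(l, u1, u2, v). concat (ecc B l u1)"]; (auto simp: seeds_def; fail)?)
  apply (rule ppt_fun_let[OF ppt_ecc, where n = 5 and js = "[0, 2]" and g = "\<lambda>(l, u1, u2, v). (l, u2)"
        and v = "\<lambda>(l, u1, u2, v). concat (ecc B l u2)"]; (auto simp: seeds_def; fail)?)
  apply (rule ppt_fun_let[OF ppt_prg2, where n = 6 and js = "[0]" and g = "\<lambda>(l, u1, u2, v). unary l"
        and v = "\<lambda>(l, u1, u2, v). prg2 B (unary l)"]; (auto simp: seeds_def; fail)?)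
  apply (rule ppt_fun_let[OF ppt_samp2, where n = 7 and js = "[0, 2]" and g = "\<lambda>(l, u1, u2, v). (l, u2)"
        and v = "\<lambda>(l, u1, u2, v). indicator_string (beta B l) (samp2 B l u2)"]; (auto simp: seeds_def; fail)?)
  apply (rule ppt_fun_let[OF ppt_Enc, where n = 8 and js = "[0, 3]"
        and g = "\<lambda>(l, u1, u2, v). (l, chunks (sym_len B l) (msg_len B l) v)"
        and v = "\<lambda>(l, u1, u2, v). concat (Enc B l (chunks (sym_len B l) (msg_len B l) v))"];
      (auto simp: seeds_def intro: vectors_chunks concat_chunks simp: bitstrings_def; fail)?)
  apply (rule ppt_fun_let[OF ppt_select2[where f = "(\<noteq>)"], where n = 9 and js = "[7, 6, 8]"
        and g = "\<lambda>(l, u1, u2, v). (indicator_string (beta B l) (samp2 B l u2), prg2 B (unary l),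
            concat (Enc B l (chunks (sym_len B l) (msg_len B l) v)))"
        and v = "\<lambda>(l, u1, u2, v). select2 (\<noteq>) (indicator_string (beta B l) (samp2 B l u2)) (prg2 B (unary l))
            (concat (Enc B l (chunks (sym_len B l) (msg_len B l) v)))"]; (auto simp: seeds_def; fail)?)
  apply (rule ppt_fun_cong[OF ppt_fun_call[OF ppt_encode4,
       where A = "{(l, a). good B l \<and> a \<in> seeds B l}" and n = 10 and js = "[4, 5, 3, 9]"
       and g = "\<lambda>(l, u1, u2, v). (concat (ecc B l u1), concat (ecc B l u2), v,
         select2 (\<noteq>) (indicator_string (beta B l) (samp2 B l u2)) (prg2 B (unary l))
            (concat (Enc B l (chunks (sym_len B l) (msg_len B l) v))))"]];
     (auto simp: point_rep_point_of; fail)?)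
  done

text \<open>The label is computed from the coins \<open>u1\<close> and \<open>v\<close> rather than
  from the point, so no encoding has to be decoded.\<close>

lemma ppt_lab:
  "ppt_fun (\<lambda>((l, y), u1, u2, v). [unary l, y, u1, u2, v])
     (\<lambda>((l, y), a). return_pmf [lab B l y (point_of B l a)]) {((l, y), a). good B l \<and> a \<in> seeds B l}"
  apply (rule ppt_fun_let[OF ppt_samp1, where n = 5 and js = "[0, 2]" and g = "\<lambda>((l, y), u1, u2, v). (l, u1)"
        and v = "\<lambda>((l, y), u1, u2, v). indicator_string (alpha B l) (samp1 B l u1)"]; (auto simp: seeds_def; fail)?)
  apply (rule ppt_fun_let[OF ppt_select2[where f = "(\<and>)"], where n = 6 and js = "[5, 1, 4]"
        and g = "\<lambda>((l, y), u1, u2, v). (indicator_string (alpha B l) (samp1 B l u1), y, v)"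
        and v = "\<lambda>((l, y), u1, u2, v). select2 (\<and>) (indicator_string (alpha B l) (samp1 B l u1)) y v"];
      (auto simp: seeds_def; fail)?)
  apply (rule ppt_fun_cong[OF ppt_fun_call[OF ppt_parity,
       where A = "{((l, y), a). good B l \<and> a \<in> seeds B l}" and n = 7 and js = "[6]"
       and g = "\<lambda>((l, y), u1, u2, v). select2 (\<and>) (indicator_string (alpha B l) (samp1 B l u1)) y v"]];
     (auto simp: lab_point_of; fail)?)
  done

end

section \<open>Training data\<close>

text \<open>The threshold \<open>k\<close> is part of the program text: register 3 holds the
  parameter in unary and is popped \<open>k\<close> times, and \<open>c\<close> is reached only if
  the register was nonempty each time.\<close>

primrec guarded :: "nat \<Rightarrow> com \<Rightarrow> com" where
  "guarded 0 c = Call 0 c [2, 1]"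
| "guarded (Suc k) c = Case 3 Skip Skip (Seq (Pop 3) (guarded k c))"

lemma does_guarded:
  assumes "s 3 = unary m" "k \<le> m \<Longrightarrow> computes c [s 2, s 1] P T"
  shows "\<exists>Q. does (guarded k c) s Q (2 + 2 * k + 2 * (length (s 2) + length (s 1)) + 2 * T) \<and>
              (k \<le> m \<longrightarrow> map_pmf (\<lambda>s. s 0) Q = P)"
  using assms
proof (induction k arbitrary: s m)
  case 0
  then have "does (Call 0 c [2, 1]) s (map_pmf (\<lambda>v. s(0 := v)) P) (1 + 2 * input_size (map s [2, 1]) + 2 * T)"
    by (intro does_Call) simp
  then show ?case
    by (intro exI[of _ "map_pmf (\<lambda>v. s(0 := v)) P"]) (auto simp: map_pmf_comp elim: does_mono)
next
  case (Suc k)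
  show ?case
  proof (cases m)
    case 0
    then have "does (guarded (Suc k) c) s (return_pmf s) (1 + 1)"
      unfolding guarded.simps using Suc.prems(1) does_Skip[of s]
      by (intro does_Case_det) (simp add: unary_def)
    then show ?thesis using 0 by (intro exI[of _ "return_pmf s"]) (auto elim: does_mono)
  next
    case (Suc m')
    let ?s = "s(3 := unary m')"
    have "\<exists>Q. does (guarded k c) ?s Q (2 + 2 * k + 2 * (length (?s 2) + length (?s 1)) + 2 * T) \<and>
      (k \<le> m' \<longrightarrow> map_pmf (\<lambda>s. s 0) Q = P)"
      by (rule Suc.IH) (use Suc.prems Suc in auto)
    then obtain Q where Q: "does (guarded k c) ?s Q (2 + 2 * k + 2 * (length (?s 2) + length (?s 1)) + 2 * T)"
      "k \<le> m' \<longrightarrow> map_pmf (\<lambda>s. s 0) Q = P"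
      by blast
    have "does (Seq (Pop 3) (guarded k c)) s Q (1 + (2 + 2 * k + 2 * (length (s 2) + length (s 1)) + 2 * T))"
      using does_Pop[of 3 s] Suc.prems(1) Suc
      by (intro does_Seq_det[OF _ Q(1)[simplified fun_upd_other]]) (simp add: unary_def)
    then have "does (guarded (Suc k) c) s Q (1 + (1 + (2 + 2 * k + 2 * (length (s 2) + length (s 1)) + 2 * T)))"
      unfolding guarded.simps using Suc.prems(1) Suc
      by (intro does_Case_det) (simp add: unary_def)
    then show ?thesis using Q(2) Suc by (intro exI[of _ Q]) auto
  qed
qed

text \<open>A distinguisher has to be polynomial-time on all inputs, so it normalizes its first input and
  gives up on small security parameters, for which \<open>F\<close> need not be computable.\<close>

lemma ppt_fun_distinguisher:
  assumes "ppt_fun (\<lambda>(l, y). [unary l, y]) (\<lambda>(l, y). F l y) {(l, y). l0 \<le> l}"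
  obtains D where "ppt D" "\<And>l y. l0 \<le> l \<Longrightarrow> run D [unary l, y] = spmf_of_pmf (F l y)"
proof -
  from assms obtain c p where c: "\<And>l y. l0 \<le> l \<Longrightarrow>
      computes c [unary l, y] (F l y) (poly p (l + length y))"
    by (fastforce simp: ppt_fun_def)
  from ppt_to_unary obtain u q where u: "\<And>v. computes u [v] (return_pmf (unary (length v))) (poly q (length v))"
    by (fastforce simp: ppt_fun_def)
  \<comment> \<open>Register 2 receives a unary string of the length of register 0, so that every
    input is treated as one of the form \<open>[unary l, y]\<close>; register 3 is the copy that the
    guard consumes.\<close>
  define D where "D = Seq (Call 2 u [0]) (Seq (Call 3 Skip [2]) (guarded l0 c))"
  define X :: "nat poly" where "X = [:0, 1:]"
  define r where "r = (1 + 2 * X + 2 * q) + ((3 + 2 * X) + ([:2 + 2 * l0:] + 4 * X + 2 * pcompose p (2 * X)))"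
  have main: "\<exists>P. computes D vs P (poly r (input_size vs)) \<and>
      (l0 \<le> length (load vs 0) \<longrightarrow> P = F (length (load vs 0)) (load vs 1))" for vs
  proof -
    let ?s = "load vs" and ?x = "input_size vs"
    let ?l = "length (?s 0)"
    let ?s1 = "?s(2 := unary ?l)"
    let ?s2 = "?s1(3 := unary ?l)"
    have le: "length (?s i) \<le> ?x" for i by (rule length_load_le)
    have 1: "does (Call 2 u [0]) ?s (return_pmf ?s1) (poly (1 + 2 * X + 2 * q) ?x)"
    proof (rule does_mono)
      show "does (Call 2 u [0]) ?s (return_pmf ?s1) (1 + 2 * input_size (map ?s [0]) + 2 * poly q ?l)"
        using does_Call[of u ?s "[0]" "return_pmf (unary ?l)" "poly q ?l" 2] u[of "?s 0"] by simp
    qed (use le[of 0] poly_nat_mono[OF le[of 0], of q] in \<open>simp add: X_def\<close>)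
    have 2: "does (Call 3 Skip [2]) ?s1 (return_pmf ?s2) (poly (3 + 2 * X) ?x)"
      by (rule does_mono[of _ _ _ "3 + 2 * length (?s1 2)"])
         (use does_Copy[of 3 2 ?s1] le[of 0] in \<open>simp_all add: X_def\<close>)
    have "computes c [?s2 2, ?s2 1] (F ?l (?s 1)) (poly p (2 * ?x))" if "l0 \<le> ?l"
    proof -
      have "?l + length (?s 1) \<le> 2 * ?x" using le[of 0] le[of 1] by simp
      from computes_mono[OF c[OF that] poly_nat_mono[OF this]] show ?thesis by simp
    qed
    from does_guarded[of ?s2 ?l l0 c, OF _ this] obtain Q where Q:
      "does (guarded l0 c) ?s2 Q (2 + 2 * l0 + 2 * (?l + length (?s 1)) + 2 * poly p (2 * ?x))"
      "l0 \<le> ?l \<longrightarrow> map_pmf (\<lambda>s. s 0) Q = F ?l (?s 1)"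
      by (auto simp: numeral_eq_Suc)
    have 3: "does (guarded l0 c) ?s2 Q (poly ([:2 + 2 * l0:] + 4 * X + 2 * pcompose p (2 * X)) ?x)"
      by (rule does_mono[OF Q(1)]) (use le[of 0] le[of 1] in \<open>simp add: X_def poly_pcompose mult.commute\<close>)
    have "does D ?s Q (poly r ?x)"
      unfolding D_def r_def poly_add[of "1 + 2 * X + 2 * q"] poly_add[of "3 + 2 * X"]
      by (intro does_Seq_det[OF 1] does_Seq_det[OF 2] 3)
    from does_computes[OF this] Q(2) show ?thesis by auto
  qed
  show ?thesis
  proof (rule that)
    show "ppt D"
      unfolding ppt_def using main by (auto simp: computes_def)
    show "run D [unary l, y] = spmf_of_pmf (F l y)" if "l0 \<le> l" for l y
      using main[of "[unary l, y]"] that by (auto simp: computes_def load_def)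
  qed
qed

context construction
begin

text \<open>Three bindings draw the coins of a point. Register 0 has to hold the security parameter,
  which determines how many are drawn; the nested pairs of the bindings are regrouped into one
  triple.\<close>

lemma ppt_with_seeds:
  assumes len: "\<And>a. a \<in> A \<Longrightarrow> length (inp a) = n" "0 < n" "\<And>a. a \<in> A \<Longrightarrow> inp a ! 0 = unary (lf a)"
    and G: "ppt_fun (\<lambda>(a, u1, u2, v). inp a @ [u1, u2, v]) (\<lambda>(a, u). G a u) {(a, u). a \<in> A \<and> u \<in> seeds B (lf a)}"
  shows "ppt_fun inp (\<lambda>a. bind_pmf (seed_dist B (lf a)) (G a)) A"
proof -
  have len_funs: "ppt_fun (\<lambda>l. [unary l]) (\<lambda>l. return_pmf (unary (msg_len B l * sym_len B l))) UNIV"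
    by (intro ppt_unary_mult[where n = 1] ppt_length_funs) auto
  have r1: "ppt_fun (\<lambda>l. [unary l]) (\<lambda>l. unif (seed1 B l)) UNIV"
    and r2: "ppt_fun (\<lambda>l. [unary l]) (\<lambda>l. unif (seed2 B l)) UNIV"
    and r3: "ppt_fun (\<lambda>l. [unary l]) (\<lambda>l. unif (msg_len B l * sym_len B l)) UNIV"
    by (intro ppt_unif[where n = 1] ppt_length_funs len_funs; simp)+
  have "ppt_fun inp (\<lambda>a. bind_pmf (unif (seed1 B (lf a))) (\<lambda>u1.
      bind_pmf (unif (seed2 B (lf a))) (\<lambda>u2.
      bind_pmf (unif (msg_len B (lf a) * sym_len B (lf a))) (\<lambda>v. G a (u1, u2, v))))) A"
  proof (rule ppt_fun_bind[OF r1, where n = n and js = "[0]" and g = lf], goal_cases)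
    case 4
    let ?A1 = "{(a, u1). a \<in> A \<and> u1 \<in> set_pmf (unif (seed1 B (lf a)))}"
    have "ppt_fun (\<lambda>(a, u1). inp a @ [u1]) (\<lambda>a1.
      bind_pmf (unif (seed2 B (lf (fst a1)))) (\<lambda>u2.
      bind_pmf (unif (msg_len B (lf (fst a1)) * sym_len B (lf (fst a1)))) (\<lambda>v. G (fst a1) (snd a1, u2, v)))) ?A1"
    proof (rule ppt_fun_bind[OF r2, where n = "Suc n" and js = "[0]" and g = "lf \<circ> fst" and A = ?A1, unfolded comp_def], goal_cases)
      case 4
      let ?A2 = "{(a1, u2). a1 \<in> ?A1 \<and> u2 \<in> set_pmf (unif (seed2 B (lf (fst a1))))}"
      have "ppt_fun (\<lambda>(a1, u2). (case a1 of (a, u1) \<Rightarrow> inp a @ [u1]) @ [u2]) (\<lambda>a2.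
        bind_pmf (unif (msg_len B (lf (fst (fst a2))) * sym_len B (lf (fst (fst a2)))))
          (\<lambda>v. G (fst (fst a2)) (snd (fst a2), snd a2, v))) ?A2"
      proof (rule ppt_fun_bind[OF r3, where n = "Suc (Suc n)" and js = "[0]" and g = "lf \<circ> fst \<circ> fst" and A = ?A2, unfolded comp_def], goal_cases)
        case 4
        from G obtain c p where c: "\<And>a u1 u2 v. a \<in> A \<Longrightarrow> (u1, u2, v) \<in> seeds B (lf a) \<Longrightarrow>
            computes c (inp a @ [u1, u2, v]) (G a (u1, u2, v)) (poly p (input_size (inp a @ [u1, u2, v])))"
          by (fastforce simp: ppt_fun_def)
        show ?case
          unfolding ppt_fun_def
        proof (intro exI[of _ c] exI[of _ p] ballI)
          fix x assume x: "x \<in> {(a2, v). a2 \<in> ?A2 \<and> v \<in> set_pmf (unif (msg_len B (lf (fst (fst a2))) * sym_len B (lf (fst (fst a2)))))}"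
          obtain a u1 u2 v where "x = (((a, u1), u2), v)" by (metis surj_pair)
          with x show "computes c ((\<lambda>(a2, v). (case a2 of (a1, u2) \<Rightarrow> (case a1 of (a, u1) \<Rightarrow> inp a @ [u1]) @ [u2]) @ [v]) x)
              ((\<lambda>(a2, v). G (fst (fst a2)) (snd (fst a2), snd a2, v)) x)
              (poly p (input_size ((\<lambda>(a2, v). (case a2 of (a1, u2) \<Rightarrow> (case a1 of (a, u1) \<Rightarrow> inp a @ [u1]) @ [u2]) @ [v]) x)))"
            using c[of a u1 u2 v] by (simp add: seeds_def)
        qed
      qed (use len in \<open>auto simp: nth_append\<close>)
      then show ?case by (rule ppt_fun_cong) auto
    qed (use len in \<open>auto simp: nth_append\<close>)
    then show ?case by (rule ppt_fun_cong) auto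
  qed (use len in auto)
  then show ?thesis
    by (rule ppt_fun_cong) (auto simp: seed_dist_def bind_assoc_pmf bind_return_pmf)
qed

definition item :: "nat \<Rightarrow> bool list \<Rightarrow> bool list pmf" where
  "item l y = map_pmf (\<lambda>a. encode_list [point_rep (point_of B l a), [lab B l y (point_of B l a)]]) (seed_dist B l)"

lemma ppt_item: "ppt_fun (\<lambda>(l, y). [unary l, y]) (\<lambda>(l, y). item l y) {(l, y). good B l}"
proof -
  let ?A = "{(l :: nat, y :: bool list). good B l}"
  let ?D = "{((l, y), a). good B l \<and> a \<in> seeds B l}"
  have "ppt_fun (\<lambda>((l, y), u1, u2, v). [unary l, y, u1, u2, v])
     (\<lambda>((l, y), a). return_pmf (encode_list [point_rep (point_of B l a), [lab B l y (point_of B l a)]])) ?D"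
    apply (rule ppt_fun_let[OF ppt_point_rep, where n = 5 and js = "[0, 2, 3, 4]" and g = "\<lambda>((l, y), a). (l, a)"
        and v = "\<lambda>((l, y), a). point_rep (point_of B l a)"]; (auto; fail)?)
    apply (rule ppt_fun_let[OF ppt_lab, where n = 6 and js = "[0, 1, 2, 3, 4]" and g = "\<lambda>a. a"
        and v = "\<lambda>((l, y), a). [lab B l y (point_of B l a)]"]; (auto; fail)?)
    apply (rule ppt_fun_cong[OF ppt_fun_call[OF ppt_encode2, where A = ?D and n = 7 and js = "[5, 6]"
        and g = "\<lambda>((l, y), a). (point_rep (point_of B l a), [lab B l y (point_of B l a)])"]]; (auto; fail)?)
    done
  then have "ppt_fun (\<lambda>((l, y), u1, u2, v). (case (l, y) of (l, y) \<Rightarrow> [unary l, y]) @ [u1, u2, v])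
     (\<lambda>(x, a). return_pmf (encode_list [point_rep (point_of B (fst x) a), [lab B (fst x) (snd x) (point_of B (fst x) a)]]))
       {(x, a). x \<in> ?A \<and> a \<in> seeds B (fst x)}"
    by (rule ppt_fun_cong) auto
  then have "ppt_fun (\<lambda>(l, y). [unary l, y]) (\<lambda>x. bind_pmf (seed_dist B (fst x))
     (\<lambda>a. return_pmf (encode_list [point_rep (point_of B (fst x) a), [lab B (fst x) (snd x) (point_of B (fst x) a)]]))) ?A"
    by (intro ppt_with_seeds[where n = 2]) (auto elim: ppt_fun_cong)
  then show ?thesis
    by (rule ppt_fun_cong) (auto simp: item_def map_pmf_def)
qed

definition training :: "nat \<Rightarrow> bool list \<Rightarrow> nat \<Rightarrow> bool list pmf" where
  "training l y N = iterM N (\<lambda>v. map_pmf (\<lambda>e. e @ v) (item l y)) []"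

lemma ppt_training:
  "ppt_fun (\<lambda>(l, y, w). [unary l, y, w]) (\<lambda>(l, y, w). training l y (length w)) {(l, y, w). good B l}"
proof (rule ppt_fun_let_const[where w = "[]" and n = 3])
  let ?A = "{(l :: nat, y :: bool list, w :: bool list). good B l}"
  let ?inp = "\<lambda>(l, y, w). [unary l, y, w, []]"
  let ?F = "\<lambda>(l, y, w). \<lambda>v. map_pmf (\<lambda>e. e @ v) (item l y)"
  \<comment> \<open>A uniform bound on the length of one encoded example keeps the accumulated data
    linear in the number of examples.\<close>
  from ppt_fun_length[OF ppt_item] obtain q where
    q: "\<And>l y v. good B l \<Longrightarrow> v \<in> set_pmf (item l y) \<Longrightarrow> length v \<le> poly q (l + length y)"
    by (metis (no_types, lifting) case_prodI input_size_Cons input_size_Nil length_unary mem_Collect_eq add_0_right case_prod_conv)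
  have F: "ppt_fun (\<lambda>((l, y, w), v). [unary l, y, w, [], v]) (\<lambda>(a, v). bind_pmf (item (fst a) (fst (snd a))) (\<lambda>e. return_pmf (e @ v)))
     {(a, v). a \<in> ?A}"
  proof -
    have "ppt_fun (\<lambda>((l, y, w), v). [unary l, y, w, [], v])
       (\<lambda>b. bind_pmf (case (\<lambda>((l, y, w), v). (l, y)) b of (l, y) \<Rightarrow> item l y) (\<lambda>e. return_pmf (e @ snd b))) {(a, v). a \<in> ?A}"
    proof (rule ppt_fun_bind[OF ppt_item, where n = 5 and js = "[0, 1]"], goal_cases)
      case 4
      show ?case
        by (rule ppt_fun_cong[OF ppt_fun_call[OF ppt_append, where A = UNIV and n = 6 and js = "[5, 4]"
              and inp = "\<lambda>(((l, y, w), v), e). [unary l, y, w, [], v, e]" and g = "\<lambda>(b, e). (e, snd b)"]])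
           auto
    qed auto
    then show ?thesis by (rule ppt_fun_cong) auto
  qed
  have "ppt_fun ?inp (\<lambda>a. iterM (length (?inp a ! 2)) (?F a) (?inp a ! 3)) ?A"
  proof (rule ppt_fun_iter[where n = 4 and k = 2 and i = 3 and q = "[:0, 1:] * q"
        and I = "\<lambda>(l, y, w) j. {v. length v \<le> j * poly q (l + length y)}"], goal_cases)
    case 1
    show ?case by (rule ppt_fun_cong[OF F]) (auto simp: map_pmf_def)
  next
    case (6 a j v)
    then show ?case using q by (fastforce intro!: add_mono)
  next
    case (7 a j v)
    obtain l y w where a: "a = (l, y, w)" by (cases a) auto
    from 7 have "length v \<le> j * poly q (l + length y)" by (simp add: a)
    also have "\<dots> \<le> input_size (?inp a) * poly q (input_size (?inp a))"
      using 7 by (intro mult_le_mono poly_nat_mono) (auto simp: a)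
    finally show ?case by simp
  qed auto
  then show "ppt_fun (\<lambda>a. (case a of (l, y, w) \<Rightarrow> [unary l, y, w]) @ [[]])
      (\<lambda>(l, y, w). training l y (length w)) ?A"
    by (rule ppt_fun_cong) (auto simp: training_def)
qed auto

lemma encode_data_append: "encode_data rep (S @ T) = encode_data rep S @ encode_data rep T"
  by (simp add: encode_data_def encode_list_def)

lemma training_eq:
  "training l y N =
     map_pmf (\<lambda>S. encode_data point_rep (label (lab B l y) S)) (replicate_pmf N (point_dist B l (unary l)))"
proof -
  let ?D = "point_dist B l (unary l)"
  let ?e = "\<lambda>S. encode_data point_rep (label (lab B l y) S)"
  have item: "map_pmf (\<lambda>e. e @ v) (item l y) = map_pmf (\<lambda>x. ?e [x] @ v) ?D" for v
    by (simp add: item_def point_dist_unary map_pmf_comp encode_data_def label_def)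
  have app: "?e (S @ T) = ?e S @ ?e T" for S T
    by (simp add: label_def encode_data_append)
  define F where "F = (\<lambda>v. map_pmf (\<lambda>e. e @ v) (item l y))"
  have F: "F v = map_pmf (\<lambda>x. ?e [x] @ v) ?D" for v
    by (simp add: F_def item)
  have "iterM N F v = map_pmf (\<lambda>S. ?e S @ v) (replicate_pmf N ?D)" for v
  proof (induction N arbitrary: v)
    case 0
    show ?case by (simp add: encode_data_def label_def encode_list_def)
  next
    case (Suc N)
    have "iterM N F = (\<lambda>v. map_pmf (\<lambda>S. ?e S @ v) (replicate_pmf N ?D))"
      by (rule ext) (rule Suc)
    then have "iterM (Suc N) F v
        = bind_pmf ?D (\<lambda>x. bind_pmf (replicate_pmf N ?D) (\<lambda>S. return_pmf (?e (S @ [x]) @ v)))"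
      by (simp add: F bind_map_pmf app) (simp add: map_pmf_def)
    \<comment> \<open>The loop prepends, so the example drawn first ends up last in the list; the
      draws are independent and may be exchanged.\<close>
    also have "\<dots> = bind_pmf (replicate_pmf N ?D) (\<lambda>S. bind_pmf ?D (\<lambda>x. return_pmf (?e (S @ [x]) @ v)))"
      by (rule bind_commute_pmf)
    also have "\<dots> = map_pmf (\<lambda>S. ?e S @ v) (replicate_pmf (N + 1) ?D)"
      unfolding replicate_pmf_distrib replicate_pmf_1
      by (simp add: map_pmf_def bind_assoc_pmf bind_return_pmf)
    finally show ?case by simp
  qed
  then show ?thesis by (simp add: training_def F_def)
qed

end

section \<open>The distinguisher\<close>

locale learning = construction +
  fixes L :: "point learner" and ev :: "nat \<Rightarrow> bool list \<Rightarrow> point \<Rightarrow> bool" and c :: com and p :: "nat poly"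
  assumes ev: "poly_time (\<lambda>(l, w, x). [unary l, w, point_rep x]) (\<lambda>(l, w, x). [ev l w x]) {(l, w, x). x \<in> instances B l}"
    and runs: "\<And>l S. S \<in> labeled_sets (instances B) l \<Longrightarrow>
      runs_within c [unary l, encode_data point_rep S] (poly p ((length S + 1) * (l + 1)))"
    and models: "\<And>l S. S \<in> labeled_sets (instances B) l \<Longrightarrow>
      map_spmf (\<lambda>w. restrict (ev l w) (instances B l)) (run c [unary l, encode_data point_rep S]) = spmf_of_pmf (L l S)"
begin

text \<open>\<open>run\<close> yields a subdistribution. On encodings of genuine samples the learner
  halts almost surely, and there \<open>descr\<close> is the law of its descriptions.\<close>

definition descr :: "nat \<Rightarrow> bool list \<Rightarrow> bool list pmf" where
  "descr l v = (SOME P. run c [unary l, v] = spmf_of_pmf P)"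

definition samples :: "nat \<Rightarrow> bool list set" where
  "samples l = encode_data point_rep ` labeled_sets (instances B) l"

lemma run_descr:
  assumes "S \<in> labeled_sets (instances B) l"
  shows "run c [unary l, encode_data point_rep S] = spmf_of_pmf (descr l (encode_data point_rep S))"
proof -
  from runs[OF assms] obtain R where "exec c (load [unary l, encode_data point_rep S]) = spmf_of_pmf R"
    by (auto simp: runs_within_def lossless_spmf_conv_spmf_of_pmf)
  then have "\<exists>P. run c [unary l, encode_data point_rep S] = spmf_of_pmf P"
    by (auto simp: run_def)
  then show ?thesis unfolding descr_def by (rule someI_ex)
qed

lemma map_descr:
  assumes "S \<in> labeled_sets (instances B) l"
  shows "map_pmf (\<lambda>w. restrict (ev l w) (instances B l)) (descr l (encode_data point_rep S)) = L l S"
  using models[OF assms] by (simp add: run_descr[OF assms] spmf_of_pmf_inject)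

lemma length_le_encode_data: "length S \<le> length (encode_data rep S)"
  by (induction S) (auto simp: encode_data_def encode_list_def)

text \<open>The learner's clock counts examples, that of \<open>ppt_fun\<close> counts input bits.
  Each example occupies at least one bit, so the first bound implies the second.\<close>

lemma ppt_descr:
  "ppt_fun (\<lambda>(l, v). [unary l, v]) (\<lambda>(l, v). descr l v) {(l, v). v \<in> samples l}"
  unfolding ppt_fun_def
proof (intro exI ballI)
  fix x assume "x \<in> {(l, v). v \<in> samples l}"
  then obtain l S where x: "x = (l, encode_data point_rep S)" and S: "S \<in> labeled_sets (instances B) l"
    by (auto simp: samples_def)
  let ?i = "input_size [unary l, encode_data point_rep S]"
  have "(length S + 1) * (l + 1) \<le> (?i + 1) * (?i + 1)"
    using length_le_encode_data[of S point_rep] by (intro mult_le_mono) auto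
  then have "poly p ((length S + 1) * (l + 1)) \<le> poly (pcompose p ([:1, 1:] * [:1, 1:])) ?i"
    unfolding poly_pcompose by (intro poly_nat_mono) simp
  moreover have "computes c [unary l, encode_data point_rep S] (descr l (encode_data point_rep S))
      (poly p ((length S + 1) * (l + 1)))"
    using run_descr[OF S] runs[OF S] unfolding computes_def by blast
  ultimately show "computes c ((\<lambda>(l, v). [unary l, v]) x) ((\<lambda>(l, v). descr l v) x)
      (poly (pcompose p ([:1, 1:] * [:1, 1:])) (input_size ((\<lambda>(l, v). [unary l, v]) x)))"
    unfolding x prod.case by (rule computes_mono[rotated])
qed

lemma training_samples: "set_pmf (training l y N) \<subseteq> samples l"
  using set_point_dist[of l]
  by (auto simp: training_eq samples_def set_replicate_pmf labeled_sets_def label_def lists_eq_set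
      intro!: imageI)

definition err :: "nat \<Rightarrow> bool list \<Rightarrow> (point \<Rightarrow> bool) \<Rightarrow> bool list \<times> bool list \<times> bool list \<Rightarrow> bool" where
  "err l y f a \<longleftrightarrow> lab B l y (point_of B l a) \<noteq> f (point_of B l a)"

text \<open>Acceptance has probability \<open>1/2 + 2 (risk - 1/2)\<^sup>2\<close>, hence is never less likely than \<open>1/2\<close>:
  sample sizes on which the learner does badly cannot cancel the advantage gained on the others.\<close>

definition tests :: "nat \<Rightarrow> bool list \<Rightarrow> (point \<Rightarrow> bool) \<Rightarrow> bool list pmf" where
  "tests l y f = do {
     a \<leftarrow> seed_dist B l;
     b \<leftarrow> seed_dist B l;
     return_pmf [err l y f a = err l y f b]}"

lemma ppt_err:
  "ppt_fun (\<lambda>(l, y, w). [unary l, y, w]) (\<lambda>(l, y, w). map_pmf (\<lambda>a. [err l y (ev l w) a]) (seed_dist B l))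
     {(l, y, w). good B l}"
proof -
  let ?A = "{(l :: nat, y :: bool list, w :: bool list). good B l}"
  let ?D = "{((l, y, w), a). good B l \<and> a \<in> seeds B l}"
  let ?x = "\<lambda>((l, y, w), a). point_of B l a"
  have ev': "ppt_fun (\<lambda>(l, w, x). [unary l, w, point_rep x]) (\<lambda>(l, w, x). return_pmf [ev l w x]) {(l, w, x). x \<in> instances B l}"
    using poly_time_ppt_fun[OF ev] by (simp add: case_prod_unfold)
  have "ppt_fun (\<lambda>((l, y, w), u1, u2, v). [unary l, y, w, u1, u2, v])
     (\<lambda>((l, y, w), a). return_pmf [err l y (ev l w) a]) ?D"
    apply (rule ppt_fun_let[OF ppt_point_rep, where n = 6 and js = "[0, 3, 4, 5]" and g = "\<lambda>((l, y, w), a). (l, a)"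
        and v = "\<lambda>((l, y, w), a). point_rep (point_of B l a)"]; (auto; fail)?)
    apply (rule ppt_fun_let[OF ppt_lab, where n = 7 and js = "[0, 1, 3, 4, 5]" and g = "\<lambda>((l, y, w), a). ((l, y), a)"
        and v = "\<lambda>((l, y, w), a). [lab B l y (point_of B l a)]"]; (auto; fail)?)
    apply (rule ppt_fun_let[OF ev', where n = 8 and js = "[0, 2, 6]" and g = "\<lambda>((l, y, w), a). (l, w, point_of B l a)"
        and v = "\<lambda>((l, y, w), a). [ev l w (point_of B l a)]"]; (auto simp: point_of_instances; fail)?)
    apply (rule ppt_fun_let_const[where w = "[True]" and n = 9]; (auto; fail)?)
    apply (rule ppt_fun_cong[OF ppt_fun_call[OF ppt_select2[where f = "(\<noteq>)"], where A = ?D and n = 10 and js = "[9, 7, 8]"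
        and g = "\<lambda>((l, y, w), a). ([True], [lab B l y (point_of B l a)], [ev l w (point_of B l a)])"]];
        (auto simp: err_def head_def; fail)?)
    done
  then have "ppt_fun (\<lambda>(x, u1, u2, v). (case x of (l, y, w) \<Rightarrow> [unary l, y, w]) @ [u1, u2, v])
     (\<lambda>(x, a). return_pmf [err (fst x) (fst (snd x)) (ev (fst x) (snd (snd x))) a]) {(x, a). x \<in> ?A \<and> a \<in> seeds B (fst x)}"
    by (rule ppt_fun_cong) auto
  then have "ppt_fun (\<lambda>(l, y, w). [unary l, y, w]) (\<lambda>x. bind_pmf (seed_dist B (fst x))
     (\<lambda>a. return_pmf [err (fst x) (fst (snd x)) (ev (fst x) (snd (snd x))) a])) ?A"
    by (intro ppt_with_seeds[where n = 3]) auto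
  then show ?thesis
    by (rule ppt_fun_cong) (auto simp: map_pmf_def)
qed

lemma ppt_tests:
  "ppt_fun (\<lambda>(l, y, w). [unary l, y, w]) (\<lambda>(l, y, w). tests l y (ev l w)) {(l, y, w). good B l}"
proof -
  let ?A = "{(l :: nat, y :: bool list, w :: bool list). good B l}"
  let ?T = "\<lambda>(l, y, w). map_pmf (\<lambda>a. [err l y (ev l w) a]) (seed_dist B l)"
  let ?eq = "\<lambda>a b. return_pmf (select2 (=) [True] a b)"
  have "ppt_fun (\<lambda>(l, y, w). [unary l, y, w]) (\<lambda>x. bind_pmf (?T x) (\<lambda>a. bind_pmf (?T x) (?eq a))) ?A"
  proof (rule ppt_fun_bind[OF ppt_err, where n = 3 and js = "[0, 1, 2]" and g = "\<lambda>x. x"], goal_cases)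
    case 4
    let ?A1 = "{(x, a). x \<in> ?A \<and> a \<in> set_pmf (?T x)}"
    have "ppt_fun (\<lambda>(x, a). (case x of (l, y, w) \<Rightarrow> [unary l, y, w]) @ [a])
        (\<lambda>xa. bind_pmf (?T (fst xa)) (?eq (snd xa))) ?A1"
    proof (rule ppt_fun_bind[OF ppt_err, where n = 4 and js = "[0, 1, 2]" and g = fst], goal_cases)
      case 4
      let ?A2 = "{(xa, b). xa \<in> ?A1 \<and> b \<in> set_pmf (?T (fst xa))}"
      show ?case
        apply (rule ppt_fun_let_const[where w = "[True]" and n = 5]; (auto; fail)?)
        apply (rule ppt_fun_cong[OF ppt_fun_call[OF ppt_select2[where f = "(=)"], where A = ?A2 and n = 6 and js = "[5, 3, 4]"
          and g = "\<lambda>((x, a), b). ([True], a, b)"]]; (auto; fail)?)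
        done
    qed auto
    then show ?case by (rule ppt_fun_cong) auto
  qed auto
  then show ?thesis
    by (rule ppt_fun_cong) (auto simp: tests_def map_pmf_def bind_assoc_pmf bind_return_pmf head_def)
qed

definition game :: "nat \<Rightarrow> nat \<Rightarrow> bool list \<Rightarrow> bool list pmf" where
  "game d l y = do {
     N \<leftarrow> iterM (d * sym_len B l) double_coin [];
     v \<leftarrow> training l y (length N);
     w \<leftarrow> descr l v;
     tests l y (ev l w)}"

lemma ppt_game:
  assumes "\<And>l. l0 \<le> l \<Longrightarrow> good B l \<and> 2 ^ (d * sym_len B l) \<le> poly q l"
  shows "ppt_fun (\<lambda>(l, y). [unary l, y]) (\<lambda>(l, y). game d l y) {(l, y). l0 \<le> l}"
proof -
  let ?A2 = "{(l :: nat, y :: bool list, v). good B l \<and> v \<in> samples l}"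
  \<comment> \<open>The stages are composed from the last to the first, each with the earlier values
    as registers. The promise \<open>v \<in> samples l\<close> reflects that the learner is
    guaranteed to halt only on genuine samples.\<close>
  have 2: "ppt_fun (\<lambda>(l, y, v). [unary l, y, v]) (\<lambda>x. bind_pmf (case (fst x, snd (snd x)) of (l, v) \<Rightarrow> descr l v)
      (\<lambda>w. tests (fst x) (fst (snd x)) (ev (fst x) w))) ?A2"
  proof (rule ppt_fun_bind[OF ppt_descr, where n = 3 and js = "[0, 2]"], goal_cases)
    case 4
    show ?case
      by (rule ppt_fun_cong[OF ppt_fun_call[OF ppt_tests, where A = "{(x, w). x \<in> ?A2}" and n = 4 and js = "[0, 1, 3]"
          and inp = "\<lambda>((l, y, v), w). [unary l, y, v, w]" and g = "\<lambda>((l, y, v), w). (l, y, w)"]]) auto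
  qed auto
  let ?A3 = "{(l :: nat, y :: bool list, N :: bool list). good B l}"
  have 3: "ppt_fun (\<lambda>(l, y, N). [unary l, y, N]) (\<lambda>x. bind_pmf (case x of (l, y, N) \<Rightarrow> training l y (length N))
      (\<lambda>v. bind_pmf (descr (fst x) v) (\<lambda>w. tests (fst x) (fst (snd x)) (ev (fst x) w)))) ?A3"
  proof (rule ppt_fun_bind[OF ppt_training, where n = 3 and js = "[0, 1, 2]" and g = "\<lambda>x. x"], goal_cases)
    case 4
    show ?case
      by (rule ppt_fun_cong[OF ppt_fun_call[OF 2, where A = "{(x, v). x \<in> ?A3 \<and> v \<in> samples (fst x)}" and n = 4 and js = "[0, 1, 3]"
          and inp = "\<lambda>((l, y, N), v). [unary l, y, N, v]" and g = "\<lambda>((l, y, N), v). (l, y, v)"]])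
        (use subsetD[OF training_samples] in auto)
  qed auto
  let ?A4 = "{(l :: nat, y :: bool list). l0 \<le> l}"
  let ?K = "\<lambda>l. unary (d * sym_len B l)"
  have K: "ppt_fun (\<lambda>l. [unary l]) (\<lambda>l. return_pmf (?K l)) UNIV"
    by (intro ppt_unary_mult[where n = 1] ppt_length_funs ppt_unary_const[where n = 1]) auto
  have R: "ppt_fun (\<lambda>(l, v). [unary l, v]) (\<lambda>(l, v). iterM (length v) double_coin []) {(l, v). l0 \<le> l \<and> v = ?K l}"
    by (rule ppt_random_nat) (use assms in auto)
  have 4: "ppt_fun (\<lambda>(l, y). [unary l, y, ?K l]) (\<lambda>x. bind_pmf (case (fst x, ?K (fst x)) of (l, v) \<Rightarrow> iterM (length v) double_coin [])
      (\<lambda>N. bind_pmf (training (fst x) (snd x) (length N)) (\<lambda>v. bind_pmf (descr (fst x) v) (\<lambda>w. tests (fst x) (snd x) (ev (fst x) w))))) ?A4"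
  proof (rule ppt_fun_bind[OF R, where n = 3 and js = "[0, 2]"], goal_cases)
    case 4
    show ?case
      by (rule ppt_fun_cong[OF ppt_fun_call[OF 3, where A = "{(x, N). x \<in> ?A4}" and n = 4 and js = "[0, 1, 3]"
          and inp = "\<lambda>((l, y), N). [unary l, y, ?K l, N]" and g = "\<lambda>((l, y), N). (l, y, N)"]])
        (use assms in auto)
  qed auto
  show ?thesis
    by (rule ppt_fun_let[OF K, where n = 2 and js = "[0]" and g = fst and v = "\<lambda>(l, y). ?K l"])
      (auto intro!: ppt_fun_cong[OF 4] simp: game_def)
qed

section \<open>The game in terms of the learner alone\<close>

definition trained :: "nat \<Rightarrow> bool list \<Rightarrow> nat \<Rightarrow> (point \<Rightarrow> bool) pmf" where
  "trained l y N = bind_pmf (replicate_pmf N (point_dist B l (unary l))) (\<lambda>S. L l (label (lab B l y) S))"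

lemma label_labeled_sets:
  "S \<in> set_pmf (replicate_pmf N (point_dist B l (unary l))) \<Longrightarrow> label h S \<in> labeled_sets (instances B) l"
  using set_point_dist[of l] by (auto simp: set_replicate_pmf labeled_sets_def label_def lists_eq_set)

text \<open>Test points are instances, so the evaluator may be restricted to
  \<open>instances B l\<close>; what remains of a description is its model, whose law is given by
  \<open>L\<close>. From here on the acceptance probability can be studied without programs.\<close>

lemma game_eq:
  "game d l y = bind_pmf (iterM (d * sym_len B l) double_coin []) (\<lambda>N. bind_pmf (trained l y (length N)) (tests l y))"
proof -
  have *: "tests l y (ev l w) = tests l y (restrict (ev l w) (instances B l))" for w
    unfolding tests_def by (intro bind_pmf_cong) (auto simp: err_def point_of_instances)
  have "bind_pmf (training l y N) (\<lambda>v. bind_pmf (descr l v) (\<lambda>w. tests l y (ev l w))) = bind_pmf (trained l y N) (tests l y)" for N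
    unfolding training_eq trained_def bind_map_pmf bind_assoc_pmf
  proof (intro bind_pmf_cong refl)
    fix S assume "S \<in> set_pmf (replicate_pmf N (point_dist B l (unary l)))"
    from map_descr[OF label_labeled_sets[OF this], symmetric]
    show "bind_pmf (descr l (encode_data point_rep (label (lab B l y) S))) (\<lambda>w. tests l y (ev l w))
        = bind_pmf (L l (label (lab B l y) S)) (tests l y)"
      by (simp add: * bind_map_pmf)
  qed
  then show ?thesis by (simp add: game_def)
qed

end

section \<open>Its acceptance probability\<close>

lemma expectation_bind_unif:
  fixes h :: "'b \<Rightarrow> real"
  assumes "\<And>u. u \<in> bitstrings r \<Longrightarrow> finite (set_pmf (f u))"
  shows "measure_pmf.expectation (bind_pmf (unif r) f) h =
    measure_pmf.expectation (unif r) (\<lambda>u. measure_pmf.expectation (f u) h)"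
  using assms unfolding expectation_unif
  by (subst pmf_expectation_bind[of "bitstrings r"]) (auto simp: unif_def sum_divide_distrib)

lemma expectation_unif_swap:
  fixes h :: "bool list \<Rightarrow> bool list \<Rightarrow> real"
  shows "measure_pmf.expectation (unif r) (\<lambda>u. measure_pmf.expectation (unif t) (h u))
    = measure_pmf.expectation (unif t) (\<lambda>v. measure_pmf.expectation (unif r) (\<lambda>u. h u v))"
  unfolding expectation_unif sum_divide_distrib by (subst sum.swap) (simp add: mult.commute)

text \<open>\<open>u2\<close> is moved innermost: on points of the distribution the label does not
  depend on it, and averaging over it turns the model into a bounded function of \<open>u1\<close>
  and the message.\<close>

lemma expectation_seed_dist:
  fixes h :: "bool list \<times> bool list \<times> bool list \<Rightarrow> real"
  shows "measure_pmf.expectation (seed_dist B l) h =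
    measure_pmf.expectation (unif (seed1 B l)) (\<lambda>u1.
    measure_pmf.expectation (unif (msg_len B l * sym_len B l)) (\<lambda>v.
    measure_pmf.expectation (unif (seed2 B l)) (\<lambda>u2. h (u1, u2, v))))"
  unfolding seed_dist_def
  by (simp add: expectation_bind_unif expectation_unif_swap[of "seed2 B l"])

lemma integrable_pmf_bounded:
  fixes f :: "'a \<Rightarrow> real"
  assumes "\<And>x. 0 \<le> f x" "\<And>x. f x \<le> b"
  shows "integrable (measure_pmf M) f"
  by (rule measure_pmf.integrable_const_bound[where B = b]) (use assms in auto)

lemma expectation_bounds:
  fixes f :: "'a \<Rightarrow> real"
  assumes "\<And>x. 0 \<le> f x" "\<And>x. f x \<le> b"
  shows "0 \<le> measure_pmf.expectation M f" "measure_pmf.expectation M f \<le> b"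
  using assms integrable_pmf_bounded[OF assms]
  by (auto intro!: integral_nonneg measure_pmf.integral_le_const)

lemma jensen_square:
  fixes g :: "'a \<Rightarrow> real"
  assumes "\<And>x. 0 \<le> g x" "\<And>x. g x \<le> 1"
  shows "(measure_pmf.expectation M g - a)\<^sup>2 \<le> measure_pmf.expectation M (\<lambda>x. (g x - a)\<^sup>2)"
proof -
  have "\<bar>g x - a\<bar> \<le> 1 + \<bar>a\<bar>" for x using assms[of x] by (simp add: abs_if)
  then have bd: "(g x - a)\<^sup>2 \<le> (1 + \<bar>a\<bar>)\<^sup>2" for x by (metis abs_le_square_iff abs_of_nonneg add_nonneg_nonneg abs_ge_zero zero_le_one)
  have i1: "integrable (measure_pmf M) g"
    by (rule measure_pmf.integrable_const_bound[where B = 1]) (use assms in auto)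
  have i2: "integrable (measure_pmf M) (\<lambda>x. (g x - a)\<^sup>2)"
    by (rule measure_pmf.integrable_const_bound[where B = "(1 + \<bar>a\<bar>)\<^sup>2"]) (use bd in auto)
  have i3: "integrable (measure_pmf M) (\<lambda>x. g x - a)" using i1 by simp
  have "(measure_pmf.expectation M (\<lambda>x. g x - a))\<^sup>2 \<le> measure_pmf.expectation M (\<lambda>x. (g x - a)\<^sup>2)"
    by (rule measure_pmf.jensens_inequality[OF i3, where I = UNIV]) (use i2 in \<open>auto simp: convex_power2\<close>)
  then show ?thesis using i1 by simp
qed

lemma risk_bounds: "0 \<le> risk h D f" "risk h D f \<le> 1"
  by (simp_all add: risk_def)

text \<open>No constant factor is required from 2 on: a coefficient \<open>a\<close> is absorbed by
  \<open>a < 2 ^ a \<le> x ^ a\<close>, and the sum of two terms by one further factor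
  \<open>x\<close>.\<close>

lemma nat_poly_less_power:
  fixes p :: "nat poly"
  shows "\<exists>k. \<forall>x\<ge>2. poly p x < x ^ k"
proof (induction p)
  case 0
  show ?case by (intro exI[of _ 0]) simp
next
  case (pCons a p)
  then obtain k where k: "\<And>x. x \<ge> 2 \<Longrightarrow> poly p x < x ^ k" by blast
  have "poly (pCons a p) x < x ^ (a + k + 2)" if x: "x \<ge> 2" for x
  proof -
    have "a < 2 ^ a" by simp
    also have "\<dots> \<le> x ^ a" using x by (intro power_mono) auto
    also have "\<dots> \<le> x ^ (a + k + 1)" using x by (intro power_increasing) auto
    finally have 1: "a < x ^ (a + k + 1)" .
    have "x * poly p x \<le> x * x ^ k" using k[OF x] by (intro mult_left_mono) auto
    also have "x * x ^ k = x ^ (k + 1)" by simp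
    also have "\<dots> \<le> x ^ (a + k + 1)" using x by (intro power_increasing) auto
    finally have "poly (pCons a p) x < x ^ (a + k + 1) + x ^ (a + k + 1)"
      using 1 unfolding poly_pCons by linarith
    also have "\<dots> = 2 * x ^ (a + k + 1)" by simp
    also have "\<dots> \<le> x * x ^ (a + k + 1)" using x by (intro mult_right_mono) auto
    finally show ?thesis by simp
  qed
  then show ?case by blast
qed

context learning
begin

abbreviation D\<^sub>0 :: "nat \<Rightarrow> point pmf" where
  "D\<^sub>0 l \<equiv> point_dist B l (unary l)"

lemma risk_eq_err: "risk (lab B l y) (D\<^sub>0 l) f = measure_pmf.prob (seed_dist B l) {a. err l y f a}"
  by (simp add: risk_def point_dist_unary err_def vimage_def)

text \<open>Two independent events of probability \<rho> both occur or both fail with probability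
  \<rho>^2 + (1 - \<rho>)^2.\<close>

lemma pmf_tests: "pmf (tests l y f) [True] = 1 / 2 + 2 * (risk (lab B l y) (D\<^sub>0 l) f - 1 / 2)\<^sup>2"
proof -
  let ?S = "seed_dist B l" and ?E = "{a. err l y f a}"
  define \<rho> where "\<rho> = measure_pmf.prob ?S ?E"
  have inner: "pmf (bind_pmf ?S (\<lambda>b. return_pmf [e = err l y f b])) [True] = 1 - \<rho> + (2 * \<rho> - 1) * of_bool e" for e
  proof -
    have "pmf (bind_pmf ?S (\<lambda>b. return_pmf [e = err l y f b])) [True] = measure_pmf.prob ?S {b. e = err l y f b}"
      unfolding map_pmf_def[symmetric] by (simp add: pmf_map vimage_def)
    moreover have "{b. \<not> err l y f b} = space (measure_pmf ?S) - ?E" by auto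
    then have "measure_pmf.prob ?S {b. \<not> err l y f b} = 1 - \<rho>"
      using measure_pmf.prob_compl[of ?E ?S] by (simp add: \<rho>_def)
    ultimately show ?thesis by (cases e) (simp_all add: \<rho>_def)
  qed
  have "pmf (tests l y f) [True] = measure_pmf.expectation ?S (\<lambda>a. 1 - \<rho> + (2 * \<rho> - 1) * indicator ?E a)"
    unfolding tests_def by (subst pmf_bind) (simp only: inner, simp add: indicator_def of_bool_def)
  also have "\<dots> = 1 - \<rho> + (2 * \<rho> - 1) * \<rho>"
    by (subst Bochner_Integration.integral_add)
       (auto simp: \<rho>_def intro!: integrable_mult_right measure_pmf.integrable_const_bound[where B = 1])
  also have "\<dots> = 1 / 2 + 2 * (\<rho> - 1 / 2)\<^sup>2"
    by (simp add: power2_eq_square algebra_simps)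
  finally show ?thesis by (simp add: \<rho>_def risk_eq_err)
qed

text \<open>Half of the excess over 1/2 of the acceptance probability at sample size
  \<open>N\<close>.\<close>

definition advantage :: "nat \<Rightarrow> bool list \<Rightarrow> nat \<Rightarrow> real" where
  "advantage l y N = measure_pmf.expectation (trained l y N) (\<lambda>f. (risk (lab B l y) (D\<^sub>0 l) f - 1 / 2)\<^sup>2)"

lemma square_risk_le: "(risk h D f - 1 / 2)\<^sup>2 \<le> 1"
  using risk_bounds[of h D f] by (intro abs_square_le_1[THEN iffD2]) auto

lemma advantage_bounds: "0 \<le> advantage l y N" "advantage l y N \<le> 1"
  unfolding advantage_def by (auto intro!: expectation_bounds square_risk_le)

lemma pmf_game:
  "pmf (game d l y) [True] =
     measure_pmf.expectation (iterM (d * sym_len B l) double_coin []) (\<lambda>N. 1 / 2 + 2 * advantage l y (length N))"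
proof -
  have "pmf (bind_pmf (trained l y n) (tests l y)) [True] = 1 / 2 + 2 * advantage l y n" for n
    unfolding pmf_bind pmf_tests advantage_def
    by (subst Bochner_Integration.integral_add)
       (auto intro!: integrable_mult_right integrable_pmf_bounded[where b = 1] square_risk_le)
  then show ?thesis
    by (simp add: game_eq pmf_bind[of "iterM _ _ _"])
qed

text \<open>The mean risk is more than 1/6 below 1/2, and the mean of a square is at least the
  square of the mean, which gives (1/6)^2 = 1/36.\<close>

lemma advantage_prg:
  assumes g: "good B l" and s: "s \<in> bitstrings l"
    and \<epsilon>: "eps_learns (distributions B) (hypotheses B) L \<epsilon>" "\<epsilon> l n < 1 / 3"
  shows "1 / 36 \<le> advantage l (prg1 B s) n"
proof -
  let ?h = "hyp B l s"
  have lab: "lab B l (prg1 B s) x = ?h x" if x: "x \<in> set_pmf (D\<^sub>0 l)" for x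
    using x lab_hyp[OF g _ s] by (auto simp: point_dist_unary)
  have "risk (lab B l (prg1 B s)) (D\<^sub>0 l) = risk ?h (D\<^sub>0 l)"
    unfolding risk_def by (intro ext measure_pmf.finite_measure_eq_AE) (auto simp: AE_measure_pmf_iff lab)
  moreover have "trained l (prg1 B s) n = bind_pmf (replicate_pmf n (D\<^sub>0 l)) (\<lambda>S. L l (label ?h S))"
    unfolding trained_def
  proof (intro bind_pmf_cong refl)
    fix S assume "S \<in> set_pmf (replicate_pmf n (D\<^sub>0 l))"
    then have "label (lab B l (prg1 B s)) S = label ?h S"
      by (auto simp: label_def set_replicate_pmf lab lists_eq_set)
    then show "L l (label (lab B l (prg1 B s)) S) = L l (label ?h S)" by simp
  qed
  moreover have "measure_pmf.expectation (bind_pmf (replicate_pmf n (D\<^sub>0 l)) (\<lambda>S. L l (label ?h S))) (risk ?h (D\<^sub>0 l)) \<le> \<epsilon> l n"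
    using \<epsilon>(1) point_dist_in_distributions[of l] s unfolding eps_learns_def hypotheses_def by blast
  ultimately have r: "measure_pmf.expectation (trained l (prg1 B s) n) (risk (lab B l (prg1 B s)) (D\<^sub>0 l)) < 1 / 3"
    using \<epsilon>(2) by simp
  have "(1 / 6 :: real)\<^sup>2 \<le> (1 / 2 - measure_pmf.expectation (trained l (prg1 B s) n) (risk (lab B l (prg1 B s)) (D\<^sub>0 l)))\<^sup>2"
    using r by (intro power_mono) auto
  also have "\<dots> = (measure_pmf.expectation (trained l (prg1 B s) n) (risk (lab B l (prg1 B s)) (D\<^sub>0 l)) - 1 / 2)\<^sup>2"
    by (rule power2_commute)
  also have "\<dots> \<le> advantage l (prg1 B s) n"
    unfolding advantage_def by (rule jensen_square) (rule risk_bounds)+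
  finally show ?thesis by (simp add: power2_eq_square)
qed

text \<open>The size \<open>n\<close> is drawn with probability at least
  \<open>1 / 2 ^ (d * sym_len B l)\<close> and then contributes 2 * 1/36 = 1/18; the contributions
  of the other sizes are nonnegative.\<close>

lemma game_prg:
  assumes g: "good B l" and s: "s \<in> bitstrings l"
    and \<epsilon>: "eps_learns (distributions B) (hypotheses B) L \<epsilon>" "\<epsilon> l n < 1 / 3"
    and n: "n < 2 ^ (d * sym_len B l)"
  shows "1 / 2 + 1 / 18 / 2 ^ (d * sym_len B l) \<le> pmf (game d l (prg1 B s)) [True]"
proof -
  let ?N = "iterM (d * sym_len B l) double_coin []"
  have "1 / 2 ^ (d * sym_len B l) \<le> pmf ?N (unary n)"
    using pmf_iterM_double_coin[of "d * sym_len B l" 0 n] n by (simp add: unary_def)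
  moreover have int: "integrable (measure_pmf ?N) (indicator {unary n} :: _ \<Rightarrow> real)"
    by (rule integrable_pmf_bounded[where b = 1]) (auto simp: indicator_def)
  ultimately have "1 / 2 + 1 / 18 / 2 ^ (d * sym_len B l) \<le> 1 / 2 + 1 / 18 * pmf ?N (unary n)" by simp
  also have "\<dots> = measure_pmf.expectation ?N (\<lambda>v. 1 / 2 + 1 / 18 * indicator {unary n} v)"
    using int by (subst Bochner_Integration.integral_add) (auto simp: measure_pmf_single)
  also have "\<dots> \<le> measure_pmf.expectation ?N (\<lambda>v. 1 / 2 + 2 * advantage l (prg1 B s) (length v))"
  proof (intro integral_mono integrable_pmf_bounded[where b = 3])
    show "1 / 2 + 1 / 18 * indicator {unary n} v \<le> 1 / 2 + 2 * advantage l (prg1 B s) (length v)" for v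
      using advantage_bounds[of l "prg1 B s" "length v"] advantage_prg[OF g s \<epsilon>]
      by (auto simp: indicator_def)
    show "1 / 2 + 2 * advantage l (prg1 B s) (length v) \<le> 3" for v
      using advantage_bounds(2)[of l "prg1 B s" "length v"] by simp
  qed (use advantage_bounds[of l "prg1 B s"] in \<open>auto simp: indicator_def\<close>)
  finally show ?thesis by (simp add: pmf_game)
qed

text \<open>The indicator of an error is (1 - a b)/2 for the signs a and b of prediction and label,
  and the average over \<open>u2\<close> affects the prediction only. The right-hand side has the
  form to which the sampler guarantee applies.\<close>

lemma risk_correlation:
  assumes g: "good B l" and y: "y \<in> bitstrings (alpha B l)"
  shows "risk (lab B l y) (D\<^sub>0 l) f - 1 / 2 = - (1 / 2) *
    measure_pmf.expectation (unif (seed1 B l)) (\<lambda>u1.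
    measure_pmf.expectation (unif (msg_len B l * sym_len B l)) (\<lambda>v.
      measure_pmf.expectation (unif (seed2 B l)) (\<lambda>u2. bit_sign (f (point_of B l (u1, u2, v))))
        * bit_sign (inner_F2 v (nths y (samp1 B l u1)))))"
proof -
  let ?S = "seed_dist B l"
  let ?e = "\<lambda>a. bit_sign (f (point_of B l a)) * bit_sign (lab B l y (point_of B l a))"
  have "risk (lab B l y) (D\<^sub>0 l) f = measure_pmf.expectation ?S (indicator {a. err l y f a})"
    unfolding risk_eq_err by simp
  also have "\<dots> = measure_pmf.expectation ?S (\<lambda>a. 1 / 2 - 1 / 2 * ?e a)"
    by (intro Bochner_Integration.integral_cong) (auto simp: err_def bit_sign_def)
  also have "\<dots> = 1 / 2 - 1 / 2 * measure_pmf.expectation ?S ?e"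
    by (subst Bochner_Integration.integral_diff) (auto intro!: integrable_measure_pmf_finite simp: seeds_def)
  also have "measure_pmf.expectation ?S ?e =
    measure_pmf.expectation (unif (seed1 B l)) (\<lambda>u1.
    measure_pmf.expectation (unif (msg_len B l * sym_len B l)) (\<lambda>v.
    measure_pmf.expectation (unif (seed2 B l)) (\<lambda>u2.
      bit_sign (f (point_of B l (u1, u2, v))) * bit_sign (inner_F2 v (nths y (samp1 B l u1))))))"
    unfolding expectation_seed_dist expectation_unif
    using g y by (auto intro!: sum.cong arg_cong2[where f = "(/)"] simp: lab_point_of_inner seeds_def bitstrings_def)
  finally show ?thesis by (simp add: mult.commute)
qed

text \<open>At a fixed sample size, training is a random map from secrets to models of a class of
  size at most 2^(\<alpha>/2), so the compression bound applies. Averaging over the sizes comes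
  last, and the bound does not depend on \<open>d\<close>.\<close>

lemma game_random:
  assumes g: "good B l"
    and s: "sampler (seed1 B l) (alpha B l) (msg_len B l * sym_len B l) (samp1 B l) (kappa1 B l) \<delta>" "0 \<le> \<delta>"
    and \<kappa>: "kappa1 B l \<le> 1 / 4"
    and \<Phi>: "finite (\<Union>S\<in>labeled_sets (instances B) l. set_pmf (L l S))"
      "real (card (\<Union>S\<in>labeled_sets (instances B) l. set_pmf (L l S))) \<le> 2 powr (real (alpha B l) / 2)"
  shows "pmf (bind_pmf (unif (alpha B l)) (game d l)) [True]
    \<le> 1 / 2 + 2 * (2 powr (- real (alpha B l) / 8) + (2 powr (- real (msg_len B l * sym_len B l) / 8) + \<delta>))"
    (is "_ \<le> 1 / 2 + 2 * (_ + ?\<eta>)")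
proof -
  let ?M = "alpha B l" and ?t = "msg_len B l * sym_len B l"
  have corr: "measure_pmf.expectation X (\<lambda>y. (risk (lab B l y) (D\<^sub>0 l) f - 1 / 2)\<^sup>2) \<le> ?\<eta>"
    if X: "set_pmf X \<subseteq> bitstrings ?M" "3 / 8 * real ?M \<le> min_entropy X" for f X
  proof -
    define e where "e = (\<lambda>u1 v. measure_pmf.expectation (unif (seed2 B l)) (\<lambda>u2. bit_sign (f (point_of B l (u1, u2, v)))))"
    define C where "C = (\<lambda>y. measure_pmf.expectation (unif (seed1 B l)) (\<lambda>u1.
      measure_pmf.expectation (unif ?t) (\<lambda>v. e u1 v * bit_sign (inner_F2 v (nths y (samp1 B l u1))))))"
    have e1: "\<bar>e u v\<bar> \<le> 1" for u v
    proof -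
      have "\<bar>\<Sum>u2\<in>bitstrings (seed2 B l). bit_sign (f (point_of B l (u, u2, v)))\<bar> \<le> (\<Sum>u2\<in>bitstrings (seed2 B l). 1)"
        by (rule order_trans[OF sum_abs]) simp
      then show ?thesis by (simp add: e_def expectation_unif)
    qed
    have fin: "finite (set_pmf X)" by (rule finite_subset[OF X(1)]) simp
    have "measure_pmf.expectation X (\<lambda>y. (risk (lab B l y) (D\<^sub>0 l) f - 1 / 2)\<^sup>2)
        = measure_pmf.expectation X (\<lambda>y. 1 / 4 * (C y)\<^sup>2)"
    proof (intro integral_cong_AE)
      show "AE y in X. (risk (lab B l y) (D\<^sub>0 l) f - 1 / 2)\<^sup>2 = 1 / 4 * (C y)\<^sup>2"
        using X(1) risk_correlation[OF g, of _ f]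
        by (auto simp: AE_measure_pmf_iff C_def e_def power2_eq_square)
    qed auto
    also have "\<dots> \<le> measure_pmf.expectation X (\<lambda>y. (C y)\<^sup>2)"
      by (intro integral_mono integrable_measure_pmf_finite fin) simp
    also have "\<dots> \<le> 2 powr (- (3 / 8 - kappa1 B l) * real ?t) + \<delta>"
      unfolding C_def by (rule sampler_correlation_bound[OF s(1) e1 X])
    \<comment> \<open>The surviving entropy rate is at least 3/8 - 1/4 = 1/8.\<close>
    also have "2 powr (- (3 / 8 - kappa1 B l) * real ?t) \<le> 2 powr (- real ?t / 8)"
    proof (intro powr_mono)
      have "real ?t * (1 / 8) \<le> real ?t * (3 / 8 - kappa1 B l)" using \<kappa> by (intro mult_left_mono) auto
      then show "- (3 / 8 - kappa1 B l) * real ?t \<le> - real ?t / 8" by (simp add: algebra_simps)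
    qed simp
    finally show ?thesis by simp
  qed
  have adv: "measure_pmf.expectation (unif ?M) (\<lambda>y. advantage l y n) \<le> 2 powr (- real ?M / 8) + ?\<eta>" for n
    unfolding advantage_def
  proof (rule compression_bound[OF \<Phi>])
    show "set_pmf (trained l y n) \<subseteq> (\<Union>S\<in>labeled_sets (instances B) l. set_pmf (L l S))" for y
      using label_labeled_sets unfolding trained_def set_bind_pmf by blast
  qed (use corr s(2) in \<open>simp_all add: square_risk_le\<close>)
  let ?N = "iterM (d * sym_len B l) double_coin []"
  have "pmf (bind_pmf (unif ?M) (game d l)) [True]
      = (\<Sum>y\<in>bitstrings ?M. measure_pmf.expectation ?N (\<lambda>N. 1 / 2 + 2 * advantage l y (length N))) / 2 ^ ?M"
    unfolding pmf_bind pmf_game expectation_unif ..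
  also have "\<dots> = measure_pmf.expectation ?N (\<lambda>N. (\<Sum>y\<in>bitstrings ?M. 1 / 2 + 2 * advantage l y (length N)) / 2 ^ ?M)"
    unfolding integral_divide_zero
  proof (rule arg_cong[where f = "\<lambda>x. x / _"], rule Bochner_Integration.integral_sum[symmetric])
    show "integrable (measure_pmf ?N) (\<lambda>N. 1 / 2 + 2 * advantage l y (length N))" for y
    proof (rule integrable_pmf_bounded[where b = 3])
      show "0 \<le> 1 / 2 + 2 * advantage l y (length N)" "1 / 2 + 2 * advantage l y (length N) \<le> 3" for N :: "bool list"
        using advantage_bounds[of l y "length N"] by simp_all
    qed
  qed
  also have "\<dots> = measure_pmf.expectation ?N (\<lambda>N. 1 / 2 + 2 * measure_pmf.expectation (unif ?M) (\<lambda>y. advantage l y (length N)))"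
    by (simp add: expectation_unif sum.distrib sum_distrib_left add_divide_distrib)
  also have "\<dots> \<le> 1 / 2 + 2 * (2 powr (- real ?M / 8) + ?\<eta>)"
  proof (rule measure_pmf.integral_le_const)
    show "integrable (measure_pmf ?N) (\<lambda>N. 1 / 2 + 2 * measure_pmf.expectation (unif ?M) (\<lambda>y. advantage l y (length N)))"
    proof (rule integrable_pmf_bounded[where b = 3])
      show "0 \<le> 1 / 2 + 2 * measure_pmf.expectation (unif ?M) (\<lambda>y. advantage l y (length N))"
        "1 / 2 + 2 * measure_pmf.expectation (unif ?M) (\<lambda>y. advantage l y (length N)) \<le> 3" for N :: "bool list"
        using expectation_bounds[where f = "\<lambda>y. advantage l y (length N)" and M = "unif ?M", OF advantage_bounds]
        by simp_all
    qed
  qed (intro AE_I2 add_left_mono mult_left_mono adv, simp_all)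
  finally show ?thesis .
qed

end

lemma exp_powr_two: "2 powr (- x) = exp (- (ln 2 * x))" for x :: real
  by (simp add: powr_def mult.commute)

context construction
begin

section \<open>Asymptotics of the error terms\<close>

definition sampler_error :: "real \<Rightarrow> nat \<Rightarrow> real" where
  "sampler_error c l = exp (- c * real (alpha B l) * kappa1 B l) + exp (- (real (alpha B l) powr kappa2 B))"

lemma eventually_sym_len:
  obtains c1 c2 where "0 < c1" "0 < c2"
    "\<forall>\<^sub>F l in sequentially. c1 * ln (real l) \<le> real (sym_len B l) \<and> real (sym_len B l) \<le> c2 * ln (real l)"
proof -
  have "(\<lambda>l. real (sym_len B l)) \<in> \<Theta>(\<lambda>l. ln (real l))"
    using blocks unfolding building_blocks_def by (elim conjE)
  then obtain c1 c2 where c: "0 < c1" "0 < c2"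
    "\<forall>\<^sub>F l in sequentially. norm (real (sym_len B l)) \<le> c2 * norm (ln (real l))"
    "\<forall>\<^sub>F l in sequentially. c1 * norm (ln (real l)) \<le> norm (real (sym_len B l))"
    unfolding bigtheta_def bigo_def bigomega_def by blast
  have "\<forall>\<^sub>F l in sequentially. c1 * ln (real l) \<le> real (sym_len B l) \<and> real (sym_len B l) \<le> c2 * ln (real l)"
    using c(3,4) eventually_ge_at_top[of 1] by eventually_elim simp
  with c(1,2) show ?thesis by (rule that)
qed

text \<open>Each of the four terms is at most \<open>1 / real l ^ C\<close>, because its exponent
  outgrows \<open>C * ln l\<close>: \<open>alpha\<close> exceeds \<open>l\<close>, the message has
  at least R l^a - 1 bits with a > 0, \<open>alpha * kappa1\<close> dominates \<open>ln\<close>, and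
  \<open>alpha powr kappa2\<close> is at least a fixed positive power of \<open>l\<close>.\<close>

lemma eventually_error_small:
  assumes c: "0 < c"
  shows "\<forall>\<^sub>F l in sequentially. 2 powr (- real (alpha B l) / 8)
      + (2 powr (- real (msg_len B l * sym_len B l) / 8) + sampler_error c l) \<le> 4 / real l ^ C"
proof -
  have bl: "\<forall>\<^sub>F l in sequentially. code_len B l < l \<and> l < alpha B l \<and> alpha B l < beta B l"
    "poly_related (code_len B)" "0 < rate B"
    "(\<lambda>l. real (alpha B l) * kappa1 B l) \<in> \<omega>(\<lambda>l. ln (real l))" "0 < kappa2 B"
    "\<forall>\<^sub>F l in sequentially. 0 < kappa1 B l \<and> kappa1 B l \<le> 1 / 4"
    using blocks unfolding building_blocks_def by - (elim conjE, assumption)+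
  obtain a b where a: "0 < a" and ab: "\<forall>\<^sub>F l in sequentially. real l powr a \<le> real (code_len B l) \<and> real (code_len B l) \<le> real l powr b"
    using bl(2) unfolding poly_related_def by blast
  obtain c1 c2 where c1: "0 < c1" "\<forall>\<^sub>F l in sequentially. c1 * ln (real l) \<le> real (sym_len B l) \<and> real (sym_len B l) \<le> c2 * ln (real l)"
    by (rule eventually_sym_len)
  define R where "R = rate B"
  define k where "k = kappa2 B"
  have Rk: "0 < R" "0 < k" using bl by (simp_all add: R_def k_def)
  have 3: "\<forall>\<^sub>F l in sequentially. (real C + 1) / c * norm (ln (real l)) \<le> norm (real (alpha B l) * kappa1 B l)"
    using landau_omega.smallD[OF bl(4), of "(real C + 1) / c"] c by simp
  have r1: "\<forall>\<^sub>F l in sequentially. real C * ln (real l) \<le> ln 2 * (real l / 8)"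
    by real_asymp
  have r2: "\<forall>\<^sub>F l in sequentially. real C * ln (real l) \<le> ln 2 * ((R * real l powr a - 1) / 8)"
    using Rk(1) a by real_asymp
  have r4: "\<forall>\<^sub>F l in sequentially. real C * ln (real l) \<le> real l powr k"
    using Rk(2) by real_asymp
  have r5: "\<forall>\<^sub>F l in sequentially. 0 < c1 * ln (real l)"
    using c1(1) by real_asymp
  from bl(1) bl(6) ab c1(2) 3 r1 r2 r4 r5 eventually_gt_at_top[of 0] show ?thesis
  proof eventually_elim
    case (elim l)
    have expC: "exp (- x) \<le> 1 / real l ^ C" if "real C * ln (real l) \<le> x" for x
    proof -
      have "exp (- x) \<le> exp (- (real C * ln (real l)))" using that by simp
      also have "\<dots> = 1 / real l ^ C"
        using elim by (simp add: exp_minus exp_of_nat_mult inverse_eq_divide)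
      finally show ?thesis .
    qed
    have powC: "2 powr (- x / 8) \<le> 1 / real l ^ C" if "real C * ln (real l) \<le> ln 2 * (x / 8)" for x
      using expC[OF that] exp_powr_two[of "x / 8"] by simp
    have "real C * ln (real l) \<le> ln 2 * (real l / 8)" using elim by blast
    also have "\<dots> \<le> ln 2 * (real (alpha B l) / 8)"
      using elim by (intro mult_left_mono) auto
    finally have 1: "2 powr (- real (alpha B l) / 8) \<le> 1 / real l ^ C"
      by (rule powC)
    have "R * real l powr a - 1 \<le> R * real (code_len B l) - 1"
      using elim Rk(1) by simp
    \<comment> \<open>The floor in the message length loses less than 1.\<close>
    also have "\<dots> \<le> real (msg_len B l)"
      unfolding msg_len_def R_def by linarith
    also have "\<dots> \<le> real (msg_len B l) * real (sym_len B l)"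
    proof -
      have "0 < real (sym_len B l)" using elim by linarith
      then show ?thesis by (simp add: mult_le_cancel_left1)
    qed
    finally have "ln 2 * ((R * real l powr a - 1) / 8) \<le> ln 2 * (real (msg_len B l * sym_len B l) / 8)"
      by (intro mult_left_mono divide_right_mono) auto
    moreover have "real C * ln (real l) \<le> ln 2 * ((R * real l powr a - 1) / 8)" using elim by blast
    ultimately have 2: "2 powr (- real (msg_len B l * sym_len B l) / 8) \<le> 1 / real l ^ C"
      by (intro powC) (rule order_trans)
    have "real C * ln (real l) \<le> (real C + 1) * ln (real l)"
      using elim by (intro mult_right_mono) auto
    also have "\<dots> = c * ((real C + 1) / c * ln (real l))" using c by simp
    also have "\<dots> \<le> c * (real (alpha B l) * kappa1 B l)"
      using elim c by (intro mult_left_mono) auto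
    finally have 3: "exp (- c * real (alpha B l) * kappa1 B l) \<le> 1 / real l ^ C"
      using expC[of "c * (real (alpha B l) * kappa1 B l)"] by (simp add: mult.assoc)
    have "real l powr k \<le> real (alpha B l) powr k"
      using elim Rk(2) by (intro powr_mono2) auto
    then have 4: "exp (- (real (alpha B l) powr kappa2 B)) \<le> 1 / real l ^ C"
      using elim by (intro expC) (simp add: k_def)
    have "2 powr (- real (alpha B l) / 8) + (2 powr (- real (msg_len B l * sym_len B l) / 8) + sampler_error c l)
        \<le> 1 / real l ^ C + (1 / real l ^ C + (1 / real l ^ C + 1 / real l ^ C))"
      unfolding sampler_error_def by (intro add_mono 1 2 3 4)
    then show ?case by simp
  qed
qed

end

text \<open>Sample sizes are bounded by a polynomial because the distinguisher has to draw the
  sample itself. A contradiction is reached at each single large \<open>l\<close> at which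
  \<epsilon> drops below 1/3, so the bound holds eventually and not merely infinitely often.\<close>

theorem theorem21:
  fixes B :: blocks and L :: "point learner" and \<epsilon> :: "nat \<Rightarrow> nat \<Rightarrow> real"
  assumes "building_blocks B"
    and "efficient_learner point_rep (instances B) L"
    and "outputs_bits (instances B) L (\<lambda>l. real (alpha B l) / 2)"
    and "eps_learns (distributions B) (hypotheses B) L \<epsilon>"
  shows "\<forall>p :: nat poly. \<forall>\<^sub>F l in sequentially. \<forall>N \<le> poly p l. \<epsilon> l N \<ge> 1 / 3"
proof
  fix p :: "nat poly"
  interpret construction B by standard fact
  from assms(2) obtain ev c p0 where e:
    "poly_time (\<lambda>(l, w, x). [unary l, w, point_rep x]) (\<lambda>(l, w, x). [ev l w x]) {(l, w, x). x \<in> instances B l}"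
    "\<forall>l. \<forall>S\<in>labeled_sets (instances B) l.
       runs_within c [unary l, encode_data point_rep S] (poly p0 ((length S + 1) * (l + 1))) \<and>
       map_spmf (\<lambda>w. restrict (ev l w) (instances B l)) (run c [unary l, encode_data point_rep S])
         = spmf_of_pmf (L l S)"
    unfolding efficient_learner_def by blast
  interpret learning B L ev c p0
    by standard (use e in blast)+
  obtain c1 c2 where c12: "0 < c1" "0 < c2" and sym:
    "\<forall>\<^sub>F l in sequentially. c1 * ln (real l) \<le> real (sym_len B l) \<and> real (sym_len B l) \<le> c2 * ln (real l)"
    by (rule eventually_sym_len)
  obtain k where k: "\<And>x. 2 \<le> x \<Longrightarrow> poly p x < x ^ k"
    using nat_poly_less_power[of p] by blast
  \<comment> \<open>\<open>d\<close> makes the range of the drawn sample size reach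
    \<open>l ^ k\<close>, which exceeds \<open>poly p l\<close>; \<open>C\<close> is the degree of a
    polynomial bound on that range. They stem from the lower and the upper bound on
    \<open>sym_len\<close> by multiples of \<open>ln l\<close>.\<close>
  define d where "d = nat \<lceil>real k / (c1 * ln 2)\<rceil>"
  define C where "C = nat \<lceil>real d * c2 * ln 2\<rceil>"
  have d: "real k \<le> real d * (c1 * ln 2)"
  proof -
    have "real k / (c1 * ln 2) \<le> real d" unfolding d_def by linarith
    then show ?thesis using c12 by (simp add: pos_divide_le_eq)
  qed
  have C: "real d * c2 * ln 2 \<le> real C" unfolding C_def by linarith
  have pow: "2 ^ (d * m) = exp (real d * real m * ln 2)" for m
    by (simp add: exp_of_nat_mult[symmetric] mult.commute powr_def flip: powr_realpow)
  have range: "\<forall>\<^sub>F l in sequentially. l ^ k \<le> 2 ^ (d * sym_len B l) \<and> 2 ^ (d * sym_len B l) \<le> l ^ C"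
    using sym eventually_ge_at_top[of 1]
  proof eventually_elim
    case (elim l)
    have ln0: "0 \<le> ln (real l)" using elim by simp
    have lp: "real l ^ j = exp (real j * ln (real l))" for j
      using elim by (simp add: exp_of_nat_mult)
    have "real k * ln (real l) \<le> real d * (c1 * ln 2) * ln (real l)"
      using d ln0 by (rule mult_right_mono)
    also have "\<dots> = real d * ln 2 * (c1 * ln (real l))" by simp
    also have "\<dots> \<le> real d * ln 2 * real (sym_len B l)"
      using elim by (intro mult_left_mono) auto
    finally have 1: "real l ^ k \<le> 2 ^ (d * sym_len B l)"
      unfolding lp pow by (simp add: mult.commute mult.left_commute)
    have "real d * ln 2 * real (sym_len B l) \<le> real d * ln 2 * (c2 * ln (real l))"
      using elim by (intro mult_left_mono) auto
    also have "\<dots> = real d * c2 * ln 2 * ln (real l)" by simp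
    also have "\<dots> \<le> real C * ln (real l)"
      using C ln0 by (rule mult_right_mono)
    finally have 2: "2 ^ (d * sym_len B l) \<le> real l ^ C"
      unfolding lp pow by (simp add: mult.commute mult.left_commute)
    from 1 2 show ?case
      by (metis of_nat_le_iff of_nat_numeral of_nat_power)
  qed
  have "\<forall>\<^sub>F l in sequentially. good B l \<and> 2 ^ (d * sym_len B l) \<le> poly (monom 1 C) l"
    using eventually_good range by eventually_elim (simp add: poly_monom)
  then obtain l0 where l0: "\<And>l. l0 \<le> l \<Longrightarrow> good B l \<and> 2 ^ (d * sym_len B l) \<le> poly (monom 1 C) l"
    unfolding eventually_sequentially by blast
  from ppt_fun_distinguisher[OF ppt_game[OF l0]] obtain A where
    A: "ppt A" "\<And>l y. l0 \<le> l \<Longrightarrow> run A [unary l, y] = spmf_of_pmf (game d l y)"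
    by blast
  define real_game where "real_game = (\<lambda>l. pmf (bind_pmf (unif l) (\<lambda>s. game d l (prg1 B s))) [True])"
  define ideal_game where "ideal_game = (\<lambda>l. pmf (bind_pmf (unif (alpha B l)) (game d l)) [True])"
  have "prg (alpha B) (prg1 B)"
    using assms(1) unfolding building_blocks_def by (elim conjE)
  with A(1) have "negligible (\<lambda>l.
        \<bar>spmf (bind_pmf (unif l) (\<lambda>x. run A [unary l, prg1 B x])) [True]
         - spmf (bind_pmf (unif (alpha B l)) (\<lambda>y. run A [unary l, y])) [True]\<bar>)"
    unfolding prg_def by blast
  \<comment> \<open>The factor 36 is chosen so that indistinguishability uses up half of the gap
    \<open>1 / (18 * l ^ C)\<close> produced by the learner; the other half is left for the error of
    the ideal game.\<close>
  then have "\<forall>\<^sub>F l in sequentially. \<bar>spmf (bind_pmf (unif l) (\<lambda>x. run A [unary l, prg1 B x])) [True]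
         - spmf (bind_pmf (unif (alpha B l)) (\<lambda>y. run A [unary l, y])) [True]\<bar> < 1 / real (poly (monom 36 C) l)"
    unfolding negligible_def by (simp add: monom_eq_0_iff)
  then have secure: "\<forall>\<^sub>F l in sequentially. \<bar>real_game l - ideal_game l\<bar> < 1 / (36 * real l ^ C)"
    using eventually_ge_at_top[of l0]
    by eventually_elim (simp add: A(2) real_game_def ideal_game_def poly_monom flip: spmf_of_pmf_bind)
  have "sampler_family (seed1 B) (alpha B) (\<lambda>l. msg_len B l * sym_len B l) (samp1 B) (kappa1 B) (kappa2 B)"
    using assms(1) unfolding building_blocks_def by (elim conjE)
  then obtain cs where cs: "0 < cs" and samp: "\<forall>\<^sub>F l in sequentially.
      sampler (seed1 B l) (alpha B l) (msg_len B l * sym_len B l) (samp1 B l) (kappa1 B l) (sampler_error cs l)"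
    unfolding sampler_family_def sampler_error_def by blast
  have kap: "\<forall>\<^sub>F l in sequentially. 0 < kappa1 B l \<and> kappa1 B l \<le> 1 / 4"
    using assms(1) unfolding building_blocks_def by (elim conjE)
  \<comment> \<open>The exponent \<open>C + 1\<close> gains a factor \<open>l\<close>, and 288 = 2 *
    4 * 36 is the value from which this factor pushes the error of the ideal game below
    \<open>1 / (36 * l ^ C)\<close>.\<close>
  from secure samp kap eventually_good range eventually_error_small[OF cs, of "C + 1"]
    eventually_ge_at_top[of 2] eventually_ge_at_top[of 288]
  show "\<forall>\<^sub>F l in sequentially. \<forall>N \<le> poly p l. 1 / 3 \<le> \<epsilon> l N"
  proof eventually_elim
    case (elim l)
    show ?case
    proof (intro allI impI, rule ccontr)
      fix N assume N: "N \<le> poly p l" "\<not> 1 / 3 \<le> \<epsilon> l N"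
      have lC: "0 < real l ^ C" using elim by simp
      have "N < l ^ k" using N(1) k[of l] elim by linarith
      also have "\<dots> \<le> 2 ^ (d * sym_len B l)" using elim by blast
      finally have n: "N < 2 ^ (d * sym_len B l)" .
      have "2 ^ (d * sym_len B l) \<le> real l ^ C"
        using elim by (metis of_nat_le_iff of_nat_numeral of_nat_power)
      then have "1 / 2 + 1 / (18 * real l ^ C) \<le> 1 / 2 + 1 / 18 / 2 ^ (d * sym_len B l)"
        by (simp add: frac_le)
      also have "\<dots> \<le> real_game l"
      proof -
        let ?b = "1 / 2 + 1 / 18 / 2 ^ (d * sym_len B l) :: real"
        have "(\<Sum>s\<in>bitstrings l. ?b) / 2 ^ l \<le> real_game l"
          unfolding real_game_def pmf_bind expectation_unif
          using elim N(2) n by (intro divide_right_mono sum_mono game_prg[OF _ _ assms(4)]) auto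
        then show ?thesis by simp
      qed
      finally have 1: "1 / 2 + 1 / (18 * real l ^ C) \<le> real_game l" .
      have "ideal_game l \<le> 1 / 2 + 2 * (2 powr (- real (alpha B l) / 8)
          + (2 powr (- real (msg_len B l * sym_len B l) / 8) + sampler_error cs l))"
        unfolding ideal_game_def
        using elim assms(3) by (intro game_random) (auto simp: outputs_bits_def sampler_error_def)
      also have "\<dots> \<le> 1 / 2 + 2 * (4 / real l ^ (C + 1))"
        using elim by (intro add_left_mono mult_left_mono) auto
      also have "\<dots> \<le> 1 / 2 + 1 / (36 * real l ^ C)"
      proof -
        have "288 * real l ^ C \<le> real l * real l ^ C" using elim lC by (intro mult_right_mono) auto
        then show ?thesis using elim lC by (simp add: field_simps)
      qed
      finally have 2: "ideal_game l \<le> 1 / 2 + 1 / (36 * real l ^ C)" .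
      have "1 / (18 * real l ^ C) = 1 / (36 * real l ^ C) + 1 / (36 * real l ^ C)"
        using lC by (simp add: field_simps)
      with 1 2 elim show False by (smt (verit))
    qed
  qed
qed

end
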